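(* Let $d$ be a positive integer. For each choice of sign, the space of smooth vectors of the representation $R_{d}^{\pm}$ of $SL(2,\mathbb{R})$ on the Hilbert space $L^{2}((0,\infty),dx/x)$ is exactly $S_{d}([0,\infty))$ (functions being restricted to $(0,\infty)$).
   Context: $S([0,\infty))$: smooth functions on $[0,\infty)$ (one-sided at $0$) which, with all derivatives, are rapidly decreasing at $\infty$. $S_d([0,\infty))=\{f : f(x)=x^{(d+1)/2}f_1(x),\ f_1\in S([0,\infty))\}$. $G=SL(2,\mathbb{R})$; $n(x)=\begin{pmatrix}1&x\\ 0&1\end{pmatrix}$ ($x\in\mathbb{R}$), $s(z)=\begin{pmatrix}z&0\\ 0&z^{-1}\end{pmatrix}$ ($z\in\mathbb{R}^*$), $w=\begin{pmatrix}0&-1\\ 1&0\end{pmatrix}$; these generate $G$. $I_d$ is the space of smooth $\phi:\mathbb{R}\to\mathbb{C}$ such that $x\mapsto x^{-d-1}\phi(-1/x)$ extends to a smooth function on $\mathbb{R}$. $G$ acts on $I_d$ by $\left(\pi_d\begin{pmatrix}p & q \\ r & s\end{pmatrix}\phi\right)(x)=(rx+p)^{-d-1}\phi\left(\frac{sx+q}{rx+p}\right)$ (extended smoothly where $rx+p=0$). Put $T_d(f)(z)=(2\pi)^{-1/2}\int_{-\infty}^{\infty}|y|^{(d-1)/2}f(y)e^{iyz}dy$ and, for $\phi\in I_d$ and $y\ne0$, $M_d(\phi)(y)=|y|^{(-d+1)/2}(2\pi)^{-1/2}\int_{-\infty}^{\infty}\phi(x)e^{-ixy}dx$. Functions on $[0,\infty)$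 (or $(-\infty,0]$) are extended by zero. For $f\in S_d([0,\infty))$, $R_d^+(g)f=M_d(\pi_d(g)T_d(f))$; and $R_d^-(g)f=\rho M_d(\pi_d(g)T_d(\rho f))$ where $(\rho f)(x)=f(-x)$. Explicitly, with $\mathcal{H}_d(f)(y)=\int_0^\infty f(x)\sqrt{xy}J_d(2\sqrt{xy})\frac{dx}{x}$ ($J_d$ the classical $J$-Bessel function): $(R_d^{\pm}(n(y))f)(x)=e^{\pm iyx}f(x)$, $(R_d^{\pm}(s(z))f)(x)=\mathrm{sgn}(z)^{d+1}f(z^2x)$, $R_d^{\pm}(w)f=i^{\mp(d+1)}\mathcal{H}_d(f)$. These operators preserve $S_d([0,\infty))$ and are isometric for the $L^2((0,\infty),dx/x)$ norm, and $R_d^{\pm}$ also denotes their extension by continuity to $L^2((0,\infty),dx/x)$. A vector $v$ is smooth if $g\mapsto R_d^{\pm}(g)v$ is a smooth map from $G$ to the Hilbert space. *)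

theory Defs
  imports "HOL-Analysis.Analysis"
begin

section \<open>Square-integrable functions\<close>

definition square_integrable :: "'a measure \<Rightarrow> ('a \<Rightarrow> complex) \<Rightarrow> bool" where
  "square_integrable M f \<longleftrightarrow>
     f \<in> borel_measurable M \<and> integrable M (\<lambda>x. (cmod (f x))\<^sup>2)"

lemma square_integrable_measurable [measurable_dest]:
  "square_integrable M f \<Longrightarrow> f \<in> borel_measurable M"
  by (simp add: square_integrable_def)

lemma square_integrable_mult:
  assumes f: "square_integrable M f" and g: "square_integrable M g"
  shows "integrable M (\<lambda>x. f x * cnj (g x))"
proof (rule Bochner_Integration.integrable_bound)
  show "integrable M (\<lambda>x. (cmod (f x))\<^sup>2 + (cmod (g x))\<^sup>2)"
    using f g by (auto simp: square_integrable_def)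
  have [measurable]: "f \<in> borel_measurable M" "g \<in> borel_measurable M"
    using f g by (auto simp: square_integrable_def)
  have [measurable]: "cnj \<in> borel_measurable borel"
    by (intro borel_measurable_continuous_onI continuous_intros)
  show "(\<lambda>x. f x * cnj (g x)) \<in> borel_measurable M"
    by measurable
  have "a * b \<le> a\<^sup>2 + b\<^sup>2" if "0 \<le> a" "0 \<le> b" for a b :: real
    using sum_squares_bound[of a b] mult_nonneg_nonneg[OF that] by linarith
  then show "AE x in M. norm (f x * cnj (g x)) \<le> norm ((cmod (f x))\<^sup>2 + (cmod (g x))\<^sup>2)"
    by (simp add: norm_mult)
qed

lemma Re_integral_mult_cnj:
  "Re (LINT x|M. f x * cnj (f x)) = (LINT x|M. (cmod (f x))\<^sup>2)"
proof -
  have "(LINT x|M. f x * cnj (f x)) = (LINT x|M. complex_of_real ((cmod (f x))\<^sup>2))"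
    by (simp only: complex_norm_square)
  also have "\<dots> = complex_of_real (LINT x|M. (cmod (f x))\<^sup>2)"
    by (rule integral_complex_of_real)
  finally show ?thesis
    by (simp only: Re_complex_of_real)
qed

lemma square_integrable_zero: "square_integrable M (\<lambda>_. 0)"
  by (simp add: square_integrable_def)

lemma square_integrable_scaleR:
  "square_integrable M f \<Longrightarrow> square_integrable M (\<lambda>x. c *\<^sub>R f x)"
  by (auto simp: square_integrable_def power_mult_distrib)

lemma square_integrable_uminus:
  "square_integrable M f \<Longrightarrow> square_integrable M (\<lambda>x. - f x)"
  by (auto simp: square_integrable_def)

lemma square_integrable_add:
  assumes f: "square_integrable M f" and g: "square_integrable M g"
  shows "square_integrable M (\<lambda>x. f x + g x)"
proof -
  have [measurable]: "f \<in> borel_measurable M" "g \<in> borel_measurable M"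
    using f g by (auto simp: square_integrable_def)
  have "integrable M (\<lambda>x. (cmod (f x + g x))\<^sup>2)"
  proof (rule Bochner_Integration.integrable_bound)
    show "integrable M (\<lambda>x. 2 * (cmod (f x))\<^sup>2 + 2 * (cmod (g x))\<^sup>2)"
      using f g by (auto simp: square_integrable_def)
    have "(cmod (a + b))\<^sup>2 \<le> 2 * (cmod a)\<^sup>2 + 2 * (cmod b)\<^sup>2" for a b
    proof -
      have "(cmod (a + b))\<^sup>2 \<le> (cmod a + cmod b)\<^sup>2"
        by (intro power_mono norm_triangle_ineq norm_ge_zero)
      also have "\<dots> \<le> 2 * (cmod a)\<^sup>2 + 2 * (cmod b)\<^sup>2"
        using sum_squares_bound[of "cmod a" "cmod b"] by (simp add: power2_sum)
      finally show ?thesis .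
    qed
    then show "AE x in M. norm ((cmod (f x + g x))\<^sup>2)
        \<le> norm (2 * (cmod (f x))\<^sup>2 + 2 * (cmod (g x))\<^sup>2)"
      by simp
  qed measurable
  then show ?thesis
    by (simp add: square_integrable_def)
qed


section \<open>The Hilbert space $L^2((0,\infty),dx/x)$\<close>

definition dx_over_x :: "real measure" where
  "dx_over_x = density (restrict_space lborel {0<..}) (\<lambda>x. ennreal (1 / x))"

definition L2_eq :: "(real \<Rightarrow> complex) \<Rightarrow> (real \<Rightarrow> complex) \<Rightarrow> bool" where
  "L2_eq f g \<longleftrightarrow> square_integrable dx_over_x f \<and> square_integrable dx_over_x g
     \<and> (AE x in dx_over_x. f x = g x)"

(* abs_L2pos f is the class of f if f is square-integrable; only the values of f on the
   positive half-line matter. *)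
quotient_type L2pos = "real \<Rightarrow> complex" / partial: L2_eq
  morphisms rep_L2pos abs_L2pos
proof (rule part_equivpI)
  show "\<exists>f. L2_eq f f"
    by (rule exI[of _ "\<lambda>_. 0"]) (simp add: L2_eq_def square_integrable_zero)
  show "symp L2_eq"
    by (rule sympI) (simp add: L2_eq_def eq_commute)
  show "transp L2_eq"
  proof (rule transpI)
    fix f g h assume "L2_eq f g" "L2_eq g h"
    moreover from this have "AE x in dx_over_x. f x = h x"
      unfolding L2_eq_def by (elim conjE) (erule (1) eventually_elim2, simp)
    ultimately show "L2_eq f h"
      by (simp add: L2_eq_def)
  qed
qed

instantiation L2pos :: real_inner
begin

lift_definition zero_L2pos :: L2pos is "\<lambda>_. 0"
  by (simp add: L2_eq_def square_integrable_zero)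

lift_definition plus_L2pos :: "L2pos \<Rightarrow> L2pos \<Rightarrow> L2pos" is "\<lambda>f g x. f x + g x"
  unfolding L2_eq_def
  by (elim conjE, intro conjI square_integrable_add, assumption+) (erule (1) eventually_elim2, simp)

lift_definition uminus_L2pos :: "L2pos \<Rightarrow> L2pos" is "\<lambda>f x. - f x"
  unfolding L2_eq_def
  by (elim conjE, intro conjI square_integrable_uminus, assumption+) (erule eventually_mono, simp)

definition minus_L2pos :: "L2pos \<Rightarrow> L2pos \<Rightarrow> L2pos" where
  "minus_L2pos f g = f + (- g)"

lift_definition scaleR_L2pos :: "real \<Rightarrow> L2pos \<Rightarrow> L2pos" is "\<lambda>c f x. c *\<^sub>R f x"
  unfolding L2_eq_def
  by (elim conjE, intro conjI square_integrable_scaleR, assumption+) (erule eventually_mono, simp)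

(* The real part of the usual Hermitian inner product; it induces the L2-norm. *)
lift_definition inner_L2pos :: "L2pos \<Rightarrow> L2pos \<Rightarrow> real"
  is "\<lambda>f g. Re (LINT x|dx_over_x. f x * cnj (g x))"
proof -
  fix f f' g g' assume "L2_eq f f'" "L2_eq g g'"
  then have "AE x in dx_over_x. f x * cnj (g x) = f' x * cnj (g' x)"
    unfolding L2_eq_def by (elim conjE) (erule (1) eventually_elim2, simp)
  moreover have "(\<lambda>x. f x * cnj (g x)) \<in> borel_measurable dx_over_x"
    "(\<lambda>x. f' x * cnj (g' x)) \<in> borel_measurable dx_over_x"
    using \<open>L2_eq f f'\<close> \<open>L2_eq g g'\<close>
    by (simp_all add: L2_eq_def borel_measurable_integrable square_integrable_mult)
  ultimately show "Re (LINT x|dx_over_x. f x * cnj (g x)) = Re (LINT x|dx_over_x. f' x * cnj (g' x))"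
    by (intro arg_cong[where f = Re] integral_cong_AE)
qed

definition norm_L2pos :: "L2pos \<Rightarrow> real" where
  "norm_L2pos f = sqrt (f \<bullet> f)"

definition sgn_L2pos :: "L2pos \<Rightarrow> L2pos" where
  "sgn_L2pos f = inverse (norm f) *\<^sub>R f"

definition dist_L2pos :: "L2pos \<Rightarrow> L2pos \<Rightarrow> real" where
  "dist_L2pos f g = norm (f - g)"

definition uniformity_L2pos :: "(L2pos \<times> L2pos) filter" where
  "uniformity_L2pos = (INF e\<in>{0<..}. principal {(f, g). dist f g < e})"

definition open_L2pos :: "L2pos set \<Rightarrow> bool" where
  "open_L2pos U \<longleftrightarrow> (\<forall>f\<in>U. \<forall>\<^sub>F (f', g) in uniformity. f' = f \<longrightarrow> g \<in> U)"

instance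
proof
  fix f g h :: L2pos and a b :: real
  show "f + g + h = f + (g + h)"
    by transfer (auto simp: L2_eq_def square_integrable_add add.assoc)
  show "f + g = g + f"
    by transfer (auto simp: L2_eq_def square_integrable_add add.commute)
  show "0 + f = f"
    by transfer (auto simp: L2_eq_def)
  show "- f + f = 0"
    by transfer (auto simp: L2_eq_def square_integrable_zero)
  show "f - g = f + - g"
    by (fact minus_L2pos_def)
  show "a *\<^sub>R (f + g) = a *\<^sub>R f + a *\<^sub>R g"
    by transfer (simp add: L2_eq_def scaleR_add_right square_integrable_add square_integrable_scaleR)
  show "(a + b) *\<^sub>R f = a *\<^sub>R f + b *\<^sub>R f"
    by transfer (simp add: L2_eq_def scaleR_add_left square_integrable_add square_integrable_scaleR)
  show "a *\<^sub>R b *\<^sub>R f = (a * b) *\<^sub>R f"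
    by transfer (use square_integrable_scaleR in \<open>auto simp: L2_eq_def\<close>)
  show "1 *\<^sub>R f = f"
    by transfer (auto simp: L2_eq_def)
  show "sgn f = inverse (norm f) *\<^sub>R f"
    by (fact sgn_L2pos_def)
  show "dist f g = norm (f - g)"
    by (fact dist_L2pos_def)
  show "(uniformity :: (L2pos \<times> L2pos) filter)
      = (INF e\<in>{0<..}. principal {(f, g). dist f g < e})"
    by (fact uniformity_L2pos_def)
  show "open U \<longleftrightarrow> (\<forall>f\<in>U. \<forall>\<^sub>F (f', g) in uniformity. f' = f \<longrightarrow> g \<in> U)" for U :: "L2pos set"
    by (fact open_L2pos_def)
  show "f \<bullet> g = g \<bullet> f"
  proof transfer
    fix f g :: "real \<Rightarrow> complex"
    have "(LINT x|dx_over_x. g x * cnj (f x)) = (LINT x|dx_over_x. cnj (f x * cnj (g x)))"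
      by (rule Bochner_Integration.integral_cong) simp_all
    also have "\<dots> = cnj (LINT x|dx_over_x. f x * cnj (g x))"
      by (rule Bochner_Integration.integral_cnj)
    finally have "(LINT x|dx_over_x. g x * cnj (f x)) = cnj (LINT x|dx_over_x. f x * cnj (g x))" .
    then show "Re (LINT x|dx_over_x. f x * cnj (g x)) = Re (LINT x|dx_over_x. g x * cnj (f x))"
      by simp
  qed
  show "(f + g) \<bullet> h = f \<bullet> h + g \<bullet> h"
    by transfer (simp add: L2_eq_def distrib_right square_integrable_mult)
  show "(a *\<^sub>R f) \<bullet> g = a * (f \<bullet> g)"
    by transfer simp
  show "0 \<le> f \<bullet> f"
    by transfer (simp only: Re_integral_mult_cnj, simp)
  show "f \<bullet> f = 0 \<longleftrightarrow> f = 0"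
  proof transfer
    fix f assume "L2_eq f f"
    then have f: "square_integrable dx_over_x f"
      by (simp add: L2_eq_def)
    then have "Re (LINT x|dx_over_x. f x * cnj (f x)) = 0
        \<longleftrightarrow> (AE x in dx_over_x. (cmod (f x))\<^sup>2 = 0)"
      unfolding Re_integral_mult_cnj
      by (intro integral_nonneg_eq_0_iff_AE) (simp_all add: square_integrable_def)
    then show "Re (LINT x|dx_over_x. f x * cnj (f x)) = 0 \<longleftrightarrow> L2_eq f (\<lambda>_. 0)"
      using f by (simp add: L2_eq_def square_integrable_zero)
  qed
  show "norm f = sqrt (f \<bullet> f)"
    by (fact norm_L2pos_def)
qed

end


section \<open>The spaces $S([0,\infty))$ and $S_d([0,\infty))$\<close>

(* F n is the n-th derivative of f on the half-line, one-sided at 0.  The values of f on the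
   negative half-line are irrelevant. *)
definition schwartz_half_line :: "(real \<Rightarrow> complex) set" where
  "schwartz_half_line = {f. \<exists>F :: nat \<Rightarrow> real \<Rightarrow> complex.
     (\<forall>x\<ge>0. F 0 x = f x) \<and>
     (\<forall>n. \<forall>x\<ge>0. (F n has_vector_derivative F (Suc n) x) (at x within {0..})) \<and>
     (\<forall>n k. bounded ((\<lambda>x. x ^ k *\<^sub>R F n x) ` {0..}))}"

definition S_half_line :: "nat \<Rightarrow> (real \<Rightarrow> complex) set" where
  "S_half_line d = {f. \<exists>f1\<in>schwartz_half_line.
     f = (\<lambda>x. if 0 \<le> x then (x powr ((real d + 1) / 2)) *\<^sub>R f1 x else 0)}"


section \<open>The operators $R_d^\pm(g)$\<close>

definition SL2 :: "(real ^ 2 ^ 2) set" where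
  "SL2 = {g. det g = 1}"

(* The representation space I_d (smooth phi such that x^(-d-1) phi(-1/x) extends smoothly to the
   line) is not needed as a separate domain: pi_rep and M_op are total functions, and below they
   are applied only to T_op d f and its translates, which lie in I_d.
   At the zero of r x + p (if any) the value is the limit, i.e. the continuous extension. *)
definition pi_rep :: "nat \<Rightarrow> real ^ 2 ^ 2 \<Rightarrow> (real \<Rightarrow> complex) \<Rightarrow> real \<Rightarrow> complex" where
  "pi_rep d g \<phi> =
     (let p = g $ 1 $ 1; q = g $ 1 $ 2; r = g $ 2 $ 1; s = g $ 2 $ 2;
          \<psi> = (\<lambda>x. ((r * x + p) powi (- int d - 1)) *\<^sub>R \<phi> ((s * x + q) / (r * x + p)))
      in (\<lambda>x. if r * x + p = 0 then Lim (at x) \<psi> else \<psi> x))"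

definition T_op :: "nat \<Rightarrow> (real \<Rightarrow> complex) \<Rightarrow> real \<Rightarrow> complex" where
  "T_op d f z = (2 * pi) powr (- 1 / 2) *\<^sub>R
     (LINT y|lborel. (\<bar>y\<bar> powr ((real d - 1) / 2)) *\<^sub>R f y * exp (\<i> * of_real (y * z)))"

definition M_op :: "nat \<Rightarrow> (real \<Rightarrow> complex) \<Rightarrow> real \<Rightarrow> complex" where
  "M_op d \<phi> y = (\<bar>y\<bar> powr ((- real d + 1) / 2) * (2 * pi) powr (- 1 / 2)) *\<^sub>R
     (LINT x|lborel. \<phi> x * exp (- \<i> * of_real (x * y)))"

definition reflect :: "(real \<Rightarrow> complex) \<Rightarrow> real \<Rightarrow> complex" where
  "reflect f x = f (- x)"

definition R_plus :: "nat \<Rightarrow> real ^ 2 ^ 2 \<Rightarrow> (real \<Rightarrow> complex) \<Rightarrow> real \<Rightarrow> complex" where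
  "R_plus d g f = M_op d (pi_rep d g (T_op d f))"

definition R_minus :: "nat \<Rightarrow> real ^ 2 ^ 2 \<Rightarrow> (real \<Rightarrow> complex) \<Rightarrow> real \<Rightarrow> complex" where
  "R_minus d g f = reflect (M_op d (pi_rep d g (T_op d (reflect f))))"

(* Extension by continuity from the dense subspace of classes of S_half_line d. *)
definition extend_to_L2 :: "nat \<Rightarrow> ((real \<Rightarrow> complex) \<Rightarrow> real \<Rightarrow> complex) \<Rightarrow> L2pos \<Rightarrow> L2pos" where
  "extend_to_L2 d A = (THE B. continuous_on UNIV B \<and>
     (\<forall>f\<in>S_half_line d. B (abs_L2pos f) = abs_L2pos (A f)))"

definition R_plus_L2 :: "nat \<Rightarrow> real ^ 2 ^ 2 \<Rightarrow> L2pos \<Rightarrow> L2pos" where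
  "R_plus_L2 d g = extend_to_L2 d (R_plus d g)"

definition R_minus_L2 :: "nat \<Rightarrow> real ^ 2 ^ 2 \<Rightarrow> L2pos \<Rightarrow> L2pos" where
  "R_minus_L2 d g = extend_to_L2 d (R_minus d g)"


section \<open>Smooth vectors\<close>

fun C_k_on :: "nat \<Rightarrow> 'a set \<Rightarrow> ('a::euclidean_space \<Rightarrow> 'b::real_normed_vector) \<Rightarrow> bool" where
  "C_k_on 0 U F \<longleftrightarrow> continuous_on U F"
| "C_k_on (Suc k) U F \<longleftrightarrow> (\<forall>x\<in>U. F differentiable (at x)) \<and>
     (\<forall>v. C_k_on k U (\<lambda>x. frechet_derivative F (at x) v))"

definition smooth_on_open :: "'a set \<Rightarrow> ('a::euclidean_space \<Rightarrow> 'b::real_normed_vector) \<Rightarrow> bool" where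
  "smooth_on_open U F \<longleftrightarrow> open U \<and> (\<forall>k. C_k_on k U F)"

(* SL2 is a closed submanifold of the space of all 2x2 matrices, so a map on SL2 is smooth iff
   it is locally the restriction of a smooth map on an open set of matrices. *)
definition smooth_on_SL2 :: "(real ^ 2 ^ 2 \<Rightarrow> 'b::real_normed_vector) \<Rightarrow> bool" where
  "smooth_on_SL2 F \<longleftrightarrow> (\<forall>g\<in>SL2. \<exists>U F'. g \<in> U \<and> smooth_on_open U F' \<and>
     (\<forall>h\<in>U \<inter> SL2. F' h = F h))"

definition smooth_vectors :: "(real ^ 2 ^ 2 \<Rightarrow> 'b \<Rightarrow> 'b) \<Rightarrow> 'b::real_normed_vector set" where
  "smooth_vectors R = {v. smooth_on_SL2 (\<lambda>g. R g v)}"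

end

theory Submission
  imports Defs "HOL-Probability.Probability"
begin

text \<open>
  Conjugated by $x^{(d+1)/2}$, the operator $\mathcal{H}_d$ becomes the integral operator with
  kernel $x^d\sum_m (-xy)^m/(m!\,(m+d)!)$, where the series is an entire function of $xy$, bounded on
  the half-line. The Laplace transform turns it into $s \mapsto 1/s$, hence the
  representation preserves $S_d$ and is isometric there; it extends to $L^2$ because $S_d$ is dense.

  A vector of $S_d$ is differentiable along the unipotent group $n(x)$ with derivative in $S_d$. Near
  the identity a group element is a product of conjugates of such unipotents that depend smoothly on
  it, and the isometry of the operators gives a product rule. So the derivative of an orbit map is a
  combination of orbit maps of other vectors of $S_d$, and by iteration the orbit map is smooth.

  Conversely, let $v$ be smooth. Differentiating along $n(x)g$ at $g = 1$ and $g = w^{-1}$ shows that all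
  $x^k v$ and all $x^k R(w^{-1})v$ are square-integrable. So $v$ is the Hankel transform of a
  function with all moments, hence smooth up to $0$ after division by $x^{(d+1)/2}$, with all derivatives
  bounded; together with square-integrability of $x^k v$ this yields rapid decay, first of the function and
  then, by Taylor expansion, of its derivatives. The minus sign reduces to the plus sign by
  conjugation with $\mathrm{diag}(1,-1)$.
\<close>

section \<open>Square-integrable functions on the half-line\<close>

text \<open>The law for s -> 1/s, read backwards, gives the Laplace transform of a Schwartz function
  decay of order d + 1 on the imaginary axis. Since d > 0 this is integrable, so pointwise Fourier
  inversion applies: \<open>M_op\<close> inverts \<open>T_op\<close> on S_d, and the Hankel
  transform is an involution. Together with the symmetry of its kernel this is the isometry. The
  operators on L^2 are known only as continuous extensions. The unipotent n(c) acts on every vector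
  by an explicit phase, but for w an integral formula exists at the outset only on S_d. In the
  converse it has to be recovered by pairing with S_d, for vectors all of whose moments are
  square-integrable. Both families of moments are used: those of v give decay in the mean but no
  regularity, while those of the vector transformed by the inverse of w give regularity, because
  each derivative of a Hankel transform puts one more factor x into the integrand.\<close>

abbreviation HL :: "real measure" where
  "HL \<equiv> restrict_space lborel {0<..}"

lemma space_HL [simp]: "space HL = {0<..}"
  by (simp add: space_restrict_space)

lemma borel_measurable_HL_iff:
  "f \<in> borel_measurable HL \<longleftrightarrow> (\<lambda>x. indicator {0<..} x *\<^sub>R f x) \<in> borel_measurable borel"
  for f :: "real \<Rightarrow> 'a::real_normed_vector"
  by (subst borel_measurable_restrict_space_iff) (auto simp: measurable_lborel1)

lemma borel_measurable_dx_over_x [simp]: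
  "borel_measurable dx_over_x = borel_measurable HL"
  unfolding dx_over_x_def by (rule measurable_cong_sets) simp_all

lemma measurable_HL_continuous:
  "continuous_on {0<..} f \<Longrightarrow> f \<in> borel_measurable HL"
  for f :: "real \<Rightarrow> 'a::topological_space"
  by (metis borel_measurable_continuous_on_restrict measurable_cong_sets sets_lborel sets_restrict_space_cong)

lemma measurable_HL_borel [measurable (raw)]: "f \<in> borel_measurable borel \<Longrightarrow> f \<in> borel_measurable HL"
  by (simp add: measurable_restrict_space1)

lemma sigma_finite_HL: "sigma_finite_measure HL"
  by (rule sigma_finite_measure_restrict_space) (auto simp: sigma_finite_lborel)

lemma AE_dx_over_x_iff: "(AE x in dx_over_x. P x) \<longleftrightarrow> (AE x in HL. P x)"
proof -
  have "(AE x in dx_over_x. P x) \<longleftrightarrow> (AE x in HL. 0 < ennreal (1 / x) \<longrightarrow> P x)"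
    unfolding dx_over_x_def by (rule AE_density) simp
  also have "\<dots> \<longleftrightarrow> (AE x in HL. P x)"
    by (rule AE_cong) simp
  finally show ?thesis .
qed

lemma AE_HL_iff: "(AE x in HL. P x) \<longleftrightarrow> (AE x in lborel. x > 0 \<longrightarrow> P x)"
  by (subst AE_restrict_space_iff) auto

lemma integrable_dx_over_x:
  fixes f :: "real \<Rightarrow> 'a::{banach, second_countable_topology}"
  assumes "f \<in> borel_measurable HL"
  shows "integrable dx_over_x f \<longleftrightarrow> integrable HL (\<lambda>x. f x /\<^sub>R x)"
proof -
  have "integrable dx_over_x f \<longleftrightarrow> integrable HL (\<lambda>x. (1 / x) *\<^sub>R f x)"
    unfolding dx_over_x_def
    by (rule integrable_density) (use assms in \<open>auto simp: AE_HL_iff\<close>)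
  then show ?thesis by (simp add: divide_inverse)
qed

lemma integral_dx_over_x:
  fixes f :: "real \<Rightarrow> 'a::{banach, second_countable_topology}"
  assumes "f \<in> borel_measurable HL"
  shows "integral\<^sup>L dx_over_x f = (LINT x|HL. f x /\<^sub>R x)"
proof -
  have "integral\<^sup>L dx_over_x f = (LINT x|HL. (1 / x) *\<^sub>R f x)"
    unfolding dx_over_x_def
    by (rule integral_density) (use assms in \<open>auto simp: AE_HL_iff\<close>)
  then show ?thesis by (simp add: divide_inverse)
qed

abbreviation "SQ \<equiv> square_integrable dx_over_x"

lemma L2_eq_refl: "SQ f \<Longrightarrow> L2_eq f f"
  by (simp add: L2_eq_def)

lemma rep_L2pos: "SQ (rep_L2pos v)" "abs_L2pos (rep_L2pos v) = v"
  using Quotient_rep_reflp[OF Quotient_L2pos, of v] Quotient_abs_rep[OF Quotient_L2pos, of v]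
  by (auto simp: L2_eq_def)

lemma abs_L2pos_eq_iff:
  "SQ f \<Longrightarrow> SQ g \<Longrightarrow> abs_L2pos f = abs_L2pos g \<longleftrightarrow> (AE x in HL. f x = g x)"
  using Quotient_rel[OF Quotient_L2pos, of f g] by (auto simp: L2_eq_def AE_dx_over_x_iff)

lemma abs_L2pos_cong:
  assumes f: "SQ f" and eq: "\<And>x. x > 0 \<Longrightarrow> f x = g x"
  shows "abs_L2pos f = abs_L2pos g" and "SQ g"
proof -
  have "square_integrable dx_over_x f \<longleftrightarrow> square_integrable dx_over_x g"
    unfolding square_integrable_def
    by (intro arg_cong2[of _ _ _ _ "(\<and>)"] measurable_cong Bochner_Integration.integrable_cong)
      (use eq in \<open>auto simp: dx_over_x_def\<close>)
  then show "SQ g" using f by simp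
  then show "abs_L2pos f = abs_L2pos g"
    using f eq by (simp add: abs_L2pos_eq_iff AE_HL_iff)
qed

lemma abs_L2pos_add: "SQ f \<Longrightarrow> SQ g \<Longrightarrow> abs_L2pos f + abs_L2pos g = abs_L2pos (\<lambda>x. f x + g x)"
  by (rule plus_L2pos.abs_eq) (auto simp: L2_eq_refl)

lemma abs_L2pos_scaleR: "SQ f \<Longrightarrow> c *\<^sub>R abs_L2pos f = abs_L2pos (\<lambda>x. c *\<^sub>R f x)"
  by (rule scaleR_L2pos.abs_eq) (auto simp: L2_eq_refl)

lemma abs_L2pos_uminus: "SQ f \<Longrightarrow> - abs_L2pos f = abs_L2pos (\<lambda>x. - f x)"
  by (rule uminus_L2pos.abs_eq) (auto simp: L2_eq_refl)

lemma SQ_diff: "SQ f \<Longrightarrow> SQ g \<Longrightarrow> SQ (\<lambda>x. f x - g x)"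
  using square_integrable_add[OF _ square_integrable_uminus] by fastforce

lemma abs_L2pos_diff: "SQ f \<Longrightarrow> SQ g \<Longrightarrow> abs_L2pos f - abs_L2pos g = abs_L2pos (\<lambda>x. f x - g x)"
  by (simp add: minus_L2pos_def abs_L2pos_uminus abs_L2pos_add square_integrable_uminus)

lemma inner_abs_L2pos:
  "SQ f \<Longrightarrow> SQ g \<Longrightarrow> abs_L2pos f \<bullet> abs_L2pos g = Re (LINT x|dx_over_x. f x * cnj (g x))"
  by (rule inner_L2pos.abs_eq) (auto simp: L2_eq_refl)

lemma norm_abs_L2pos:
  "SQ f \<Longrightarrow> (norm (abs_L2pos f))\<^sup>2 = (LINT x|dx_over_x. (cmod (f x))\<^sup>2)"
  by (simp only: power2_norm_eq_inner inner_abs_L2pos Re_integral_mult_cnj)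

lemma SQ_bound:
  assumes g: "SQ g" and f: "f \<in> borel_measurable HL" and le: "AE x in HL. cmod (f x) \<le> C * cmod (g x)"
  shows "SQ f"
  unfolding square_integrable_def
proof
  have [measurable]: "g \<in> borel_measurable HL" "f \<in> borel_measurable HL"
    using f g by (auto simp: square_integrable_def)
  show "f \<in> borel_measurable dx_over_x" using f by simp
  show "integrable dx_over_x (\<lambda>x. (cmod (f x))\<^sup>2)"
  proof (rule Bochner_Integration.integrable_bound)
    show "integrable dx_over_x (\<lambda>x. C\<^sup>2 * (cmod (g x))\<^sup>2)"
      using g by (simp add: square_integrable_def)
    show "AE x in dx_over_x. norm ((cmod (f x))\<^sup>2) \<le> norm (C\<^sup>2 * (cmod (g x))\<^sup>2)"
      unfolding AE_dx_over_x_iff using le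
    proof eventually_elim
      case (elim x)
      then have "(cmod (f x))\<^sup>2 \<le> (C * cmod (g x))\<^sup>2" by (intro power_mono) auto
      then show ?case by (simp add: power_mult_distrib)
    qed
  qed simp
qed

lemma norm_abs_L2pos_le:
  assumes g: "SQ g" and f: "f \<in> borel_measurable HL" and C: "0 \<le> C"
    and le: "AE x in HL. cmod (f x) \<le> C * cmod (g x)"
  shows "norm (abs_L2pos f) \<le> C * norm (abs_L2pos g)"
proof (rule power2_le_imp_le)
  have sf: "SQ f" using SQ_bound[OF g f le] .
  have "(norm (abs_L2pos f))\<^sup>2 \<le> (LINT x|dx_over_x. C\<^sup>2 * (cmod (g x))\<^sup>2)"
    unfolding norm_abs_L2pos[OF sf]
  proof (rule integral_mono_AE)
    show "AE x in dx_over_x. (cmod (f x))\<^sup>2 \<le> C\<^sup>2 * (cmod (g x))\<^sup>2"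
      unfolding AE_dx_over_x_iff using le
    proof eventually_elim
      case (elim x)
      then have "(cmod (f x))\<^sup>2 \<le> (C * cmod (g x))\<^sup>2" by (intro power_mono) auto
      then show ?case by (simp add: power_mult_distrib)
    qed
  qed (use sf g in \<open>auto simp: square_integrable_def\<close>)
  also have "\<dots> = (C * norm (abs_L2pos g))\<^sup>2"
    by (simp add: norm_abs_L2pos[OF g] power_mult_distrib)
  finally show "(norm (abs_L2pos f))\<^sup>2 \<le> (C * norm (abs_L2pos g))\<^sup>2" .
qed (use C in simp)

text \<open>A subsequence of an L^2-convergent sequence converges almost everywhere, so a pointwise
  limit must represent the Hilbert space limit. This turns derivatives taken in the Hilbert space
  into pointwise ones in \<open>smooth_vector_powers\<close>.\<close>

lemma L2_limit_AE:
  assumes f: "\<And>n. SQ (f n)" and lim: "(\<lambda>n. abs_L2pos (f n)) \<longlonglongrightarrow> v"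
    and ae: "AE x in HL. (\<lambda>n. f n x) \<longlonglongrightarrow> g x" and g: "g \<in> borel_measurable HL"
  shows "SQ g" "v = abs_L2pos g"
proof -
  define h where "h = rep_L2pos v"
  have h: "SQ h" and v: "v = abs_L2pos h" using rep_L2pos[of v] by (auto simp: h_def)
  have d: "SQ (\<lambda>x. f n x - h x)" for n using f h by (rule SQ_diff)
  have "(\<lambda>n. (norm (abs_L2pos (f n) - v))\<^sup>2) \<longlonglongrightarrow> 0\<^sup>2"
    using lim by (intro tendsto_power) (simp add: LIM_zero_iff tendsto_norm_zero)
  then have 0: "(\<lambda>n. LINT x|dx_over_x. (cmod (f n x - h x))\<^sup>2) \<longlonglongrightarrow> 0"
    by (simp add: v abs_L2pos_diff f h norm_abs_L2pos d)
  have "\<exists>r::nat\<Rightarrow>nat. strict_mono r \<and> (AE x in dx_over_x. (\<lambda>n. (cmod (f (r n) x - h x))\<^sup>2) \<longlonglongrightarrow> 0)"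
    using 0 d by (intro tendsto_L1_AE_subseq) (auto simp: square_integrable_def)
  then obtain r where r: "strict_mono r" and
    ae2: "AE x in HL. (\<lambda>n. (cmod (f (r n) x - h x))\<^sup>2) \<longlonglongrightarrow> 0"
    by (auto simp: AE_dx_over_x_iff)
  have eq: "AE x in HL. h x = g x"
    using ae ae2
  proof eventually_elim
    case (elim x)
    have "(\<lambda>n. f (r n) x) \<longlonglongrightarrow> g x"
      using LIMSEQ_subseq_LIMSEQ[OF elim(1) r] by (simp add: o_def)
    moreover have "(\<lambda>n. sqrt ((cmod (f (r n) x - h x))\<^sup>2)) \<longlonglongrightarrow> sqrt 0"
      using elim(2) by (rule tendsto_real_sqrt)
    then have "(\<lambda>n. f (r n) x) \<longlonglongrightarrow> h x"
      by (simp add: tendsto_norm_zero_iff LIM_zero_iff)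
    ultimately show ?case by (metis LIMSEQ_unique)
  qed
  show "SQ g"
    using eq by (intro SQ_bound[OF h g, of 1]) auto
  then show "v = abs_L2pos g"
    using eq h v by (simp add: abs_L2pos_eq_iff)
qed

section \<open>Integrability criteria and completeness of the Hilbert space\<close>

lemma integrable_HL_inverse_quadratic: "integrable HL (\<lambda>x. 1 / (1 + x\<^sup>2))"
proof -
  have "einterval 0 \<infinity> = {0<..}" by (auto simp: einterval_def)
  then show ?thesis
    using integrable_I0i_1_div_plus_square
    by (simp add: interval_lebesgue_integrable_def set_integrable_def integrable_restrict_space)
qed

lemma integrable_HL_bound:
  fixes f :: "real \<Rightarrow> 'a::{banach, second_countable_topology}"
  assumes f: "f \<in> borel_measurable HL" and le: "\<And>x. x > 0 \<Longrightarrow> (1 + x\<^sup>2) * norm (f x) \<le> C"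
  shows "integrable HL f"
proof (rule Bochner_Integration.integrable_bound[OF _ f])
  show "integrable HL (\<lambda>x. C * (1 / (1 + x\<^sup>2)))"
    using integrable_HL_inverse_quadratic by (rule integrable_mult_right)
  have "norm (f x) \<le> norm (C * (1 / (1 + x\<^sup>2)))" if "x > 0" for x
  proof -
    have "1 + x\<^sup>2 > 0" by (simp add: add_pos_nonneg)
    then have "norm (f x) \<le> C * (1 / (1 + x\<^sup>2))"
      using le[OF that] by (simp add: field_simps)
    then show ?thesis by (metis abs_ge_self order_trans real_norm_def)
  qed
  then show "AE x in HL. norm (f x) \<le> norm (C * (1 / (1 + x\<^sup>2)))" by (simp add: AE_HL_iff)
qed

text \<open>The factor \<open>x\<close> on the right absorbs the density 1/x of the measure; what
  remains is dominated by a multiple of 1 / (1 + x^2).\<close>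

lemma SQ_criterion:
  assumes f: "f \<in> borel_measurable HL" and le: "\<And>x. x > 0 \<Longrightarrow> (1 + x\<^sup>2) * (cmod (f x))\<^sup>2 \<le> C * x"
  shows "SQ f"
proof -
  have m: "(\<lambda>x. (cmod (f x))\<^sup>2) \<in> borel_measurable HL" using f by simp
  have "integrable HL (\<lambda>x. (cmod (f x))\<^sup>2 /\<^sub>R x)"
    by (rule integrable_HL_bound[of _ C]) (use m le in \<open>auto simp: field_simps\<close>)
  then show ?thesis
    using f m by (simp add: square_integrable_def integrable_dx_over_x)
qed

text \<open>A strictly positive vector on the half-line. Pairing with it bounds a weighted L^1 norm
  by the L^2 norm, which serves both completeness and the integrability of moments.\<close>

lemma SQ_weight: "SQ (\<lambda>x. complex_of_real (x / (1 + x\<^sup>2)))"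
proof (rule SQ_criterion)
  fix x :: real assume x: "x > 0"
  have p: "1 + x\<^sup>2 > 0" by (simp add: add_pos_nonneg)
  have "2 * x \<le> 1 + x\<^sup>2" using sum_squares_bound[of 1 x] by simp
  then have "x * x \<le> x * (1 + x\<^sup>2)" using x by (intro mult_left_mono) auto
  then have "x\<^sup>2 / (1 + x\<^sup>2) \<le> x" using p by (simp add: field_simps power2_eq_square)
  moreover have q: "q * (x / q)\<^sup>2 = x\<^sup>2 / q" if "q > 0" for q :: real
    using that by (simp add: power2_eq_square)
  have "(1 + x\<^sup>2) * (cmod (complex_of_real (x / (1 + x\<^sup>2))))\<^sup>2 = x\<^sup>2 / (1 + x\<^sup>2)"
    using q[OF p] by (simp only: norm_of_real power2_abs)
  ultimately show "(1 + x\<^sup>2) * (cmod (complex_of_real (x / (1 + x\<^sup>2))))\<^sup>2 \<le> 1 * x" by simp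
qed measurable

text \<open>The Riesz-Fischer argument: paired with the positive weight \<open>w\<close>, an L^2
  Cauchy sequence is Cauchy in L^1, so a subsequence converges almost everywhere. Completeness is
  what allows isometries to be extended from S_d to its closure.\<close>

lemma complete_L2pos:
  fixes X :: "nat \<Rightarrow> L2pos"
  assumes X: "Cauchy X"
  shows "convergent X"
proof -
  define f where "f n = rep_L2pos (X n)" for n
  have f: "SQ (f n)" and Xf: "X n = abs_L2pos (f n)" for n
    using rep_L2pos[of "X n"] by (auto simp: f_def)
  have fm [measurable]: "f n \<in> borel_measurable HL" for n
    using f[of n] by (simp add: square_integrable_def)
  have df: "SQ (\<lambda>x. f m x - f n x)" for m n using f by (simp add: SQ_diff)
  define w where "w x = x / (1 + x\<^sup>2)" for x :: real
  have w: "SQ (\<lambda>x. complex_of_real (w x))" unfolding w_def by (rule SQ_weight)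
  define W where "W = norm (abs_L2pos (\<lambda>x. complex_of_real (w x)))"
  have W0: "0 \<le> W" by (simp add: W_def)
  have wpos: "w x > 0" if "x > 0" for x
    unfolding w_def using that by (intro divide_pos_pos add_pos_nonneg) auto
  have int: "integrable dx_over_x (\<lambda>x. w x *\<^sub>R f n x)" for n
    using square_integrable_mult[OF f[of n] w] by (simp add: scaleR_conv_of_real mult.commute)
  obtain r where r: "strict_mono r" and "AE x in dx_over_x. Cauchy (\<lambda>i. w x *\<^sub>R f (r i) x)"
  proof (rule cauchy_L1_AE_cauchy_subseq[OF int])
    fix e :: real assume e: "e > 0"
    then have "e / (W + 1) > 0" using W0 by simp
    then obtain N where N: "\<And>m n. m \<ge> N \<Longrightarrow> n \<ge> N \<Longrightarrow> norm (X m - X n) < e / (W + 1)"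
      using X unfolding Cauchy_def dist_norm by meson
    have "(LINT x|dx_over_x. norm (w x *\<^sub>R f m x - w x *\<^sub>R f n x)) < e" if "m \<ge> N" "n \<ge> N" for m n
    proof -
      let ?g = "\<lambda>x. complex_of_real (cmod (f m x - f n x))"
      have g: "SQ ?g" using df[of m n] by (auto simp: square_integrable_def)
      have "(LINT x|dx_over_x. norm (w x *\<^sub>R f m x - w x *\<^sub>R f n x))
          = (LINT x|dx_over_x. Re (?g x * cnj (complex_of_real (w x))))"
        unfolding dx_over_x_def using wpos
        by (intro Bochner_Integration.integral_cong refl) (auto simp flip: scaleR_diff_right simp: less_imp_le)
      also have "\<dots> = Re (LINT x|dx_over_x. ?g x * cnj (complex_of_real (w x)))"
        using square_integrable_mult[OF g w] by (rule integral_Re)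
      also have "\<dots> = abs_L2pos ?g \<bullet> abs_L2pos (\<lambda>x. complex_of_real (w x))"
        using g w by (simp add: inner_abs_L2pos)
      also have "\<dots> \<le> norm (abs_L2pos ?g) * W"
        unfolding W_def by (rule norm_cauchy_schwarz)
      also have "norm (abs_L2pos ?g) \<le> 1 * norm (X m - X n)"
        unfolding Xf abs_L2pos_diff[OF f f]
        using g by (intro norm_abs_L2pos_le[OF df]) (auto simp: square_integrable_def)
      finally have "(LINT x|dx_over_x. norm (w x *\<^sub>R f m x - w x *\<^sub>R f n x)) \<le> norm (X m - X n) * W"
        using W0 by (simp add: mult_right_mono)
      also have "\<dots> \<le> e / (W + 1) * W"
        using N[OF that] W0 by (intro mult_right_mono) auto
      also have "\<dots> < e" using e W0 by (simp add: field_simps)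
      finally show ?thesis .
    qed
    then show "\<exists>N. \<forall>i\<ge>N. \<forall>j\<ge>N. (LINT x|dx_over_x. norm (w x *\<^sub>R f i x - w x *\<^sub>R f j x)) < e"
      by blast
  qed
  then have ae: "AE x in HL. Cauchy (\<lambda>i. w x *\<^sub>R f (r i) x)" by (simp add: AE_dx_over_x_iff)
  define g where "g x = lim (\<lambda>i. f (r i) x)" for x
  have gm [measurable]: "g \<in> borel_measurable HL"
    unfolding g_def by measurable
  have lim: "AE x in HL. (\<lambda>i. f (r i) x) \<longlonglongrightarrow> g x"
  proof -
    have "AE x in HL. x > 0" by (simp add: AE_HL_iff)
    with ae show ?thesis
    proof eventually_elim
      case (elim x)
      then have "convergent (\<lambda>i. w x *\<^sub>R f (r i) x)" by (simp add: Cauchy_convergent)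
      then obtain l where "(\<lambda>i. w x *\<^sub>R f (r i) x) \<longlonglongrightarrow> l" by (auto simp: convergent_def)
      then have "(\<lambda>i. inverse (w x) *\<^sub>R w x *\<^sub>R f (r i) x) \<longlonglongrightarrow> inverse (w x) *\<^sub>R l"
        by (intro tendsto_scaleR tendsto_const)
      then have "convergent (\<lambda>i. f (r i) x)"
        using wpos[OF elim(2)] by (auto simp: convergent_def)
      then show ?case by (simp add: g_def convergent_LIMSEQ_iff)
    qed
  qed
  \<comment> \<open>Fatou's lemma along the subsequence carries the Cauchy estimate over to the
    pointwise limit \<open>g\<close>, whose own square-integrability is not yet known.\<close>
  have key: "SQ (\<lambda>x. g x - f n x) \<and> norm (abs_L2pos (\<lambda>x. g x - f n x)) \<le> e"
    if e: "e > 0" and N: "\<And>m. m \<ge> n \<Longrightarrow> norm (X m - X n) \<le> e" for n e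
  proof -
    let ?I = "\<lambda>h. \<integral>\<^sup>+x. ennreal ((cmod (h x))\<^sup>2) \<partial>dx_over_x"
    have b: "?I (\<lambda>x. f (r i) x - f n x) \<le> ennreal (e\<^sup>2)" if "i \<ge> n" for i
    proof -
      have "r i \<ge> n" using that seq_suble[OF r, of i] by linarith
      then have "(norm (X (r i) - X n))\<^sup>2 \<le> e\<^sup>2" using N by (intro power_mono) auto
      then have "(LINT x|dx_over_x. (cmod (f (r i) x - f n x))\<^sup>2) \<le> e\<^sup>2"
        by (simp add: Xf abs_L2pos_diff f norm_abs_L2pos df)
      then show ?thesis
        using df[of "r i" n] by (subst nn_integral_eq_integral) (auto simp: square_integrable_def)
    qed
    have "?I (\<lambda>x. g x - f n x) \<le> (\<integral>\<^sup>+x. liminf (\<lambda>i. ennreal ((cmod (f (r i) x - f n x))\<^sup>2)) \<partial>dx_over_x)"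
    proof (rule nn_integral_mono_AE, unfold AE_dx_over_x_iff, use lim in eventually_elim)
      case (elim x)
      then have "(\<lambda>i. ennreal ((cmod (f (r i) x - f n x))\<^sup>2)) \<longlonglongrightarrow> ennreal ((cmod (g x - f n x))\<^sup>2)"
        by (intro tendsto_intros) auto
      from lim_imp_Liminf[OF trivial_limit_sequentially this] show ?case by simp
    qed
    also have "\<dots> \<le> liminf (\<lambda>i. ?I (\<lambda>x. f (r i) x - f n x))"
      by (rule nn_integral_liminf) simp
    also have "\<dots> \<le> ennreal (e\<^sup>2)"
      by (rule Liminf_le) (use b in \<open>auto simp: eventually_at_top_linorder\<close>)
    finally have le: "?I (\<lambda>x. g x - f n x) \<le> ennreal (e\<^sup>2)" .
    have int': "integrable dx_over_x (\<lambda>x. (cmod (g x - f n x))\<^sup>2)"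
    proof (rule integrableI_bounded)
      show "(\<integral>\<^sup>+x. ennreal (norm ((cmod (g x - f n x))\<^sup>2)) \<partial>dx_over_x) < \<infinity>"
        using le_less_trans[OF le ennreal_less_top] by simp
    qed simp
    from int' have sq: "SQ (\<lambda>x. g x - f n x)" by (simp add: square_integrable_def)
    moreover have "(LINT x|dx_over_x. (cmod (g x - f n x))\<^sup>2) \<le> e\<^sup>2"
    proof -
      have "ennreal (LINT x|dx_over_x. (cmod (g x - f n x))\<^sup>2) \<le> ennreal (e\<^sup>2)"
        using le int' by (simp add: nn_integral_eq_integral)
      then show ?thesis by simp
    qed
    then have "(norm (abs_L2pos (\<lambda>x. g x - f n x)))\<^sup>2 \<le> e\<^sup>2"
      by (simp add: norm_abs_L2pos[OF sq])
    then have "norm (abs_L2pos (\<lambda>x. g x - f n x)) \<le> e"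
      by (rule power2_le_imp_le) (use e in simp)
    ultimately show ?thesis by simp
  qed
  have ex: "\<exists>N. \<forall>n\<ge>N. SQ (\<lambda>x. g x - f n x) \<and> norm (abs_L2pos (\<lambda>x. g x - f n x)) \<le> e" if e: "e > 0" for e
  proof -
    obtain N where N: "\<And>m n. m \<ge> N \<Longrightarrow> n \<ge> N \<Longrightarrow> norm (X m - X n) < e"
      using CauchyD[OF X e] by blast
    have "\<forall>n\<ge>N. SQ (\<lambda>x. g x - f n x) \<and> norm (abs_L2pos (\<lambda>x. g x - f n x)) \<le> e"
      using key[OF that] N by (meson less_imp_le order_trans)
    then show ?thesis by blast
  qed
  obtain N where "SQ (\<lambda>x. g x - f N x)" using ex[of 1] by auto
  from square_integrable_add[OF this f[of N]] have g: "SQ g" by simp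
  have "X \<longlonglongrightarrow> abs_L2pos g"
  proof (rule metric_LIMSEQ_I)
    fix e :: real assume "e > 0"
    with ex[of "e/2"] obtain N where N: "\<And>n. n \<ge> N \<Longrightarrow> norm (abs_L2pos (\<lambda>x. g x - f n x)) \<le> e/2" by auto
    then have "dist (X n) (abs_L2pos g) < e" if "n \<ge> N" for n
      using N[OF that] \<open>e > 0\<close> by (simp add: dist_commute dist_norm Xf abs_L2pos_diff f g)
    then show "\<exists>N. \<forall>n\<ge>N. dist (X n) (abs_L2pos g) < e" by blast
  qed
  then show ?thesis by (auto simp: convergent_def)
qed

instance L2pos :: complete_space
  by standard (rule complete_L2pos)

section \<open>Hankel transforms of Schwartz functions\<close>

text \<open>The classical Bessel function is $J_d(2\sqrt{t}) = t^{d/2}$ times this series.\<close>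

definition bes :: "nat \<Rightarrow> real \<Rightarrow> real" where
  "bes d t = (\<Sum>m. (-1) ^ m / (fact m * fact (m + d)) * t ^ m)"

lemma summable_bes: "summable (\<lambda>m. (-1) ^ m / (fact m * fact (m + d)) * t ^ m)" for t :: real
proof (rule summable_comparison_test')
  show "summable (\<lambda>m. inverse (fact m) * \<bar>t\<bar> ^ m)" by (rule summable_exp)
  fix m
  have "(1::real) \<le> fact (m + d)" by (rule fact_ge_1)
  then have "(fact m :: real) * 1 \<le> fact m * fact (m + d)" by (intro mult_left_mono) auto
  then show "norm ((-1) ^ m / (fact m * fact (m + d)) * t ^ m) \<le> inverse (fact m) * \<bar>t\<bar> ^ m"
    by (simp add: abs_mult power_abs divide_inverse mult_right_mono le_imp_inverse_le del: inverse_mult_distrib)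
qed

text \<open>Differentiation only raises the order, so the family is closed under derivatives and a
  bound valid for every order controls all derivatives at once.\<close>

lemma bes_deriv: "(bes d has_real_derivative - bes (Suc d) t) (at t)"
proof -
  let ?c = "\<lambda>m. (-1) ^ m / (fact m * fact (m + d)) :: real"
  have "((\<lambda>t. \<Sum>m. ?c m * t ^ m) has_real_derivative (\<Sum>m. diffs ?c m * t ^ m)) (at t)"
    by (rule termdiffs_strong_converges_everywhere) (rule summable_bes)
  moreover have "diffs ?c m * t ^ m = - ((-1) ^ m / (fact m * fact (m + Suc d)) * t ^ m)" for m
  proof -
    have "fact (Suc m) = (real m + 1) * fact m" "fact (Suc m + d) = (fact (m + Suc d) :: real)"
      by (simp_all add: algebra_simps)
    then show ?thesis
      by (simp add: diffs_def divide_simps del: fact_Suc)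
  qed
  then have "(\<Sum>m. diffs ?c m * t ^ m) = - bes (Suc d) t"
    unfolding bes_def by (simp only: suminf_minus[OF summable_bes])
  ultimately show ?thesis
    by (simp only: bes_def[abs_def])
qed

text \<open>In view of \<open>bes_deriv\<close> this is the Bessel equation t u'' + (d + 1) u' + u =
  0 for u = \<open>bes d\<close>. It is obtained by comparing coefficients.\<close>

lemma bes_recurrence: "(real d + 1) * bes (Suc d) t - t * bes (Suc (Suc d)) t = bes d t"
proof -
  let ?a = "\<lambda>m. (-1) ^ m / (fact m * fact (m + Suc d)) * t ^ m"
  let ?b = "\<lambda>m. (-1) ^ m / (fact m * fact (m + Suc (Suc d))) * t ^ m"
  \<comment> \<open>The series of \<open>t * bes (Suc (Suc d)) t\<close> with its index shifted by
    one, so that it can be subtracted term by term; its term of index 0 is 0.\<close>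
  let ?b' = "\<lambda>m. (case m of 0 \<Rightarrow> 0 | Suc n \<Rightarrow> t * ?b n)"
  have b': "?b' sums (t * bes (Suc (Suc d)) t)"
  proof -
    have "(\<lambda>m. ?b' (Suc m)) sums (t * bes (Suc (Suc d)) t)"
      using sums_mult[OF summable_sums[OF summable_bes[of "Suc (Suc d)" t]], of t]
      by (simp only: bes_def nat.case)
    from sums_Suc[OF this] show ?thesis by simp
  qed
  have "(\<lambda>m. (real d + 1) * ?a m - ?b' m) sums ((real d + 1) * bes (Suc d) t - t * bes (Suc (Suc d)) t)"
    unfolding bes_def[of "Suc d"] by (intro sums_diff sums_mult b' summable_sums summable_bes)
  moreover have "(real d + 1) * ?a m - ?b' m = (-1) ^ m / (fact m * fact (m + d)) * t ^ m" for m
  proof (cases m)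
    case 0
    have "fact (Suc d) = (real d + 1) * fact d" by simp
    with 0 show ?thesis by (simp del: fact_Suc)
  next
    case (Suc n)
    define F where "F = (fact n :: real)"
    define G where "G = (fact (n + d) :: real)"
    have pos: "F > 0" "G > 0" by (auto simp: F_def G_def)
    have nz: "real n + 1 > 0" "real n + real d + 1 > 0" "real n + real d + 2 > 0" by auto
    have e: "fact m = (real n + 1) * F" "fact (m + Suc d) = (real n + real d + 2) * ((real n + real d + 1) * G)"
      "fact (n + Suc (Suc d)) = (real n + real d + 2) * ((real n + real d + 1) * G)" "fact (m + d) = (real n + real d + 1) * G"
      by (auto simp: Suc F_def G_def algebra_simps)
    have "(real d + 1) * ?a m - ?b' m = (-1) ^ m * t ^ m * ((real d + 1) / ((real n + 1) * F * ((real n + real d + 2) * ((real n + real d + 1) * G)))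
        + 1 / (F * ((real n + real d + 2) * ((real n + real d + 1) * G))))"
    proof -
      have "?b' m = - ((-1) ^ m * t ^ m * (1 / (F * ((real n + real d + 2) * ((real n + real d + 1) * G)))))"
        using e(3) Suc by (simp add: F_def)
      moreover have "?a m = (-1) ^ m * t ^ m * (1 / ((real n + 1) * F * ((real n + real d + 2) * ((real n + real d + 1) * G))))"
        unfolding e by simp
      moreover have "a * (P * (1 / Q)) - - (P * (1 / R)) = P * (a / Q + 1 / R)" for a P Q R :: real
        by (simp add: distrib_left)
      ultimately show ?thesis by (simp only:)
    qed
    also have "\<dots> = (-1) ^ m * t ^ m * (1 / ((real n + 1) * F * ((real n + real d + 1) * G)))"
    proof -
      have "(real d + 1) / ((real n + 1) * F * ((real n + real d + 2) * ((real n + real d + 1) * G)))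
        + 1 / (F * ((real n + real d + 2) * ((real n + real d + 1) * G)))
        = 1 / ((real n + 1) * F * ((real n + real d + 1) * G))"
        using pos nz by (simp add: divide_simps)
      then show ?thesis by simp
    qed
    also have "\<dots> = (-1) ^ m / (fact m * fact (m + d)) * t ^ m" unfolding e by simp
    finally show ?thesis .
  qed
  ultimately have "(\<lambda>m. (-1) ^ m / (fact m * fact (m + d)) * t ^ m) sums
      ((real d + 1) * bes (Suc d) t - t * bes (Suc (Suc d)) t)" by (simp only:)
  then show ?thesis unfolding bes_def[of d] by (simp add: sums_iff)
qed

lemma bes_0: "bes d 0 = 1 / fact d"
  using powser_zero[of "\<lambda>m. (-1) ^ m / (fact m * fact (m + d)) :: real"] by (simp add: bes_def)

lemma bes_bound:
  assumes "t \<ge> 0" shows "\<bar>bes d t\<bar> \<le> 1"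
proof -
  \<comment> \<open>an energy that decreases along the Bessel equation\<close>
  define E where "E t = t * (bes (Suc d) t)\<^sup>2 + (bes d t)\<^sup>2" for t
  have dE: "(E has_real_derivative - (2 * real d + 1) * (bes (Suc d) t)\<^sup>2) (at t)" for t
  proof -
    have "(E has_real_derivative (bes (Suc d) t)\<^sup>2 + t * (2 * bes (Suc d) t * - bes (Suc (Suc d)) t)
        + 2 * bes d t * - bes (Suc d) t) (at t)"
      unfolding E_def by (auto intro!: derivative_eq_intros bes_deriv)
    \<comment> \<open>The recurrence expresses \<open>t * bes (Suc (Suc d)) t\<close> by the two
      lower orders; the mixed terms then cancel. This is why the square of order d + 1 carries the
      weight \<open>t\<close> in the energy.\<close>
    moreover have "t * (2 * bes (Suc d) t * - bes (Suc (Suc d)) t)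
        = - 2 * bes (Suc d) t * ((real d + 1) * bes (Suc d) t - bes d t)"
      unfolding bes_recurrence[of d t, symmetric] by (simp add: algebra_simps)
    then have "(bes (Suc d) t)\<^sup>2 + t * (2 * bes (Suc d) t * - bes (Suc (Suc d)) t)
        + 2 * bes d t * - bes (Suc d) t = - (2 * real d + 1) * (bes (Suc d) t)\<^sup>2"
      by (simp add: algebra_simps power2_eq_square)
    ultimately show ?thesis by simp
  qed
  have "(bes d t)\<^sup>2 \<le> E t" using assms by (simp add: E_def)
  also have "E t \<le> E 0"
  proof (rule DERIV_nonpos_imp_nonincreasing[OF assms])
    fix x :: real
    have "- (2 * real d + 1) * (bes (Suc d) x)\<^sup>2 \<le> 0" by (intro mult_nonpos_nonneg) auto
    with dE show "\<exists>y. (E has_real_derivative y) (at x) \<and> y \<le> 0" by blast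
  qed
  also have "E 0 = (1 / fact d)\<^sup>2" by (simp add: E_def bes_0)
  also have "\<dots> \<le> 1\<^sup>2" by (intro power_mono) (auto simp: fact_ge_1)
  finally have "\<bar>bes d t\<bar>\<^sup>2 \<le> 1\<^sup>2" by simp
  then show ?thesis by (rule power2_le_imp_le) simp
qed

lemma continuous_on_bes [continuous_intros]:
  "continuous_on S f \<Longrightarrow> continuous_on S (\<lambda>x. bes d (f x))"
  for f :: "'a::t2_space \<Rightarrow> real"
  using continuous_on_compose2[of UNIV "bes d" S f] DERIV_continuous_on[of UNIV "bes d", OF bes_deriv] by simp

lemma borel_measurable_bes [measurable]: "bes d \<in> borel_measurable borel"
  by (rule borel_measurable_continuous_onI) (intro continuous_intros)

text \<open>By \<open>bes_bound\<close> the derivative of each \<open>bes n\<close> is at most 1 in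
  modulus, so \<open>bes (Suc d)\<close> is Lipschitz with constant 1 and the linear approximation
  of \<open>bes d\<close> has a quadratic error. The constant is independent of \<open>s\<close> and
  \<open>t\<close>, which makes the estimate integrable in \<open>hank_taylor\<close>.\<close>

lemma bes_taylor:
  assumes "s \<ge> 0" "t \<ge> 0"
  shows "\<bar>bes d s - bes d t + (s - t) * bes (Suc d) t\<bar> \<le> (s - t)\<^sup>2"
proof -
  have lip: "\<bar>bes n u - bes n v\<bar> \<le> \<bar>u - v\<bar>" if "u \<ge> 0" "v \<ge> 0" for n u v
  proof -
    have "norm (bes n u - bes n v) \<le> 1 * norm (u - v)"
    proof (rule field_differentiable_bound[of "{0..}" "bes n" "\<lambda>t. - bes (Suc n) t"])
      show "(bes n has_field_derivative - bes (Suc n) x) (at x within {0..})" for x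
        by (rule has_field_derivative_at_within[OF bes_deriv])
      show "norm (- bes (Suc n) x) \<le> 1" if "x \<in> {0..}" for x
        using bes_bound[of x "Suc n"] that by simp
    qed (use that in auto)
    then show ?thesis by simp
  qed
  \<comment> \<open>Up to an additive constant, \<open>bes d\<close> minus its tangent at
    \<open>t\<close>: the derivative of \<open>g\<close> vanishes at \<open>t\<close> and is at most
    the distance to \<open>t\<close>.\<close>
  define g where "g u = bes d u + u * bes (Suc d) t" for u
  have "norm (g s - g t) \<le> \<bar>s - t\<bar> * norm (s - t)"
  proof (rule field_differentiable_bound[of "closed_segment t s" g "\<lambda>u. - bes (Suc d) u + bes (Suc d) t"])
    fix u assume u: "u \<in> closed_segment t s"
    then have u0: "u \<ge> 0" and "\<bar>u - t\<bar> \<le> \<bar>s - t\<bar>"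
      using assms by (auto simp: closed_segment_eq_real_ivl split: if_splits)
    then show "norm (- bes (Suc d) u + bes (Suc d) t) \<le> \<bar>s - t\<bar>"
      using lip[of u t "Suc d"] assms by simp
    show "(g has_field_derivative - bes (Suc d) u + bes (Suc d) t) (at u within closed_segment t s)"
      unfolding g_def
      by (rule has_field_derivative_at_within) (auto intro!: derivative_eq_intros bes_deriv)
  qed auto
  moreover have "g s - g t = bes d s - bes d t + (s - t) * bes (Suc d) t"
    by (simp add: g_def algebra_simps)
  ultimately show ?thesis by (simp add: power2_eq_square)
qed

section \<open>Closure properties of the Schwartz space on the half-line\<close>

lemma bounded_power_image_iff:
  "bounded ((\<lambda>x. x ^ k *\<^sub>R f x) ` {0::real..}) \<longleftrightarrow> (\<exists>C. \<forall>x\<ge>0. x ^ k * norm (f x) \<le> C)"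
  for f :: "real \<Rightarrow> 'a::real_normed_vector"
proof -
  have "norm (x ^ k *\<^sub>R f x) = x ^ k * norm (f x)" if "x \<ge> 0" for x
    using that by simp
  then have "(\<forall>z\<in>(\<lambda>x. x ^ k *\<^sub>R f x) ` {0..}. norm z \<le> C) \<longleftrightarrow> (\<forall>x\<ge>0. x ^ k * norm (f x) \<le> C)" for C
    by simp (simp add: Ball_def)
  then show ?thesis unfolding bounded_iff by (rule arg_cong[where f = Ex, OF ext])
qed

text \<open>Choosing a derivative inside \<open>C\<close> again and again produces the whole
  sequence of derivatives that the definition asks for. Closure properties thus reduce to finding a
  set stable under one differentiation, and no formula for the n-th derivative ever has to be
  written down.\<close>

lemma schwartz_coinduct:
  assumes f: "f \<in> C"
    and bd: "\<And>g k. g \<in> C \<Longrightarrow> \<exists>B. \<forall>x\<ge>0. x ^ k * cmod (g x) \<le> B"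
    and der: "\<And>g. g \<in> C \<Longrightarrow> \<exists>g'\<in>C. \<forall>x\<ge>0. (g has_vector_derivative g' x) (at x within {0..})"
  shows "f \<in> schwartz_half_line"
proof -
  define nxt where "nxt g = (SOME g'. g' \<in> C \<and> (\<forall>x\<ge>0. (g has_vector_derivative g' x) (at x within {0..})))" for g
  have nxt: "nxt g \<in> C \<and> (\<forall>x\<ge>0. (g has_vector_derivative nxt g x) (at x within {0..}))" if "g \<in> C" for g
  proof -
    have "\<exists>g'. g' \<in> C \<and> (\<forall>x\<ge>0. (g has_vector_derivative g' x) (at x within {0..}))"
      using der[OF that] by blast
    from someI_ex[OF this] show ?thesis unfolding nxt_def .
  qed
  define F where "F n = (nxt ^^ n) f" for n
  have FC: "F n \<in> C" for n by (induction n) (simp_all add: F_def f nxt)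
  have F0: "F 0 = f" by (simp add: F_def)
  have "(F n has_vector_derivative F (Suc n) x) (at x within {0..})" if "x \<ge> 0" for n x
  proof -
    have "F (Suc n) = nxt (F n)" by (simp add: F_def)
    with nxt[OF FC[of n]] that show ?thesis by simp
  qed
  then show ?thesis
    unfolding schwartz_half_line_def bounded_power_image_iff mem_Collect_eq
    by (intro exI[of _ F] conjI allI impI bd FC) (simp_all add: F0)
qed

lemma schwartz_derivs:
  assumes "f \<in> schwartz_half_line"
  obtains F where "\<And>x. x \<ge> 0 \<Longrightarrow> F 0 x = f x"
    "\<And>n x. x \<ge> 0 \<Longrightarrow> (F n has_vector_derivative F (Suc n) x) (at x within {0..})"
    "\<And>n k. bounded ((\<lambda>x. x ^ k *\<^sub>R F n x) ` {0..})"
proof -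
  obtain F where F: "(\<forall>x\<ge>0. F 0 x = f x) \<and>
     (\<forall>n. \<forall>x\<ge>0. (F n has_vector_derivative F (Suc n) x) (at x within {0..})) \<and>
     (\<forall>n k. bounded ((\<lambda>x. x ^ k *\<^sub>R F n x) ` {0..}))"
    using assms unfolding schwartz_half_line_def mem_Collect_eq by (rule exE)
  show ?thesis by (rule that[of F]) (use F in simp_all)
qed

lemma schwartz_deriv:
  assumes "f \<in> schwartz_half_line"
  obtains f' where "f' \<in> schwartz_half_line"
    "\<And>x. x \<ge> 0 \<Longrightarrow> (f has_vector_derivative f' x) (at x within {0..})"
proof -
  obtain F where F: "\<And>x. x \<ge> 0 \<Longrightarrow> F 0 x = f x"
    "\<And>n x. x \<ge> 0 \<Longrightarrow> (F n has_vector_derivative F (Suc n) x) (at x within {0..})"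
    "\<And>n k. bounded ((\<lambda>x. x ^ k *\<^sub>R F n x) ` {0..})"
    using schwartz_derivs[OF assms] by blast
  show ?thesis
  proof
    show "F 1 \<in> schwartz_half_line"
      unfolding schwartz_half_line_def using F
      by (auto intro!: exI[of _ "\<lambda>n. F (Suc n)"])
    show "(f has_vector_derivative F 1 x) (at x within {0..})" if "x \<ge> 0" for x
      using F(2)[OF that, of 0] that F(1)
      by (auto intro: has_vector_derivative_transform[of x "{0..}" f "F 0"])
  qed
qed

lemma schwartz_bound:
  assumes "f \<in> schwartz_half_line"
  obtains C where "C \<ge> 0" "\<And>x. x \<ge> 0 \<Longrightarrow> x ^ k * cmod (f x) \<le> C"
proof -
  obtain F where F: "\<And>x. x \<ge> 0 \<Longrightarrow> F 0 x = f x"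
    "\<And>n x. x \<ge> 0 \<Longrightarrow> (F n has_vector_derivative F (Suc n) x) (at x within {0..})"
    "\<And>n k. bounded ((\<lambda>x. x ^ k *\<^sub>R F n x) ` {0..})"
    using schwartz_derivs[OF assms] by blast
  obtain C where C: "\<forall>x\<ge>0. x ^ k * cmod (F 0 x) \<le> C"
    using F(3)[of k 0, unfolded bounded_power_image_iff] by (rule exE)
  show ?thesis
  proof
    show "max 0 C \<ge> 0" by simp
    show "x ^ k * cmod (f x) \<le> max 0 C" if "x \<ge> 0" for x
      using C F(1) that by (simp add: max.coboundedI2)
  qed
qed

lemma schwartz_continuous: "f \<in> schwartz_half_line \<Longrightarrow> continuous_on {0..} f"
  by (erule schwartz_deriv, rule continuous_on_vector_derivative) (simp only: atLeast_iff)

lemma schwartz_measurable: "f \<in> schwartz_half_line \<Longrightarrow> f \<in> borel_measurable HL"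
  by (rule measurable_HL_continuous, rule continuous_on_subset[OF schwartz_continuous]) auto

lemma schwartz_poly_bound:
  assumes "f \<in> schwartz_half_line"
  obtains C where "C \<ge> 0" "\<And>x. x \<ge> 0 \<Longrightarrow> (1 + x\<^sup>2) * (x ^ k * cmod (f x)) \<le> C"
proof -
  obtain A where A: "A \<ge> 0" "\<And>x. x \<ge> 0 \<Longrightarrow> x ^ k * cmod (f x) \<le> A"
    using schwartz_bound[OF assms] by blast
  obtain B where B: "B \<ge> 0" "\<And>x. x \<ge> 0 \<Longrightarrow> x ^ (k + 2) * cmod (f x) \<le> B"
    using schwartz_bound[OF assms] by blast
  have "(1 + x\<^sup>2) * (x ^ k * cmod (f x)) \<le> A + B" if "x \<ge> 0" for x
    using A(2)[OF that] B(2)[OF that] by (simp add: algebra_simps power_add power2_eq_square)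
  with A B that[of "A + B"] show ?thesis by simp
qed

lemma schwartz_integrable:
  assumes "f \<in> schwartz_half_line" shows "integrable HL (\<lambda>x. x ^ n *\<^sub>R f x)"
proof -
  obtain C where "C \<ge> 0" "\<And>x. x \<ge> 0 \<Longrightarrow> (1 + x\<^sup>2) * (x ^ n * cmod (f x)) \<le> C"
    using schwartz_poly_bound[OF assms] by blast
  then show ?thesis
    using schwartz_measurable[OF assms]
    by (intro integrable_HL_bound[of _ C]) (auto intro!: borel_measurable_scaleR)
qed

lemma schwartz_add:
  assumes "f \<in> schwartz_half_line" "g \<in> schwartz_half_line"
  shows "(\<lambda>x. f x + g x) \<in> schwartz_half_line"
proof (rule schwartz_coinduct[where C = "{\<lambda>x. f x + g x |f g. f \<in> schwartz_half_line \<and> g \<in> schwartz_half_line}"])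
  fix h k assume "h \<in> {\<lambda>x. f x + g x |f g. f \<in> schwartz_half_line \<and> g \<in> schwartz_half_line}"
  then obtain f g where h: "h = (\<lambda>x. f x + g x)" and f: "f \<in> schwartz_half_line" and g: "g \<in> schwartz_half_line"
    by blast
  obtain A where A: "\<And>x. x \<ge> 0 \<Longrightarrow> x ^ k * cmod (f x) \<le> A" using schwartz_bound[OF f] by blast
  obtain B where B: "\<And>x. x \<ge> 0 \<Longrightarrow> x ^ k * cmod (g x) \<le> B" using schwartz_bound[OF g] by blast
  have "x ^ k * cmod (h x) \<le> A + B" if "x \<ge> 0" for x
  proof -
    have "x ^ k * cmod (h x) \<le> x ^ k * (cmod (f x) + cmod (g x))"
      unfolding h using that by (intro mult_left_mono norm_triangle_ineq) auto
    with A[OF that] B[OF that] show ?thesis by (simp add: distrib_left)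
  qed
  then show "\<exists>B. \<forall>x\<ge>0. x ^ k * cmod (h x) \<le> B" by blast
next
  fix h assume "h \<in> {\<lambda>x. f x + g x |f g. f \<in> schwartz_half_line \<and> g \<in> schwartz_half_line}"
  then obtain f g where h: "h = (\<lambda>x. f x + g x)" and f: "f \<in> schwartz_half_line" and g: "g \<in> schwartz_half_line"
    by blast
  obtain f' where f': "f' \<in> schwartz_half_line"
    "\<And>x. x \<ge> 0 \<Longrightarrow> (f has_vector_derivative f' x) (at x within {0..})" using schwartz_deriv[OF f] by blast
  obtain g' where g': "g' \<in> schwartz_half_line"
    "\<And>x. x \<ge> 0 \<Longrightarrow> (g has_vector_derivative g' x) (at x within {0..})" using schwartz_deriv[OF g] by blast
  show "\<exists>g'\<in>{\<lambda>x. f x + g x |f g. f \<in> schwartz_half_line \<and> g \<in> schwartz_half_line}.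
      \<forall>x\<ge>0. (h has_vector_derivative g' x) (at x within {0..})"
    using f' g' unfolding h
    by (intro bexI[of _ "\<lambda>x. f' x + g' x"]) (auto intro!: has_vector_derivative_add)
qed (rule CollectI, rule exI[of _ f], rule exI[of _ g], use assms in simp)

lemma schwartz_cmult:
  assumes "f \<in> schwartz_half_line"
  shows "(\<lambda>x. c * f x) \<in> schwartz_half_line"
proof (rule schwartz_coinduct[where C = "(\<lambda>f x. c * f x) ` schwartz_half_line"])
  fix h k assume "h \<in> (\<lambda>f x. c * f x) ` schwartz_half_line"
  then obtain f where h: "h = (\<lambda>x. c * f x)" and f: "f \<in> schwartz_half_line" by blast
  obtain A where A: "\<And>x. x \<ge> 0 \<Longrightarrow> x ^ k * cmod (f x) \<le> A" using schwartz_bound[OF f] by blast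
  have "x ^ k * cmod (h x) \<le> cmod c * A" if "x \<ge> 0" for x
    using mult_left_mono[OF A[OF that], of "cmod c"] by (simp add: h norm_mult mult_ac)
  then show "\<exists>B. \<forall>x\<ge>0. x ^ k * cmod (h x) \<le> B" by blast
next
  fix h assume "h \<in> (\<lambda>f x. c * f x) ` schwartz_half_line"
  then obtain f where h: "h = (\<lambda>x. c * f x)" and f: "f \<in> schwartz_half_line" by blast
  obtain f' where f': "f' \<in> schwartz_half_line"
    "\<And>x. x \<ge> 0 \<Longrightarrow> (f has_vector_derivative f' x) (at x within {0..})" using schwartz_deriv[OF f] by blast
  show "\<exists>g'\<in>(\<lambda>f x. c * f x) ` schwartz_half_line.
      \<forall>x\<ge>0. (h has_vector_derivative g' x) (at x within {0..})"
    using f' unfolding h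
    by (intro bexI[of _ "\<lambda>x. c * f' x"]) (auto intro: has_vector_derivative_mult_right)
qed (rule rev_image_eqI[OF assms], rule refl)

lemma schwartz_exp_mult:
  fixes s :: complex
  assumes "f \<in> schwartz_half_line" and s: "Re s \<ge> 0"
  shows "(\<lambda>x. exp (- s * complex_of_real x) * f x) \<in> schwartz_half_line"
proof (rule schwartz_coinduct[where C = "(\<lambda>f x. exp (- s * complex_of_real x) * f x) ` schwartz_half_line"])
  fix h k assume "h \<in> (\<lambda>f x. exp (- s * complex_of_real x) * f x) ` schwartz_half_line"
  then obtain f where h: "h = (\<lambda>x. exp (- s * complex_of_real x) * f x)" and f: "f \<in> schwartz_half_line" by blast
  obtain A where A: "\<And>x. x \<ge> 0 \<Longrightarrow> x ^ k * cmod (f x) \<le> A" using schwartz_bound[OF f] by blast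
  have "x ^ k * cmod (h x) \<le> A" if "x \<ge> 0" for x
  proof -
    have "cmod (exp (- s * complex_of_real x)) \<le> 1" using s that by simp
    then have "cmod (h x) \<le> 1 * cmod (f x)"
      unfolding h norm_mult by (intro mult_right_mono) auto
    then have "x ^ k * cmod (h x) \<le> x ^ k * cmod (f x)"
      using that by (intro mult_left_mono) auto
    also note A[OF that]
    finally show ?thesis .
  qed
  then show "\<exists>B. \<forall>x\<ge>0. x ^ k * cmod (h x) \<le> B" by blast
next
  fix h assume "h \<in> (\<lambda>f x. exp (- s * complex_of_real x) * f x) ` schwartz_half_line"
  then obtain f where h: "h = (\<lambda>x. exp (- s * complex_of_real x) * f x)" and f: "f \<in> schwartz_half_line" by blast
  obtain f' where f': "f' \<in> schwartz_half_line"
    "\<And>x. x \<ge> 0 \<Longrightarrow> (f has_vector_derivative f' x) (at x within {0..})" using schwartz_deriv[OF f] by blast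
  have e: "((\<lambda>x. exp (- s * complex_of_real x)) has_vector_derivative - s * exp (- s * complex_of_real x)) (at x within {0..})" for x
    by (rule has_vector_derivative_real_field) (auto intro!: derivative_eq_intros)
  show "\<exists>g'\<in>(\<lambda>f x. exp (- s * complex_of_real x) * f x) ` schwartz_half_line.
      \<forall>x\<ge>0. (h has_vector_derivative g' x) (at x within {0..})"
  proof (intro bexI[of _ "\<lambda>x. exp (- s * complex_of_real x) * (f' x + (- s) * f x)"] allI impI imageI)
    fix x :: real assume "x \<ge> 0"
    from has_vector_derivative_mult[OF e f'(2)[OF this]]
    show "(h has_vector_derivative exp (- s * complex_of_real x) * (f' x + (- s) * f x)) (at x within {0..})"
      unfolding h by (simp add: algebra_simps)
  qed (intro schwartz_add schwartz_cmult f'(1) f)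
qed (rule rev_image_eqI[OF assms(1)], rule refl)

lemma schwartz_xmult:
  assumes "f \<in> schwartz_half_line"
  shows "(\<lambda>x. complex_of_real x * f x) \<in> schwartz_half_line"
\<comment> \<open>The products x f alone are not stable under differentiation, as (x f)' = x f' + f;
  a free Schwartz summand \<open>g\<close> makes the set stable.\<close>
proof (rule schwartz_coinduct[where C = "{\<lambda>x. complex_of_real x * f x + g x |f g. f \<in> schwartz_half_line \<and> g \<in> schwartz_half_line}"])
  have "(\<lambda>x. 0) \<in> schwartz_half_line" using schwartz_cmult[OF assms, of 0] by simp
  then show "(\<lambda>x. complex_of_real x * f x) \<in> {\<lambda>x. complex_of_real x * f x + g x |f g. f \<in> schwartz_half_line \<and> g \<in> schwartz_half_line}"
    by - (rule CollectI, rule exI[of _ f], rule exI[of _ "\<lambda>x. 0"], use assms in simp)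
next
  fix h k assume "h \<in> {\<lambda>x. complex_of_real x * f x + g x |f g. f \<in> schwartz_half_line \<and> g \<in> schwartz_half_line}"
  then obtain f g where h: "h = (\<lambda>x. complex_of_real x * f x + g x)" and f: "f \<in> schwartz_half_line" and g: "g \<in> schwartz_half_line"
    by blast
  obtain A where A: "\<And>x. x \<ge> 0 \<Longrightarrow> x ^ Suc k * cmod (f x) \<le> A" using schwartz_bound[OF f] by blast
  obtain B where B: "\<And>x. x \<ge> 0 \<Longrightarrow> x ^ k * cmod (g x) \<le> B" using schwartz_bound[OF g] by blast
  have "x ^ k * cmod (h x) \<le> A + B" if "x \<ge> 0" for x
  proof -
    have "x ^ k * cmod (h x) \<le> x ^ k * (cmod (complex_of_real x * f x) + cmod (g x))"
      unfolding h using that by (intro mult_left_mono norm_triangle_ineq) auto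
    with A[OF that] B[OF that] that show ?thesis by (simp add: distrib_left norm_mult mult_ac)
  qed
  then show "\<exists>B. \<forall>x\<ge>0. x ^ k * cmod (h x) \<le> B" by blast
next
  fix h assume "h \<in> {\<lambda>x. complex_of_real x * f x + g x |f g. f \<in> schwartz_half_line \<and> g \<in> schwartz_half_line}"
  then obtain f g where h: "h = (\<lambda>x. complex_of_real x * f x + g x)" and f: "f \<in> schwartz_half_line" and g: "g \<in> schwartz_half_line"
    by blast
  obtain f' where f': "f' \<in> schwartz_half_line"
    "\<And>x. x \<ge> 0 \<Longrightarrow> (f has_vector_derivative f' x) (at x within {0..})" using schwartz_deriv[OF f] by blast
  obtain g' where g': "g' \<in> schwartz_half_line"
    "\<And>x. x \<ge> 0 \<Longrightarrow> (g has_vector_derivative g' x) (at x within {0..})" using schwartz_deriv[OF g] by blast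
  show "\<exists>g'\<in>{\<lambda>x. complex_of_real x * f x + g x |f g. f \<in> schwartz_half_line \<and> g \<in> schwartz_half_line}.
      \<forall>x\<ge>0. (h has_vector_derivative g' x) (at x within {0..})"
  proof (intro bexI[of _ "\<lambda>x. complex_of_real x * f' x + (f x + g' x)"] allI impI)
    fix x :: real assume x: "x \<ge> 0"
    have e: "((\<lambda>x. complex_of_real x) has_vector_derivative 1) (at x within {0..})"
      by (rule has_vector_derivative_real_field) (auto intro!: derivative_eq_intros)
    from has_vector_derivative_add[OF has_vector_derivative_mult[OF e f'(2)[OF x]] g'(2)[OF x]]
    show "(h has_vector_derivative complex_of_real x * f' x + (f x + g' x)) (at x within {0..})"
      unfolding h by (simp add: algebra_simps)
  next
    show "(\<lambda>x. complex_of_real x * f' x + (f x + g' x)) \<in>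
       {\<lambda>x. complex_of_real x * f x + g x |f g. f \<in> schwartz_half_line \<and> g \<in> schwartz_half_line}"
      by (rule CollectI, rule exI[of _ f'], rule exI[of _ "\<lambda>x. f x + g' x"])
        (intro conjI refl f'(1) schwartz_add f g'(1))
  qed
qed

text \<open>The inequality t <= exp t at t = a x / k, raised to the power k. The case k = 0 is
  separate because of this quotient.\<close>

lemma power_exp_bound:
  assumes a: "a > 0"
  shows "\<exists>B. \<forall>x\<ge>0. x ^ k * exp (- a * x) \<le> (B::real)"
proof (cases "k = 0")
  case True
  then show ?thesis using a by (intro exI[of _ 1]) auto
next
  case False
  have "x ^ k * exp (- a * x) \<le> (real k / a) ^ k" if x: "x \<ge> 0" for x
  proof -
    have "a * x / k \<le> exp (a * x / k)" by (rule order_trans[OF _ exp_ge_add_one_self]) simp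
    then have "(a * x / k) ^ k \<le> exp (a * x / k) ^ k" using a x by (intro power_mono) auto
    also have "\<dots> = exp (a * x)" using False by (simp flip: exp_of_nat_mult)
    finally have "(real k / a) ^ k * (a * x / k) ^ k \<le> (real k / a) ^ k * exp (a * x)"
      using a by (intro mult_left_mono) auto
    also have "(real k / a) ^ k * (a * x / k) ^ k = x ^ k"
      using a False by (simp flip: power_mult_distrib)
    finally have "x ^ k / exp (a * x) \<le> (real k / a) ^ k" by (simp only: pos_divide_le_eq exp_gt_zero)
    then show ?thesis by (simp add: exp_minus divide_inverse)
  qed
  then show ?thesis by blast
qed

lemma schwartz_exp:
  assumes s: "Re s > 0"
  shows "(\<lambda>x. exp (- s * complex_of_real x)) \<in> schwartz_half_line"
proof (rule schwartz_coinduct[where C = "range (\<lambda>c x. c * exp (- s * complex_of_real x))"])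
  show "(\<lambda>x. exp (- s * complex_of_real x)) \<in> range (\<lambda>c x. c * exp (- s * complex_of_real x))"
    by (rule range_eqI[of _ _ 1]) simp
next
  fix h k assume "h \<in> range (\<lambda>c x. c * exp (- s * complex_of_real x))"
  then obtain c where h: "h = (\<lambda>x. c * exp (- s * complex_of_real x))" by blast
  obtain B where "\<And>x. x \<ge> 0 \<Longrightarrow> x ^ k * exp (- Re s * x) \<le> B" using power_exp_bound[OF s] by blast
  then have "x ^ k * cmod (h x) \<le> cmod c * B" if "x \<ge> 0" for x
    using mult_left_mono[of "x ^ k * exp (- Re s * x)" B "cmod c"] that by (simp add: h norm_mult mult_ac)
  then show "\<exists>B. \<forall>x\<ge>0. x ^ k * cmod (h x) \<le> B" by blast
next
  fix h assume "h \<in> range (\<lambda>c x. c * exp (- s * complex_of_real x))"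
  then obtain c where h: "h = (\<lambda>x. c * exp (- s * complex_of_real x))" by blast
  have "(h has_vector_derivative (c * - s) * exp (- s * complex_of_real x)) (at x within {0..})" for x
    unfolding h by (rule has_vector_derivative_real_field) (auto intro!: derivative_eq_intros)
  then show "\<exists>g'\<in>range (\<lambda>c x. c * exp (- s * complex_of_real x)). \<forall>x\<ge>0. (h has_vector_derivative g' x) (at x within {0..})"
    by - (rule bexI[of _ "\<lambda>x. (c * - s) * exp (- s * complex_of_real x)"], simp, rule rangeI)
qed

text \<open>$\mathcal{H}_d$ maps $x^{(d+1)/2} w$ to $y^{(d+1)/2}$ times this function.\<close>

definition hank :: "nat \<Rightarrow> (real \<Rightarrow> complex) \<Rightarrow> real \<Rightarrow> complex" where
  "hank d w y = (LINT x|HL. bes d (x * y) *\<^sub>R x ^ d *\<^sub>R w x)"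

section \<open>Differentiation and decay of Hankel transforms\<close>

lemma has_vector_derivative_quadratic:
  fixes f :: "real \<Rightarrow> 'a::real_normed_vector"
  assumes "\<And>z. z \<in> S \<Longrightarrow> norm (f z - f y - (z - y) *\<^sub>R D) \<le> C * (z - y)\<^sup>2"
  shows "(f has_vector_derivative D) (at y within S)"
  unfolding has_vector_derivative_def has_derivative_within_alt
proof (intro conjI allI impI)
  show "bounded_linear (\<lambda>x. x *\<^sub>R D)" by (rule bounded_linear_scaleR_left)
  fix e :: real assume e: "e > 0"
  show "\<exists>d>0. \<forall>z\<in>S. norm (z - y) < d \<longrightarrow> norm (f z - f y - (z - y) *\<^sub>R D) \<le> e * norm (z - y)"
  proof (intro exI[of _ "e / (\<bar>C\<bar> + 1)"] conjI ballI impI)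
    show "e / (\<bar>C\<bar> + 1) > 0" using e by (simp add: add_nonneg_pos)
    fix z assume z: "z \<in> S" "norm (z - y) < e / (\<bar>C\<bar> + 1)"
    have "norm (f z - f y - (z - y) *\<^sub>R D) \<le> C * (z - y)\<^sup>2" using assms z by blast
    also have "\<dots> \<le> (\<bar>C\<bar> + 1) * (norm (z - y) * norm (z - y))"
      by (simp add: power2_eq_square mult_right_mono)
    also have "\<dots> \<le> (\<bar>C\<bar> + 1) * (e / (\<bar>C\<bar> + 1) * norm (z - y))"
      using z by (intro mult_left_mono mult_right_mono) auto
    also have "\<dots> = e * norm (z - y)" by (simp add: field_simps)
    finally show "norm (f z - f y - (z - y) *\<^sub>R D) \<le> e * norm (z - y)" .
  qed
qed

lemma hank_integrable:
  fixes w :: "real \<Rightarrow> complex"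
  assumes w: "integrable HL (\<lambda>x. x ^ d *\<^sub>R w x)" and y: "y \<ge> 0"
  shows "integrable HL (\<lambda>x. bes e (x * y) *\<^sub>R x ^ d *\<^sub>R w x)"
proof (rule Bochner_Integration.integrable_bound[OF w])
  show "(\<lambda>x. bes e (x * y) *\<^sub>R x ^ d *\<^sub>R w x) \<in> borel_measurable HL"
    by (rule borel_measurable_scaleR[OF measurable_HL_borel borel_measurable_integrable[OF w]]) measurable
  show "AE x in HL. norm (bes e (x * y) *\<^sub>R x ^ d *\<^sub>R w x) \<le> norm (x ^ d *\<^sub>R w x)"
    unfolding AE_HL_iff norm_scaleR[of "bes _ _"] using bes_bound y by (auto intro!: mult_left_le_one_le)
qed

lemma hank_bound:
  assumes w: "integrable HL (\<lambda>x. x ^ d *\<^sub>R w x)" and y: "y \<ge> 0"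
  shows "cmod (hank d w y) \<le> (LINT x|HL. x ^ d * cmod (w x))"
proof -
  have "cmod (hank d w y) \<le> (LINT x|HL. norm (bes d (x * y) *\<^sub>R x ^ d *\<^sub>R w x))"
    unfolding hank_def by (rule integral_norm_bound)
  also have "\<dots> \<le> (LINT x|HL. norm (x ^ d *\<^sub>R w x))"
  proof (rule integral_mono_AE)
    show "AE x in HL. norm (bes d (x * y) *\<^sub>R x ^ d *\<^sub>R w x) \<le> norm (x ^ d *\<^sub>R w x)"
      unfolding AE_HL_iff norm_scaleR[of "bes _ _"] using bes_bound y by (auto intro!: mult_left_le_one_le)
  qed (use w hank_integrable[OF w y] in \<open>auto simp del: norm_scaleR\<close>)
  also have "\<dots> = (LINT x|HL. x ^ d * cmod (w x))"
    by (intro Bochner_Integration.integral_cong) auto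
  finally show ?thesis .
qed

text \<open>\<open>bes_taylor\<close> at the points x z and x y has the error (x (z - y))^2, whence
  the moment of order d + 2. The hypotheses ask for moments only, and the constant is explicit and
  uniform: in this form the estimate also serves functions not yet known to be smooth.\<close>

lemma hank_taylor:
  assumes w: "\<And>n. n \<ge> d \<Longrightarrow> integrable HL (\<lambda>x. x ^ n *\<^sub>R w x)" and y: "y \<ge> 0" and z: "z \<ge> 0"
  shows "norm (hank d w z - hank d w y - (z - y) *\<^sub>R - hank (Suc d) w y)
    \<le> (LINT x|HL. norm (x ^ (d + 2) *\<^sub>R w x)) * (z - y)\<^sup>2"
proof -
  have eq: "hank d w z - hank d w y - (z - y) *\<^sub>R - hank (Suc d) w y
     = (LINT x|HL. (bes d (x * z) - bes d (x * y) + (x * z - x * y) * bes (Suc d) (x * y)) *\<^sub>R x ^ d *\<^sub>R w x)"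
  proof -
    have i: "integrable HL (\<lambda>x. bes d (x * z) *\<^sub>R x ^ d *\<^sub>R w x)"
      "integrable HL (\<lambda>x. bes d (x * y) *\<^sub>R x ^ d *\<^sub>R w x)"
      "integrable HL (\<lambda>x. bes (Suc d) (x * y) *\<^sub>R x ^ Suc d *\<^sub>R w x)"
      using hank_integrable[OF w[of d] z, of d] hank_integrable[OF w[of d] y, of d]
        hank_integrable[OF w[of "Suc d"] y, of "Suc d"] by (simp_all only: order_refl le_SucI)
    have "hank d w z - hank d w y - (z - y) *\<^sub>R - hank (Suc d) w y
      = (LINT x|HL. bes d (x * z) *\<^sub>R x ^ d *\<^sub>R w x - bes d (x * y) *\<^sub>R x ^ d *\<^sub>R w x
          + (z - y) *\<^sub>R (bes (Suc d) (x * y) *\<^sub>R x ^ Suc d *\<^sub>R w x))"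
      unfolding hank_def using i by (simp del: scaleR_scaleR)
    then show ?thesis by (simp add: algebra_simps)
  qed
  have "norm (hank d w z - hank d w y - (z - y) *\<^sub>R - hank (Suc d) w y)
    \<le> (LINT x|HL. norm ((bes d (x * z) - bes d (x * y) + (x * z - x * y) * bes (Suc d) (x * y)) *\<^sub>R x ^ d *\<^sub>R w x))"
    unfolding eq by (rule integral_norm_bound)
  also have "\<dots> \<le> (LINT x|HL. (z - y)\<^sup>2 * norm (x ^ (d + 2) *\<^sub>R w x))"
  proof (rule integral_mono')
    show "integrable HL (\<lambda>x. (z - y)\<^sup>2 * norm (x ^ (d + 2) *\<^sub>R w x))"
      using w[of "d + 2"] by (intro integrable_mult_right integrable_norm) auto
    fix x assume "x \<in> space HL"
    then have x: "x > 0" by simp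
    have "\<bar>bes d (x * z) - bes d (x * y) + (x * z - x * y) * bes (Suc d) (x * y)\<bar> \<le> (x * z - x * y)\<^sup>2"
      using x y z by (intro bes_taylor) auto
    also have "\<dots> = x\<^sup>2 * (z - y)\<^sup>2" by (simp add: power_mult_distrib flip: right_diff_distrib)
    finally have "\<bar>bes d (x * z) - bes d (x * y) + (x * z - x * y) * bes (Suc d) (x * y)\<bar> * norm (x ^ d *\<^sub>R w x)
      \<le> (x\<^sup>2 * (z - y)\<^sup>2) * norm (x ^ d *\<^sub>R w x)" by (rule mult_right_mono) simp
    moreover have r: "norm (x ^ (d + 2) *\<^sub>R w x) = x\<^sup>2 * norm (x ^ d *\<^sub>R w x)"
      using x by (simp add: power_add power2_eq_square mult_ac abs_mult)
    ultimately show "norm ((bes d (x * z) - bes d (x * y) + (x * z - x * y) * bes (Suc d) (x * y)) *\<^sub>R x ^ d *\<^sub>R w x)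
      \<le> (z - y)\<^sup>2 * norm (x ^ (d + 2) *\<^sub>R w x)"
      unfolding r by (subst norm_scaleR) (simp only: mult_ac)
  qed simp
  finally show ?thesis by (simp add: mult.commute)
qed

lemma hank_deriv:
  assumes w: "\<And>n. n \<ge> d \<Longrightarrow> integrable HL (\<lambda>x. x ^ n *\<^sub>R w x)" and y: "y \<ge> 0"
  shows "(hank d w has_vector_derivative - hank (Suc d) w y) (at y within {0..})"
  by (rule has_vector_derivative_quadratic, rule hank_taylor[OF w y]) simp_all

lemma integral_HL_deriv:
  fixes F f :: "real \<Rightarrow> complex"
  assumes F: "\<And>x. x \<ge> 0 \<Longrightarrow> (F has_vector_derivative f x) (at x within {0..})"
    and f: "continuous_on {0<..} f" "integrable HL f"
    and lim: "(F \<longlongrightarrow> 0) at_top"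
  shows "integral\<^sup>L HL f = - F 0"
proof -
  have e: "einterval 0 \<infinity> = {0<..}" by (auto simp: einterval_def)
  have "(LBINT x=0..\<infinity>. f x) = 0 - F 0"
  proof (rule interval_integral_FTC_integrable)
    show "(F has_vector_derivative f x) (at x)" if "0 < ereal x" "ereal x < \<infinity>" for x
      using F[of x] that by (simp add: at_within_interior[of x "{0..}"])
    show "isCont f x" if "0 < ereal x" "ereal x < \<infinity>" for x
      using f(1) that by (simp add: continuous_on_eq_continuous_at)
    show "set_integrable lborel (einterval 0 \<infinity>) f"
      using f(2) by (simp add: e set_integrable_def integrable_restrict_space)
    have "continuous (at 0 within {0..}) F"
      using F[of 0] by (auto intro: has_vector_derivative_continuous)
    then have "(F \<longlongrightarrow> F 0) (at_right 0)"
      by (auto simp: continuous_within intro: tendsto_within_subset)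
    then show "((F \<circ> real_of_ereal) \<longlongrightarrow> F 0) (at_right 0)"
      unfolding zero_ereal_def by (simp add: ereal_tendsto_simps)
    show "((F \<circ> real_of_ereal) \<longlongrightarrow> 0) (at_left \<infinity>)"
      using lim by (simp add: ereal_tendsto_simps)
  qed simp
  then show ?thesis
    by (simp add: interval_lebesgue_integral_def e set_lebesgue_integral_def integral_restrict_space)
qed

lemma tendsto_0_inverse_bound:
  fixes F :: "real \<Rightarrow> complex"
  assumes "\<And>x. x \<ge> 0 \<Longrightarrow> x * cmod (F x) \<le> C"
  shows "(F \<longlongrightarrow> 0) at_top"
proof (rule Lim_null_comparison)
  show "\<forall>\<^sub>F x in at_top. cmod (F x) \<le> C * inverse x"
    using eventually_gt_at_top[of 0]
  proof eventually_elim
    case (elim x)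
    then show ?case using assms[of x] by (simp add: field_simps)
  qed
  show "((\<lambda>x. C * inverse x) \<longlongrightarrow> 0) at_top"
    by (intro tendsto_mult_right_zero tendsto_inverse_0_at_top filterlim_ident)
qed

lemma hank_schwartz_integrand:
  assumes "f \<in> schwartz_half_line" "y \<ge> 0"
  shows "integrable HL (\<lambda>x. bes e (x * y) *\<^sub>R x ^ n *\<^sub>R f x)"
    and "continuous_on {0<..} (\<lambda>x. bes e (x * y) *\<^sub>R x ^ n *\<^sub>R f x)"
    and "((\<lambda>x. bes e (x * y) *\<^sub>R x ^ n *\<^sub>R f x) \<longlongrightarrow> 0) at_top"
proof -
  show "integrable HL (\<lambda>x. bes e (x * y) *\<^sub>R x ^ n *\<^sub>R f x)"
    using assms by (intro hank_integrable schwartz_integrable)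
  show "continuous_on {0<..} (\<lambda>x. bes e (x * y) *\<^sub>R x ^ n *\<^sub>R f x)"
    by (intro continuous_intros continuous_on_subset[OF schwartz_continuous[OF assms(1)]]) auto
  obtain C where C: "\<And>x. x \<ge> 0 \<Longrightarrow> x ^ Suc n * cmod (f x) \<le> C" using schwartz_bound[OF assms(1)] by blast
  show "((\<lambda>x. bes e (x * y) *\<^sub>R x ^ n *\<^sub>R f x) \<longlongrightarrow> 0) at_top"
  proof (rule tendsto_0_inverse_bound)
    fix x :: real assume x: "x \<ge> 0"
    have "\<bar>bes e (x * y)\<bar> * (x ^ Suc n * cmod (f x)) \<le> 1 * (x ^ Suc n * cmod (f x))"
      using x assms(2) by (intro mult_right_mono bes_bound) auto
    also note C[OF x]
    finally show "x * cmod (bes e (x * y) *\<^sub>R x ^ n *\<^sub>R f x) \<le> 1 * C"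
      using x by (simp add: mult_ac abs_mult)
  qed
qed

text \<open>The boundary terms vanish, at 0 because of the factor \<open>x ^ Suc d\<close> and at
  infinity by rapid decay. The first identity integrates x^d bes d (x y), which by the recurrence is
  the x-derivative of x^(d+1) bes (d+1) (x y); the second differentiates x^(d+1) bes d (x y) f(x).
  Applied in turn they convert multiplication of the transform by y into the operator - (x f'' + (d
  + 1) f').\<close>

lemma hank_by_parts:
  assumes f: "f \<in> schwartz_half_line" and f': "f' \<in> schwartz_half_line"
    and der: "\<And>x. x \<ge> 0 \<Longrightarrow> (f has_vector_derivative f' x) (at x within {0..})" and y: "y \<ge> 0"
  shows "hank d f y = - hank (Suc d) f' y"
    and "y *\<^sub>R hank (Suc d) f y = hank d (\<lambda>x. of_nat (Suc d) * f x + complex_of_real x * f' x) y"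
proof -
  have b: "((\<lambda>x. bes e (x * y)) has_real_derivative - bes (Suc e) (x * y) * y) (at x within {0..})" for e x
    by (rule has_field_derivative_at_within, rule DERIV_chain2[OF bes_deriv]) (auto intro!: derivative_eq_intros)
  have p: "((\<lambda>x. x ^ Suc d) has_real_derivative (1 + real d) * x ^ d) (at x within {0..})" for x :: real
    by (rule DERIV_cong[OF DERIV_power[OF DERIV_ident]]) simp
  note int = hank_schwartz_integrand[OF _ y]
  have "integral\<^sup>L HL (\<lambda>x. bes d (x * y) *\<^sub>R x ^ d *\<^sub>R f x + bes (Suc d) (x * y) *\<^sub>R x ^ Suc d *\<^sub>R f' x)
     = - (bes (Suc d) (0 * y) *\<^sub>R 0 ^ Suc d *\<^sub>R f 0)"
  proof (rule integral_HL_deriv)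
    fix x :: real assume x: "x \<ge> 0"
    have "((\<lambda>x. (bes (Suc d) (x * y) * x ^ Suc d) *\<^sub>R f x) has_vector_derivative
       (bes (Suc d) (x * y) * x ^ Suc d) *\<^sub>R f' x
       + (bes (Suc d) (x * y) * ((1 + real d) * x ^ d) + (- bes (Suc (Suc d)) (x * y) * y) * x ^ Suc d) *\<^sub>R f x) (at x within {0..})"
      by (rule has_vector_derivative_scaleR[OF DERIV_cong[OF DERIV_mult[OF b p]] der[OF x]]) (simp only: mult_ac add_ac)
    moreover have "bes (Suc d) (x * y) * ((1 + real d) * x ^ d) + (- bes (Suc (Suc d)) (x * y) * y) * x ^ Suc d
       = bes d (x * y) * x ^ d"
      unfolding bes_recurrence[of d "x * y", symmetric] by (simp add: algebra_simps)
    ultimately show "((\<lambda>x. bes (Suc d) (x * y) *\<^sub>R x ^ Suc d *\<^sub>R f x) has_vector_derivative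
      bes d (x * y) *\<^sub>R x ^ d *\<^sub>R f x + bes (Suc d) (x * y) *\<^sub>R x ^ Suc d *\<^sub>R f' x) (at x within {0..})"
      by (simp add: add.commute)
  qed (intro continuous_on_add Bochner_Integration.integrable_add int f f')+
  then show "hank d f y = - hank (Suc d) f' y"
    unfolding hank_def using int(1)[OF f, of d d] int(1)[OF f', of "Suc d" "Suc d"]
    by (simp add: eq_neg_iff_add_eq_0 del: scaleR_scaleR power_Suc)
  have "integral\<^sup>L HL (\<lambda>x. bes d (x * y) *\<^sub>R x ^ d *\<^sub>R (of_nat (Suc d) * f x + complex_of_real x * f' x)
      + (- y) *\<^sub>R (bes (Suc d) (x * y) *\<^sub>R x ^ Suc d *\<^sub>R f x))
     = - (bes d (0 * y) *\<^sub>R 0 ^ Suc d *\<^sub>R f 0)"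
  proof (rule integral_HL_deriv)
    fix x :: real assume x: "x \<ge> 0"
    have "((\<lambda>x. (bes d (x * y) * x ^ Suc d) *\<^sub>R f x) has_vector_derivative
       (bes d (x * y) * x ^ Suc d) *\<^sub>R f' x
       + (bes d (x * y) * ((1 + real d) * x ^ d) + (- bes (Suc d) (x * y) * y) * x ^ Suc d) *\<^sub>R f x) (at x within {0..})"
      by (rule has_vector_derivative_scaleR[OF DERIV_cong[OF DERIV_mult[OF b p]] der[OF x]]) (simp only: mult_ac add_ac)
    then show "((\<lambda>x. bes d (x * y) *\<^sub>R x ^ Suc d *\<^sub>R f x) has_vector_derivative
      bes d (x * y) *\<^sub>R x ^ d *\<^sub>R (of_nat (Suc d) * f x + complex_of_real x * f' x)
      + (- y) *\<^sub>R (bes (Suc d) (x * y) *\<^sub>R x ^ Suc d *\<^sub>R f x)) (at x within {0..})"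
      by (simp add: scaleR_conv_of_real algebra_simps)
  qed (intro continuous_on_add continuous_on_scaleR continuous_on_const Bochner_Integration.integrable_add
      integrable_scaleR_right int schwartz_add schwartz_cmult schwartz_xmult f f')+
  then show "y *\<^sub>R hank (Suc d) f y = hank d (\<lambda>x. of_nat (Suc d) * f x + complex_of_real x * f' x) y"
    unfolding hank_def using int(1)[OF schwartz_add[OF schwartz_cmult[OF f] schwartz_xmult[OF f']], of d d "of_nat (Suc d)"]
      int(1)[OF f, of "Suc d" "Suc d"]
    by (simp del: scaleR_scaleR power_Suc scaleR_minus_left of_nat_Suc) (simp add: algebra_simps)
qed

text \<open>Each factor \<open>y\<close> is traded, up to sign, for the second-order operator
  \<open>?g\<close> of the integrations by parts, which preserves the Schwartz space.\<close>

lemma hank_decay: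
  assumes "f \<in> schwartz_half_line"
  shows "\<exists>C. \<forall>y\<ge>0. y ^ k * cmod (hank d f y) \<le> C"
  using assms
proof (induction k arbitrary: f)
  case 0
  then show ?case using hank_bound[OF schwartz_integrable[OF 0]] by auto
next
  case (Suc k)
  obtain f' where f': "f' \<in> schwartz_half_line"
    "\<And>x. x \<ge> 0 \<Longrightarrow> (f has_vector_derivative f' x) (at x within {0..})" using schwartz_deriv[OF Suc.prems] by blast
  obtain f'' where f'': "f'' \<in> schwartz_half_line"
    "\<And>x. x \<ge> 0 \<Longrightarrow> (f' has_vector_derivative f'' x) (at x within {0..})" using schwartz_deriv[OF f'(1)] by blast
  let ?g = "\<lambda>x. of_nat (Suc d) * f' x + complex_of_real x * f'' x"
  have "?g \<in> schwartz_half_line" by (intro schwartz_add schwartz_cmult schwartz_xmult f' f'')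
  then obtain C where C: "\<And>y. y \<ge> 0 \<Longrightarrow> y ^ k * cmod (hank d ?g y) \<le> C" using Suc.IH by blast
  have "y ^ Suc k * cmod (hank d f y) = y ^ k * cmod (hank d ?g y)" if y: "y \<ge> 0" for y
  proof -
    have "y *\<^sub>R hank d f y = - hank d ?g y"
      using hank_by_parts(1)[OF Suc.prems f' y, of d] hank_by_parts(2)[OF f'(1) f'' y, of d] by simp
    then have "cmod (y *\<^sub>R hank d f y) = cmod (hank d ?g y)" by simp
    then show ?thesis using y by simp
  qed
  with C show ?case by (intro exI[of _ C] allI impI) (simp only:)
qed

lemma hank_schwartz:
  assumes "f \<in> schwartz_half_line"
  shows "hank d f \<in> schwartz_half_line"
\<comment> \<open>The order \<open>n\<close> varies within the class because differentiation raises
  it; the scalar \<open>c\<close> absorbs the sign.\<close>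
proof (rule schwartz_coinduct[where C = "{\<lambda>y. c * hank n f y |c n f. f \<in> schwartz_half_line}"])
  have "hank d f = (\<lambda>y. 1 * hank d f y)" by simp
  then show "hank d f \<in> {\<lambda>y. c * hank n f y |c n f. f \<in> schwartz_half_line}" 
    by (intro CollectI exI[of _ 1] exI[of _ d] exI[of _ f] conjI assms) (use assms in simp_all)
next
  fix g k assume "g \<in> {\<lambda>y. c * hank n f y |c n f. f \<in> schwartz_half_line}"
  then obtain c n f where g: "g = (\<lambda>y. c * hank n f y)" and f: "f \<in> schwartz_half_line" by blast
  obtain B where "\<And>y. y \<ge> 0 \<Longrightarrow> y ^ k * cmod (hank n f y) \<le> B" using hank_decay[OF f] by blast
  then have "y ^ k * cmod (g y) \<le> cmod c * B" if "y \<ge> 0" for y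
    using mult_left_mono[of "y ^ k * cmod (hank n f y)" B "cmod c"] that by (simp add: g norm_mult mult_ac)
  then show "\<exists>B. \<forall>x\<ge>0. x ^ k * cmod (g x) \<le> B" by blast
next
  fix g assume "g \<in> {\<lambda>y. c * hank n f y |c n f. f \<in> schwartz_half_line}"
  then obtain c n f where g: "g = (\<lambda>y. c * hank n f y)" and f: "f \<in> schwartz_half_line" by blast
  have "(g has_vector_derivative (- c) * hank (Suc n) f y) (at y within {0..})" if "y \<ge> 0" for y
    using has_vector_derivative_mult_right[OF hank_deriv[OF schwartz_integrable[OF f] that], of c n]
    by (simp add: g)
  then show "\<exists>g'\<in>{\<lambda>y. c * hank n f y |c n f. f \<in> schwartz_half_line}.
      \<forall>x\<ge>0. (g has_vector_derivative g' x) (at x within {0..})"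
    by (intro bexI[of _ "\<lambda>y. (- c) * hank (Suc n) f y"] CollectI exI[of _ "- c"] exI[of _ "Suc n"] exI[of _ f] conjI f) simp_all
qed

lemma integral_HL_exp:
  assumes s: "Re s > 0"
  shows "(LINT x|HL. exp (- s * complex_of_real x)) = 1 / s"
proof -
  have s0: "s \<noteq> 0" using s by auto
  have S: "(\<lambda>x. (- 1 / s) * exp (- s * complex_of_real x)) \<in> schwartz_half_line"
    by (intro schwartz_cmult schwartz_exp s)
  have "(LINT x|HL. exp (- s * complex_of_real x)) = - ((- 1 / s) * exp (- s * complex_of_real 0))"
  proof (rule integral_HL_deriv)
    show "((\<lambda>x. (- 1 / s) * exp (- s * complex_of_real x)) has_vector_derivative exp (- s * complex_of_real x)) (at x within {0..})" for x
      by (rule has_vector_derivative_real_field) (use s0 in \<open>auto intro!: derivative_eq_intros\<close>)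
    show "integrable HL (\<lambda>x. exp (- s * complex_of_real x))"
      using schwartz_integrable[OF schwartz_exp[OF s], of 0] by simp
    show "((\<lambda>x. (- 1 / s) * exp (- s * complex_of_real x)) \<longlongrightarrow> 0) at_top"
      using schwartz_bound[OF S, of 1] tendsto_0_inverse_bound[of "\<lambda>x. (- 1 / s) * exp (- s * complex_of_real x)"]
      by (metis power_one_right)
  qed (intro continuous_intros)
  then show ?thesis by simp
qed

text \<open>Integration by parts shows that raising the order divides the transform by
  \<open>s\<close>, while differentiation in y raises the order up to sign. So the transform solves
  u' = - u / s. Its value at 0 comes by induction on the order from the integral of the
  exponential.\<close>

lemma hank_exp:
  assumes s: "Re s > 0" and y: "y \<ge> 0"
  shows "hank d (\<lambda>x. exp (- s * complex_of_real x)) y = exp (- complex_of_real y / s) / s ^ Suc d"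
proof -
  let ?e = "\<lambda>x. exp (- s * complex_of_real x)"
  have s0: "s \<noteq> 0" using s by auto
  have e: "?e \<in> schwartz_half_line" by (rule schwartz_exp[OF s])
  have de: "(?e has_vector_derivative - s * ?e x) (at x within {0..})" for x
    by (rule has_vector_derivative_real_field) (auto intro!: derivative_eq_intros)
  have step: "hank (Suc n) ?e y = hank n ?e y / s" if "y \<ge> 0" for n y
  proof -
    have "hank n ?e y = - hank (Suc n) (\<lambda>x. - s * ?e x) y"
      by (rule hank_by_parts(1)[OF e schwartz_cmult[OF e] de that])
    also have "\<dots> = - (- s * hank (Suc n) ?e y)"
      unfolding hank_def by (subst integral_mult_right_zero[symmetric]) (simp add: mult_ac)
    finally show ?thesis using s0 by (simp add: field_simps)
  qed
  have h0: "hank n ?e 0 = 1 / s ^ Suc n" for n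
  proof (induction n)
    case 0
    show ?case using integral_HL_exp[OF s] by (simp add: hank_def bes_0)
  next
    case (Suc n)
    then show ?case using step[of 0 n] by (simp add: field_simps)
  qed
  let ?G = "\<lambda>y. hank d ?e y * exp (complex_of_real y / s)"
  have dG: "(?G has_vector_derivative 0) (at y within {0..})" if "y \<ge> 0" for y
  proof -
    have x: "((\<lambda>y. exp (complex_of_real y / s)) has_vector_derivative exp (complex_of_real y / s) / s) (at y within {0..})"
      by (rule has_vector_derivative_real_field) (auto intro!: derivative_eq_intros simp: s0)
    from has_vector_derivative_mult[OF hank_deriv[OF schwartz_integrable[OF e] that] x, of d]
    show ?thesis unfolding step[OF that] by simp
  qed
  have "\<exists>c. \<forall>y\<in>{0..}. ?G y = c"
    by (rule has_derivative_zero_constant) (use dG in \<open>auto simp: has_vector_derivative_def\<close>)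
  then obtain c where c: "\<forall>y\<in>{0..}. ?G y = c" ..
  have "?G y = ?G 0" using bspec[OF c, of y] bspec[OF c, of 0] y by (simp only: atLeast_iff order_refl)
  also have "?G 0 = 1 / s ^ Suc d" unfolding h0 by simp
  finally have eq: "hank d ?e y * exp (complex_of_real y / s) = 1 / s ^ Suc d" .
  have "hank d ?e y = (hank d ?e y * exp (complex_of_real y / s)) * exp (- complex_of_real y / s)"
    by (simp add: mult.assoc flip: exp_add)
  then show ?thesis unfolding eq by simp
qed

text \<open>Fubini applies to any two integrable functions, because the kernel is bounded by 1; and
  the kernel depends on the product of its variables only.\<close>

lemma bes_kernel_symmetric:
  fixes W V :: "real \<Rightarrow> complex"
  assumes W: "integrable HL W" and V: "integrable HL V"
  shows "(LINT y|HL. (LINT x|HL. bes d (x * y) *\<^sub>R W x) * V y) = (LINT x|HL. W x * (LINT y|HL. bes d (y * x) *\<^sub>R V y))"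
proof -
  interpret H: sigma_finite_measure HL by (rule sigma_finite_HL)
  interpret P: pair_sigma_finite HL HL ..
  have [measurable]: "W \<in> borel_measurable HL" "V \<in> borel_measurable HL" using W V by auto
  have [measurable]: "(\<lambda>x. x) \<in> borel_measurable HL" by (rule measurable_HL_borel) simp
  have bd: "norm (bes d (x * y) *\<^sub>R (W x * V y)) \<le> norm (W x) * norm (V y)" if "x > 0" "y > 0" for x y
    using bes_bound[of "x * y" d] that
    unfolding norm_scaleR norm_mult by (intro mult_left_le_one_le) auto
  have i: "integrable (HL \<Otimes>\<^sub>M HL) (\<lambda>(x, y). bes d (x * y) *\<^sub>R (W x * V y))"
  proof (rule P.Fubini_integrable)
    show "(\<lambda>(x, y). bes d (x * y) *\<^sub>R (W x * V y)) \<in> borel_measurable (HL \<Otimes>\<^sub>M HL)"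
      by measurable
    have int: "integrable HL (\<lambda>y. bes d (x * y) *\<^sub>R (W x * V y))" if "x > 0" for x
    proof (rule Bochner_Integration.integrable_bound)
      show "integrable HL (\<lambda>y. norm (W x) * norm (V y))" using V by (intro integrable_mult_right integrable_norm)
      show "AE y in HL. norm (bes d (x * y) *\<^sub>R (W x * V y)) \<le> norm (norm (W x) * norm (V y))"
        unfolding AE_HL_iff using bd[OF that] by (simp del: norm_scaleR add: abs_mult)
    qed measurable
    then show "AE x in HL. integrable HL (\<lambda>y. case (x, y) of (x, y) \<Rightarrow> bes d (x * y) *\<^sub>R (W x * V y))"
      by (simp add: AE_HL_iff)
    show "integrable HL (\<lambda>x. LINT y|HL. norm (case (x, y) of (x, y) \<Rightarrow> bes d (x * y) *\<^sub>R (W x * V y)))"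
    proof (rule Bochner_Integration.integrable_bound)
      show "integrable HL (\<lambda>x. norm (W x) * (LINT y|HL. norm (V y)))"
        using W by (intro integrable_mult_left integrable_norm)
      have "(LINT y|HL. norm (bes d (x * y) *\<^sub>R (W x * V y))) \<le> norm (W x) * (LINT y|HL. norm (V y))" if "x > 0" for x
      proof -
        have "(LINT y|HL. norm (bes d (x * y) *\<^sub>R (W x * V y))) \<le> (LINT y|HL. norm (W x) * norm (V y))"
          using V bd[OF that] by (intro integral_mono') (simp_all del: norm_scaleR)
        then show ?thesis by simp
      qed
      then show "AE x in HL. norm (LINT y|HL. norm (case (x, y) of (x, y) \<Rightarrow> bes d (x * y) *\<^sub>R (W x * V y)))
          \<le> norm (norm (W x) * (LINT y|HL. norm (V y)))"
        by (simp add: AE_HL_iff abs_mult del: norm_scaleR)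
    qed measurable
  qed
  have "(LINT y|HL. (LINT x|HL. bes d (x * y) *\<^sub>R W x) * V y) = (LINT y|HL. LINT x|HL. bes d (x * y) *\<^sub>R (W x * V y))"
    by (intro Bochner_Integration.integral_cong refl, subst integral_mult_left_zero[symmetric]) simp
  also have "\<dots> = (LINT x|HL. LINT y|HL. bes d (x * y) *\<^sub>R (W x * V y))"
    using P.Fubini_integral[OF i] by simp
  also have "\<dots> = (LINT x|HL. W x * (LINT y|HL. bes d (y * x) *\<^sub>R V y))"
    by (intro Bochner_Integration.integral_cong refl, subst integral_mult_right_zero[symmetric])
      (simp add: mult.commute)
  finally show ?thesis .
qed

text \<open>Only the moment of order \<open>d\<close> is assumed, since in the converse direction
  this is applied with a \<open>w\<close> whose smoothness is unknown.\<close>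

lemma hank_symmetric:
  assumes "integrable HL (\<lambda>x. x ^ d *\<^sub>R w x)" "integrable HL (\<lambda>x. x ^ d *\<^sub>R g x)"
  shows "(LINT y|HL. hank d w y * (y ^ d *\<^sub>R g y)) = (LINT x|HL. (x ^ d *\<^sub>R w x) * hank d g x)"
  unfolding hank_def by (rule bes_kernel_symmetric[OF assms])

section \<open>Laplace and Fourier transforms\<close>

text \<open>The weight \<open>x ^ d\<close> collects the power (d - 1) / 2 of the definition of T_d
  and the power (d + 1) / 2 of S_d. On the imaginary axis \<open>lap\<close> is therefore T_d up to
  a constant (\<open>T_op_emb\<close>).\<close>

definition lap :: "nat \<Rightarrow> (real \<Rightarrow> complex) \<Rightarrow> complex \<Rightarrow> complex" where
  "lap d f s = (LINT x|HL. exp (- s * complex_of_real x) * (x ^ d *\<^sub>R f x))"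

lemma lap_dominated:
  assumes "Re s \<ge> 0" "x > 0"
  shows "cmod (exp (- s * complex_of_real x) * z) \<le> cmod z"
proof -
  have "cmod (exp (- s * complex_of_real x)) \<le> 1" using assms by simp
  then show ?thesis unfolding norm_mult by (intro mult_left_le_one_le) auto
qed

lemma measurable_HL_exp [measurable]: "(\<lambda>x. exp (- s * complex_of_real x)) \<in> borel_measurable HL"
  by (rule measurable_HL_continuous) (intro continuous_intros)

lemma lap_bound:
  assumes f: "f \<in> schwartz_half_line" and s: "Re s \<ge> 0"
  shows "cmod (lap d f s) \<le> (LINT x|HL. norm (x ^ d *\<^sub>R f x))"
proof -
  have "cmod (lap d f s) \<le> (LINT x|HL. norm (exp (- s * complex_of_real x) * (x ^ d *\<^sub>R f x)))"
    unfolding lap_def by (rule integral_norm_bound)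
  also have "\<dots> \<le> (LINT x|HL. norm (x ^ d *\<^sub>R f x))"
    using integrable_norm[OF schwartz_integrable[OF f]] lap_dominated[OF s] by (intro integral_mono') auto
  finally show ?thesis .
qed

lemma lap_tendsto:
  assumes f: "f \<in> schwartz_half_line" and s: "\<And>n. Re (s n) \<ge> 0" "s \<longlonglongrightarrow> l"
  shows "(\<lambda>n. lap d f (s n)) \<longlonglongrightarrow> lap d f l"
  unfolding lap_def
proof (rule integral_dominated_convergence)
  have m: "(\<lambda>x. x ^ d *\<^sub>R f x) \<in> borel_measurable HL"
    using schwartz_integrable[OF f] by (rule borel_measurable_integrable)
  show "(\<lambda>x. exp (- l * complex_of_real x) * (x ^ d *\<^sub>R f x)) \<in> borel_measurable HL"
    by (intro borel_measurable_times measurable_HL_exp m)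
  show "(\<lambda>x. exp (- s n * complex_of_real x) * (x ^ d *\<^sub>R f x)) \<in> borel_measurable HL" for n
    by (intro borel_measurable_times measurable_HL_exp m)
  show "integrable HL (\<lambda>x. norm (x ^ d *\<^sub>R f x))"
    by (intro integrable_norm schwartz_integrable f)
  show "AE x in HL. (\<lambda>n. exp (- s n * complex_of_real x) * (x ^ d *\<^sub>R f x)) \<longlonglongrightarrow> exp (- l * complex_of_real x) * (x ^ d *\<^sub>R f x)"
    by (intro always_eventually allI tendsto_intros s(2))
  show "AE x in HL. norm (exp (- s n * complex_of_real x) * (x ^ d *\<^sub>R f x)) \<le> norm (x ^ d *\<^sub>R f x)" for n
    unfolding AE_HL_iff using lap_dominated[OF s(1)] by simp
qed

lemma lap_continuous:
  assumes f: "f \<in> schwartz_half_line"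
  shows "continuous_on {s. Re s \<ge> 0} (lap d f)"
  unfolding continuous_on_sequentially
proof (intro allI ballI impI)
  fix x l assume "l \<in> {s. Re s \<ge> 0}" "(\<forall>n. x n \<in> {s. Re s \<ge> 0}) \<and> x \<longlonglongrightarrow> l"
  then show "(lap d f \<circ> x) \<longlonglongrightarrow> lap d f l"
    using lap_tendsto[OF f, of x l d] by (simp add: o_def)
qed

text \<open>Symmetry of the kernel shifts the transform from \<open>f\<close> to the exponential,
  where it is explicit. The open half-plane is required here because the exponential itself has to
  be a Schwartz function.\<close>

lemma lap_hank_right:
  assumes f: "f \<in> schwartz_half_line" and s: "Re s > 0"
  shows "lap d (hank d f) s = lap d f (1 / s) / s ^ Suc d"
proof -
  let ?e = "\<lambda>x. exp (- s * complex_of_real x)"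
  have e: "?e \<in> schwartz_half_line" by (rule schwartz_exp[OF s])
  have "lap d (hank d f) s = (LINT y|HL. hank d f y * (y ^ d *\<^sub>R ?e y))"
    unfolding lap_def by (intro Bochner_Integration.integral_cong refl) (simp add: mult.commute)
  also have "\<dots> = (LINT x|HL. (x ^ d *\<^sub>R f x) * hank d ?e x)"
    by (rule hank_symmetric[OF schwartz_integrable[OF f] schwartz_integrable[OF e]])
  also have "\<dots> = (LINT x|HL. exp (- (1 / s) * complex_of_real x) * (x ^ d *\<^sub>R f x) / s ^ Suc d)"
  proof (intro Bochner_Integration.integral_cong refl)
    fix x assume "x \<in> space HL"
    then have "hank d ?e x = exp (- complex_of_real x / s) / s ^ Suc d" by (intro hank_exp s) simp
    then show "(x ^ d *\<^sub>R f x) * hank d ?e x = exp (- (1 / s) * complex_of_real x) * (x ^ d *\<^sub>R f x) / s ^ Suc d"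
      by (simp only: mult_ac) (simp add: mult.commute)
  qed
  also have "\<dots> = lap d f (1 / s) / s ^ Suc d"
    unfolding lap_def by (rule integral_divide_zero)
  finally show ?thesis .
qed

lemma Re_inverse_nonneg: "Re s \<ge> 0 \<Longrightarrow> Re (1 / s) \<ge> 0"
  by (simp add: Re_divide)

text \<open>The imaginary axis, on which T_d lives, is reached from the open half-plane by
  continuity of \<open>lap\<close> on the closed one; the origin is excluded by the pole of
  1/s.\<close>

lemma lap_hank:
  assumes f: "f \<in> schwartz_half_line" and s: "Re s \<ge> 0" "s \<noteq> 0"
  shows "lap d (hank d f) s = lap d f (1 / s) / s ^ Suc d"
proof (rule LIMSEQ_unique)
  let ?s = "\<lambda>n. complex_of_real (1 / real (Suc n)) + s"
  have "(\<lambda>n. complex_of_real (1 / real (Suc n))) \<longlonglongrightarrow> complex_of_real 0"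
    by (intro tendsto_of_real LIMSEQ_Suc[OF lim_1_over_n])
  then have lim: "?s \<longlonglongrightarrow> s" using tendsto_add[OF _ tendsto_const, of _ 0 _ s] by simp
  have pos: "Re (?s n) > 0" for n using s by (simp add: add_pos_nonneg)
  have nz: "?s n \<noteq> 0" for n using pos[of n] by (metis less_irrefl zero_complex.sel(1))
  show "(\<lambda>n. lap d (hank d f) (?s n)) \<longlonglongrightarrow> lap d (hank d f) s"
    using pos by (intro lap_tendsto hank_schwartz f lim) (simp add: less_imp_le)
  have "(\<lambda>n. lap d f (1 / ?s n) / ?s n ^ Suc d) \<longlonglongrightarrow> lap d f (1 / s) / s ^ Suc d"
  proof (intro tendsto_divide tendsto_power lim lap_tendsto f tendsto_const)
    show "Re (1 / ?s n) \<ge> 0" for n using pos[of n] by (intro Re_inverse_nonneg) (simp only: less_imp_le)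
  qed (use s in auto)
  then show "(\<lambda>n. lap d (hank d f) (?s n)) \<longlonglongrightarrow> lap d f (1 / s) / s ^ Suc d"
    by (simp only: lap_hank_right[OF f pos])
qed

text \<open>The product of s^(d+1) with the transform of \<open>f\<close> at s is the transform of
  \<open>hank d f\<close> at 1/s, and transforms are bounded on the closed half-plane.\<close>

lemma lap_decay:
  assumes f: "f \<in> schwartz_half_line"
  obtains C where "\<And>s. Re s \<ge> 0 \<Longrightarrow> cmod s ^ Suc d * cmod (lap d f s) \<le> C"
proof -
  let ?C = "LINT x|HL. norm (x ^ d *\<^sub>R hank d f x)"
  have C0: "0 \<le> ?C" by (rule Bochner_Integration.integral_nonneg) simp
  have "cmod s ^ Suc d * cmod (lap d f s) \<le> ?C" if s: "Re s \<ge> 0" for s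
  proof (cases "s = 0")
    case True then show ?thesis using C0 by simp
  next
    case False
    then have "lap d (hank d f) (1 / s) = lap d f (1 / (1 / s)) / (1 / s) ^ Suc d"
      using Re_inverse_nonneg[OF s] by (intro lap_hank f) auto
    also have "\<dots> = s ^ Suc d * lap d f s" using False by (simp add: power_divide)
    finally have "cmod s ^ Suc d * cmod (lap d f s) = cmod (lap d (hank d f) (1 / s))"
      by (simp add: norm_mult norm_power)
    also have "\<dots> \<le> ?C" by (intro lap_bound hank_schwartz f Re_inverse_nonneg s)
    finally show ?thesis .
  qed
  then show ?thesis by (rule that)
qed

section \<open>Integrability on the imaginary axis and Fourier inversion\<close>

lemma integrable_lborel_bound:
  fixes f :: "real \<Rightarrow> 'a::{banach, second_countable_topology}"
  assumes f: "f \<in> borel_measurable borel" and le: "\<And>x. (1 + x\<^sup>2) * norm (f x) \<le> C"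
  shows "integrable lborel f"
proof (rule Bochner_Integration.integrable_bound)
  have "einterval (-\<infinity>) \<infinity> = UNIV" by (auto simp: einterval_def)
  then have "integrable lborel (\<lambda>x. inverse (1 + x\<^sup>2) :: real)"
    using integrable_inverse_1_plus_square by (simp add: set_integrable_def)
  then show "integrable lborel (\<lambda>x. C * inverse (1 + x\<^sup>2))" by (rule integrable_mult_right)
  have "norm (f x) \<le> norm (C * inverse (1 + x\<^sup>2))" for x
  proof -
    have "1 + x\<^sup>2 > 0" by (simp add: add_pos_nonneg)
    then have "norm (f x) \<le> C * inverse (1 + x\<^sup>2)"
      using le[of x] by (simp add: field_simps)
    then show ?thesis by (metis abs_ge_self order_trans real_norm_def)
  qed
  then show "AE x in lborel. norm (f x) \<le> norm (C * inverse (1 + x\<^sup>2))" by simp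
qed (use f in simp)

text \<open>Decay of order d + 1 is at least quadratic because \<open>d > 0\<close>; near the origin
  boundedness is enough. For d = 0 the claim would fail: exp (- x) has the transform 1 / (1 - i
  x).\<close>

lemma lap_integrable:
  assumes f: "f \<in> schwartz_half_line" and d: "d > 0"
  shows "integrable lborel (\<lambda>x. lap d f (- \<i> * complex_of_real x))"
proof -
  obtain B where B: "\<And>s. Re s \<ge> 0 \<Longrightarrow> cmod s ^ Suc d * cmod (lap d f s) \<le> B"
    using lap_decay[OF f] by blast
  define A where "A = (LINT x|HL. norm (x ^ d *\<^sub>R f x))"
  have A: "Re s \<ge> 0 \<Longrightarrow> cmod (lap d f s) \<le> A" for s unfolding A_def by (rule lap_bound[OF f])
  show ?thesis
  proof (rule integrable_lborel_bound)
    have "continuous_on UNIV (\<lambda>x. lap d f (- \<i> * complex_of_real x))"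
      by (rule continuous_on_compose2[OF lap_continuous[OF f]]) (auto intro!: continuous_intros)
    then show "(\<lambda>x. lap d f (- \<i> * complex_of_real x)) \<in> borel_measurable borel"
      by (rule borel_measurable_continuous_onI)
    fix x :: real
    let ?l = "cmod (lap d f (- \<i> * complex_of_real x))"
    have 1: "?l \<le> A" by (rule A) simp
    have 2: "\<bar>x\<bar> ^ Suc d * ?l \<le> B" using B[of "- \<i> * complex_of_real x"] by (simp add: norm_mult)
    have 3: "x\<^sup>2 * ?l \<le> max A B"
    proof (cases "\<bar>x\<bar> \<le> 1")
      case True
      then have "x\<^sup>2 \<le> 1" by (simp add: abs_square_le_1)
      then have "x\<^sup>2 * ?l \<le> 1 * ?l" by (intro mult_right_mono) auto
      with 1 show ?thesis by simp
    next
      case False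
      then have "\<bar>x\<bar> ^ 2 \<le> \<bar>x\<bar> ^ Suc d" using d by (intro power_increasing) auto
      then have "x\<^sup>2 * ?l \<le> \<bar>x\<bar> ^ Suc d * ?l" by (intro mult_right_mono) auto
      with 2 show ?thesis by simp
    qed
    show "(1 + x\<^sup>2) * ?l \<le> A + max A B" using 1 3 by (simp add: distrib_right)
  qed
qed

lemma gaussian_fourier:
  "(LINT x|lborel. exp (\<i> * complex_of_real (u * x)) * complex_of_real (exp (- x\<^sup>2 / 2)))
    = complex_of_real (sqrt (2 * pi) * exp (- u\<^sup>2 / 2))"
  and gaussian_integrable: "integrable lborel (\<lambda>x. exp (- x\<^sup>2 / 2) :: real)"
proof -
  have i: "integrable lborel (\<lambda>x. sqrt (2 * pi) * std_normal_density x)"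
    by (intro integrable_mult_right) simp
  have eq: "sqrt (2 * pi) * std_normal_density x = exp (- x\<^sup>2 / 2)" for x
    by (simp add: std_normal_density_def)
  show "integrable lborel (\<lambda>x. exp (- x\<^sup>2 / 2) :: real)" using i unfolding eq .
  have "complex_of_real (exp (- u\<^sup>2 / 2)) = char std_normal_distribution u"
    by (simp add: char_std_normal_distribution)
  also have "\<dots> = (LINT x|lborel. std_normal_density x *\<^sub>R iexp (u * x))"
    unfolding char_def by (subst integral_density) auto
  finally have "complex_of_real (sqrt (2 * pi)) * complex_of_real (exp (- u\<^sup>2 / 2))
    = complex_of_real (sqrt (2 * pi)) * (LINT x|lborel. std_normal_density x *\<^sub>R iexp (u * x))"
    by (simp only:)
  also have "\<dots> = (LINT x|lborel. complex_of_real (sqrt (2 * pi)) * (std_normal_density x *\<^sub>R iexp (u * x)))"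
    by (rule integral_mult_right_zero[symmetric])
  also have "\<dots> = (LINT x|lborel. exp (\<i> * complex_of_real (u * x)) * complex_of_real (exp (- x\<^sup>2 / 2)))"
    unfolding eq[symmetric] of_real_mult scaleR_conv_of_real by (simp only: mult_ac)
  finally show "(LINT x|lborel. exp (\<i> * complex_of_real (u * x)) * complex_of_real (exp (- x\<^sup>2 / 2)))
    = complex_of_real (sqrt (2 * pi) * exp (- u\<^sup>2 / 2))" by simp
qed

text \<open>The Gaussian factor \<open>G (e n * x)\<close> makes the double integral absolutely
  convergent, and after Fubini the inner integral is again a Gaussian, concentrated at
  \<open>t\<close> with width \<open>e n\<close>. As the width tends to 0, integrability of the
  transform governs the limit on one side, boundedness of \<open>h\<close> and continuity at
  \<open>t\<close> the limit on the other.\<close>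

lemma fourier_inversion:
  fixes h :: "real \<Rightarrow> complex"
  assumes h: "integrable lborel h" and bd: "\<And>y. cmod (h y) \<le> B" and cont: "isCont h t"
    and hat: "integrable lborel (\<lambda>x. LINT y|lborel. h y * exp (\<i> * complex_of_real (y * x)))"
  shows "(LINT x|lborel. (LINT y|lborel. h y * exp (\<i> * complex_of_real (y * x))) * exp (- \<i> * complex_of_real (x * t)))
    = 2 * pi * h t"
proof -
  define H where "H x = (LINT y|lborel. h y * exp (\<i> * complex_of_real (y * x)))" for x
  define G where "G x = exp (- x\<^sup>2 / 2)" for x :: real
  have G1: "G x \<le> 1" "G x \<ge> 0" for x by (auto simp: G_def)
  have [measurable]: "h \<in> borel_measurable borel" "H \<in> borel_measurable borel" "G \<in> borel_measurable borel"
    using h hat unfolding H_def[abs_def] G_def[abs_def] by (auto dest: borel_measurable_integrable)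
  have Hint: "integrable lborel H" using hat unfolding H_def .
  have Gint: "integrable lborel G" using gaussian_integrable unfolding G_def .
  define e where "e n = 1 / real (Suc n)" for n
  have e0: "e n > 0" for n by (simp add: e_def)
  have elim: "e \<longlonglongrightarrow> 0" unfolding e_def by (rule LIMSEQ_Suc[OF lim_1_over_n])
  have cG: "isCont G 0" unfolding G_def by (intro continuous_intros) auto
  have GF: "(LINT x|lborel. exp (\<i> * complex_of_real (u * x)) * complex_of_real (G x)) = complex_of_real (sqrt (2 * pi) * G u)" for u
    unfolding G_def by (rule gaussian_fourier)
  have lim1: "(\<lambda>n. LINT x|lborel. H x * exp (- \<i> * complex_of_real (x * t)) * complex_of_real (G (e n * x)))
      \<longlonglongrightarrow> (LINT x|lborel. H x * exp (- \<i> * complex_of_real (x * t)))"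
  proof (rule integral_dominated_convergence)
    show "integrable lborel (\<lambda>x. norm (H x))" using Hint by (rule integrable_norm)
    show "AE x in lborel. (\<lambda>n. H x * exp (- \<i> * complex_of_real (x * t)) * complex_of_real (G (e n * x)))
      \<longlonglongrightarrow> H x * exp (- \<i> * complex_of_real (x * t))"
    proof (rule always_eventually, rule allI)
      fix x
      have "(\<lambda>n. G (e n * x)) \<longlonglongrightarrow> G 0"
        by (rule isCont_tendsto_compose[OF cG]) (rule tendsto_mult_left_zero[OF elim])
      then have "(\<lambda>n. complex_of_real (G (e n * x))) \<longlonglongrightarrow> complex_of_real (G 0)" by (rule tendsto_of_real)
      from tendsto_mult_left[OF this, of "H x * exp (- \<i> * complex_of_real (x * t))"]
      show "(\<lambda>n. H x * exp (- \<i> * complex_of_real (x * t)) * complex_of_real (G (e n * x)))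
        \<longlonglongrightarrow> H x * exp (- \<i> * complex_of_real (x * t))" by (simp add: G_def)
    qed
    show "AE x in lborel. norm (H x * exp (- \<i> * complex_of_real (x * t)) * complex_of_real (G (e n * x))) \<le> norm (H x)" for n
      using G1 by (intro always_eventually allI) (simp add: norm_mult mult_left_le)
  qed measurable
  have eq: "(LINT x|lborel. H x * exp (- \<i> * complex_of_real (x * t)) * complex_of_real (G (e n * x)))
     = complex_of_real (sqrt (2 * pi)) * (LINT s|lborel. h (t + e n * s) * complex_of_real (G s))" for n
  proof -
    let ?K = "\<lambda>x y. h y * exp (\<i> * complex_of_real ((y - t) * x)) * complex_of_real (G (e n * x))"
    have Ge: "integrable lborel (\<lambda>x. G (e n * x))"
      using lborel_integrable_real_affine[OF Gint, of "e n" 0] e0[of n] by simp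
    have "integrable (lborel \<Otimes>\<^sub>M lborel) (\<lambda>(x, y). ?K x y)"
    proof (rule lborel_pair.Fubini_integrable)
      have n: "norm (?K x y) = norm (h y) * G (e n * x)" for x y
        using G1 by (simp add: norm_mult)
      show "integrable lborel (\<lambda>x. LINT y|lborel. norm (case (x, y) of (x, y) \<Rightarrow> ?K x y))"
        by (simp only: prod.case n integral_mult_left_zero) (intro integrable_mult_right Ge)
      have "integrable lborel (\<lambda>y. ?K x y)" for x
      proof (rule Bochner_Integration.integrable_bound)
        show "integrable lborel (\<lambda>y. norm (h y) * G (e n * x))" using h by (intro integrable_mult_left integrable_norm)
        show "AE y in lborel. norm (?K x y) \<le> norm (norm (h y) * G (e n * x))" unfolding n using G1 by simp
      qed measurable
      then show "AE x in lborel. integrable lborel (\<lambda>y. case (x, y) of (x, y) \<Rightarrow> ?K x y)" by simp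
    qed measurable
    then have fub: "(LINT x|lborel. LINT y|lborel. ?K x y) = (LINT y|lborel. LINT x|lborel. ?K x y)"
      using lborel_pair.Fubini_integral by fastforce
    have "(LINT x|lborel. H x * exp (- \<i> * complex_of_real (x * t)) * complex_of_real (G (e n * x)))
        = (LINT x|lborel. LINT y|lborel. ?K x y)"
    proof (intro Bochner_Integration.integral_cong refl)
      fix x
      have "H x * (exp (- \<i> * complex_of_real (x * t)) * complex_of_real (G (e n * x)))
         = (LINT y|lborel. (h y * exp (\<i> * complex_of_real (y * x))) * (exp (- \<i> * complex_of_real (x * t)) * complex_of_real (G (e n * x))))"
        unfolding H_def by (rule integral_mult_left_zero[symmetric])
      also have "\<dots> = (LINT y|lborel. ?K x y)"
        by (intro Bochner_Integration.integral_cong refl)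
          (simp add: mult_exp_exp algebra_simps)
      finally show "H x * exp (- \<i> * complex_of_real (x * t)) * complex_of_real (G (e n * x)) = (LINT y|lborel. ?K x y)"
        by (simp only: mult.assoc)
    qed
    also note fub
    also have "(LINT y|lborel. LINT x|lborel. ?K x y)
        = (LINT y|lborel. h y * complex_of_real (sqrt (2 * pi) * G ((y - t) / e n) / e n))"
    proof (intro Bochner_Integration.integral_cong refl)
      fix y
      have "(LINT x|lborel. ?K x y) = h y * (LINT x|lborel. exp (\<i> * complex_of_real ((y - t) * x)) * complex_of_real (G (e n * x)))"
        by (simp add: mult.assoc)
      also have "(LINT x|lborel. exp (\<i> * complex_of_real ((y - t) * x)) * complex_of_real (G (e n * x)))
         = \<bar>1 / e n\<bar> *\<^sub>R (LINT x|lborel. exp (\<i> * complex_of_real ((y - t) * (0 + 1 / e n * x))) * complex_of_real (G (e n * (0 + 1 / e n * x))))"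
        using e0[of n] by (intro lborel_integral_real_affine) auto
      also have "(LINT x|lborel. exp (\<i> * complex_of_real ((y - t) * (0 + 1 / e n * x))) * complex_of_real (G (e n * (0 + 1 / e n * x))))
         = (LINT x|lborel. exp (\<i> * complex_of_real ((y - t) / e n * x)) * complex_of_real (G x))"
        using e0[of n] by (intro Bochner_Integration.integral_cong refl) simp
      also have "\<dots> = complex_of_real (sqrt (2 * pi) * G ((y - t) / e n))" by (rule GF)
      finally show "(LINT x|lborel. ?K x y) = h y * complex_of_real (sqrt (2 * pi) * G ((y - t) / e n) / e n)"
        using e0[of n] by (simp add: scaleR_conv_of_real)
    qed
    \<comment> \<open>The substitution y = t + e n * s rescales the Gaussian to unit width; its
      Jacobian cancels the factor 1 / e n.\<close>
    also have "\<dots> = \<bar>e n\<bar> *\<^sub>R (LINT s|lborel. h (t + e n * s) * complex_of_real (sqrt (2 * pi) * G ((t + e n * s - t) / e n) / e n))"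
      using e0[of n] by (intro lborel_integral_real_affine) auto
    also have "\<dots> = (LINT s|lborel. \<bar>e n\<bar> *\<^sub>R (h (t + e n * s) * complex_of_real (sqrt (2 * pi) * G ((t + e n * s - t) / e n) / e n)))"
      by (rule integral_scaleR_right[symmetric])
    also have "\<dots> = (LINT s|lborel. complex_of_real (sqrt (2 * pi)) * (h (t + e n * s) * complex_of_real (G s)))"
      using e0[of n] by (intro Bochner_Integration.integral_cong refl) (simp add: scaleR_conv_of_real)
    finally show ?thesis by simp
  qed
  have lim2: "(\<lambda>n. LINT s|lborel. h (t + e n * s) * complex_of_real (G s)) \<longlonglongrightarrow> (LINT s|lborel. h t * complex_of_real (G s))"
  proof (rule integral_dominated_convergence)
    show "integrable lborel (\<lambda>s. B * G s)" using Gint by (rule integrable_mult_right)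
    show "AE s in lborel. (\<lambda>n. h (t + e n * s) * complex_of_real (G s)) \<longlonglongrightarrow> h t * complex_of_real (G s)"
    proof (rule always_eventually, intro allI tendsto_mult tendsto_const isCont_tendsto_compose[OF cont])
      fix s
      from tendsto_add[OF tendsto_const[of t] tendsto_mult_left_zero[OF elim, of s]]
      show "(\<lambda>n. t + e n * s) \<longlonglongrightarrow> t" by simp
    qed
    show "AE s in lborel. norm (h (t + e n * s) * complex_of_real (G s)) \<le> B * G s" for n
      using G1 bd by (intro always_eventually allI) (simp add: norm_mult mult_right_mono)
  qed measurable
  have e1: "(LINT s|lborel. h t * complex_of_real (G s)) = h t * complex_of_real (sqrt (2 * pi))"
    using GF[of 0] by (simp add: G_def)
  have "(\<lambda>n. LINT x|lborel. H x * exp (- \<i> * complex_of_real (x * t)) * complex_of_real (G (e n * x)))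
      \<longlonglongrightarrow> complex_of_real (sqrt (2 * pi)) * (h t * complex_of_real (sqrt (2 * pi)))"
    unfolding eq by (rule tendsto_mult_left[OF lim2[unfolded e1]])
  from LIMSEQ_unique[OF lim1 this]
  have "(LINT x|lborel. H x * exp (- \<i> * complex_of_real (x * t))) = complex_of_real (sqrt (2 * pi) * sqrt (2 * pi)) * h t"
    by (simp only: of_real_mult mult_ac)
  also have "sqrt (2 * pi) * sqrt (2 * pi) = 2 * pi" by simp
  finally show ?thesis by (simp add: H_def)
qed

section \<open>The action on $S_d$\<close>

text \<open>The correspondence between f_1 and f in the definition of S_d. Operators are computed on
  f_1, where no half-integral powers occur.\<close>

definition emb :: "nat \<Rightarrow> (real \<Rightarrow> complex) \<Rightarrow> real \<Rightarrow> complex" where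
  "emb d f = (\<lambda>x. if 0 \<le> x then (x powr ((real d + 1) / 2)) *\<^sub>R f x else 0)"

lemma S_half_line_eq: "S_half_line d = emb d ` schwartz_half_line"
  by (auto simp: S_half_line_def emb_def)

lemma emb_power:
  assumes "x > 0" shows "(x powr ((real d + 1) / 2))\<^sup>2 = x ^ Suc d"
proof -
  have "(x powr ((real d + 1) / 2))\<^sup>2 = x powr real (Suc d)"
    by (simp add: power2_eq_square add.commute flip: powr_add)
  then show ?thesis unfolding powr_realpow[OF assms] .
qed

lemma measurable_emb: "f \<in> schwartz_half_line \<Longrightarrow> emb d f \<in> borel_measurable HL"
proof -
  assume f: "f \<in> schwartz_half_line"
  have "(\<lambda>x. (x powr ((real d + 1) / 2)) *\<^sub>R f x) \<in> borel_measurable HL"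
    by (intro borel_measurable_scaleR schwartz_measurable f measurable_HL_borel) measurable
  then show ?thesis
    by (rule measurable_cong[THEN iffD1, rotated]) (simp add: emb_def)
qed

lemma SQ_emb: 
  assumes f: "f \<in> schwartz_half_line" shows "SQ (emb d f)"
proof -
  obtain A where A: "A \<ge> 0" "\<And>x. x \<ge> 0 \<Longrightarrow> (1 + x\<^sup>2) * (x ^ d * cmod (f x)) \<le> A"
    using schwartz_poly_bound[OF f] by blast
  obtain B where B: "B \<ge> 0" "\<And>x. x \<ge> 0 \<Longrightarrow> x ^ 0 * cmod (f x) \<le> B"
    using schwartz_bound[OF f] by blast
  show ?thesis
  proof (rule SQ_criterion[OF measurable_emb[OF f]])
    fix x :: real assume x: "x > 0"
    have "(1 + x\<^sup>2) * (cmod (emb d f x))\<^sup>2 = ((1 + x\<^sup>2) * (x ^ d * cmod (f x))) * (x ^ 0 * cmod (f x)) * x"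
      using x by (simp add: emb_def power_mult_distrib emb_power) (simp add: power2_eq_square)
    also have "\<dots> \<le> (A * B) * x"
      using x A B by (intro mult_right_mono mult_mono) auto
    finally show "(1 + x\<^sup>2) * (cmod (emb d f x))\<^sup>2 \<le> (A * B) * x" .
  qed
qed

lemma norm_emb:
  assumes f: "f \<in> schwartz_half_line"
  shows "complex_of_real ((norm (abs_L2pos (emb d f)))\<^sup>2) = (LINT x|HL. f x * (x ^ d *\<^sub>R cnj (f x)))"
proof -
  have [measurable]: "emb d f \<in> borel_measurable HL" by (rule measurable_emb[OF f])
  have "(norm (abs_L2pos (emb d f)))\<^sup>2 = (LINT x|HL. (cmod (emb d f x))\<^sup>2 /\<^sub>R x)"
    unfolding norm_abs_L2pos[OF SQ_emb[OF f]]
    by (rule integral_dx_over_x) measurable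
  also have "\<dots> = (LINT x|HL. x ^ d * (cmod (f x))\<^sup>2)"
    by (intro Bochner_Integration.integral_cong refl) (simp add: emb_def power_mult_distrib emb_power)
  also have "complex_of_real \<dots> = (LINT x|HL. complex_of_real (x ^ d * (cmod (f x))\<^sup>2))"
    by (rule integral_complex_of_real[symmetric])
  also have "\<dots> = (LINT x|HL. f x * (x ^ d *\<^sub>R cnj (f x)))"
    by (intro Bochner_Integration.integral_cong refl)
      (simp only: of_real_mult complex_norm_square scaleR_conv_of_real mult_ac)
  finally show ?thesis .
qed

abbreviation c2pi :: real where "c2pi \<equiv> (2 * pi) powr (- 1 / 2)"

lemma T_op_emb: "T_op d (emb d f) z = c2pi *\<^sub>R lap d f (- \<i> * complex_of_real z)"
proof -
  have "(\<bar>y\<bar> powr ((real d - 1) / 2)) *\<^sub>R emb d f y * exp (\<i> * of_real (y * z))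
    = indicator {0<..} y *\<^sub>R (exp (- (- \<i> * complex_of_real z) * complex_of_real y) * (y ^ d *\<^sub>R f y))" for y
  proof (cases "y > 0")
    case True
    have "y powr ((real d - 1) / 2) * y powr ((real d + 1) / 2) = y ^ d"
      using True by (simp add: field_simps flip: powr_add powr_realpow)
    then have "(\<bar>y\<bar> powr ((real d - 1) / 2)) *\<^sub>R emb d f y = y ^ d *\<^sub>R f y"
      using True by (simp add: emb_def)
    then show ?thesis using True by (simp add: mult_ac)
  next
    case False
    then show ?thesis by (auto simp: emb_def)
  qed
  then show ?thesis
    unfolding T_op_def lap_def by (subst integral_restrict_space) auto
qed

lemma lap_fourier:
  "lap d f (- \<i> * complex_of_real x) = (LINT y|lborel. (indicator {0<..} y *\<^sub>R (y ^ d *\<^sub>R f y)) * exp (\<i> * complex_of_real (y * x)))"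
  unfolding lap_def by (subst integral_restrict_space) (auto intro!: Bochner_Integration.integral_cong simp: mult_ac)

lemma lap_inversion:
  fixes f :: "real \<Rightarrow> complex"
  assumes f: "f \<in> schwartz_half_line" and d: "d > 0" and t: "t \<noteq> 0"
  shows "(LINT x|lborel. lap d f (- \<i> * complex_of_real x) * exp (- \<i> * complex_of_real (x * t)))
    = complex_of_real (2 * pi) * (if t > 0 then t ^ d *\<^sub>R f t else 0)"
proof -
  define h where "h y = indicator {0<..} y *\<^sub>R (y ^ d *\<^sub>R f y)" for y :: real
  obtain B where B: "B \<ge> 0" "\<And>x. x \<ge> 0 \<Longrightarrow> x ^ d * cmod (f x) \<le> B"
    using schwartz_bound[OF f] by blast
  have "(LINT x|lborel. (LINT y|lborel. h y * exp (\<i> * complex_of_real (y * x))) * exp (- \<i> * complex_of_real (x * t)))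
    = complex_of_real (2 * pi) * h t"
  proof (rule fourier_inversion)
    show "integrable lborel h"
      using schwartz_integrable[OF f, of d] unfolding h_def by (subst (asm) integrable_restrict_space) auto
    show "cmod (h y) \<le> B" for y
      using B(1) B(2)[of y] by (cases "y > 0") (simp_all add: h_def)
    show "isCont h t"
    proof (cases "t > 0")
      case True
      have "continuous_on {0<..} (\<lambda>y. y ^ d *\<^sub>R f y)"
        by (intro continuous_intros continuous_on_subset[OF schwartz_continuous[OF f]]) auto
      then have "continuous_on {0<..} h"
        by (rule continuous_on_cong[THEN iffD1, rotated -1]) (simp_all add: h_def)
      then show ?thesis using True by (simp add: continuous_on_eq_continuous_at)
    next
      case False
      have "continuous_on {..<0} h"
        by (rule continuous_on_cong[THEN iffD1, rotated -1, OF continuous_on_const[of _ 0]]) (simp_all add: h_def)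
      then show ?thesis using False t by (simp add: continuous_on_eq_continuous_at)
    qed
    show "integrable lborel (\<lambda>x. LINT y|lborel. h y * exp (\<i> * complex_of_real (y * x)))"
      using lap_integrable[OF f d] unfolding h_def lap_fourier .
  qed
  then show ?thesis unfolding lap_fourier h_def by simp
qed

lemma c2pi_square: "c2pi * c2pi * (2 * pi) = 1"
proof -
  have "c2pi * c2pi = (2 * pi) powr (- 1 / 2 + - 1 / 2)" by (rule powr_add[symmetric])
  also have "\<dots> = inverse (2 * pi)" by (simp add: powr_minus)
  finally show ?thesis by (simp only:) simp
qed

lemma M_T_emb:
  assumes f: "f \<in> schwartz_half_line" and d: "d > 0"
  shows "M_op d (T_op d (emb d f)) = emb d f"
proof
  fix y
  show "M_op d (T_op d (emb d f)) y = emb d f y"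
  proof (cases "y = 0")
    case True
    \<comment> \<open>Both sides are 0 here because \<open>0 powr a = 0\<close> for every exponent,
      also for the nonpositive one in \<open>M_op\<close>.\<close>
    then show ?thesis by (simp add: M_op_def emb_def)
  next
    case False
    have "(LINT x|lborel. T_op d (emb d f) x * exp (- \<i> * of_real (x * y)))
       = (LINT x|lborel. c2pi *\<^sub>R (lap d f (- \<i> * complex_of_real x) * exp (- \<i> * complex_of_real (x * y))))"
      unfolding T_op_emb by simp
    also have "\<dots> = c2pi *\<^sub>R (complex_of_real (2 * pi) * (if y > 0 then y ^ d *\<^sub>R f y else 0))"
      by (simp only: integral_scaleR_right lap_inversion[OF f d False])
    finally have "M_op d (T_op d (emb d f)) y
       = (\<bar>y\<bar> powr ((- real d + 1) / 2) * c2pi) *\<^sub>R c2pi *\<^sub>R (complex_of_real (2 * pi) * (if y > 0 then y ^ d *\<^sub>R f y else 0))"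
      unfolding M_op_def by (simp only:)
    also have "\<dots> = (\<bar>y\<bar> powr ((- real d + 1) / 2) * (c2pi * c2pi * (2 * pi))) *\<^sub>R (if y > 0 then y ^ d *\<^sub>R f y else 0)"
      by (simp add: scaleR_conv_of_real mult_ac)
    also have "\<dots> = \<bar>y\<bar> powr ((- real d + 1) / 2) *\<^sub>R (if y > 0 then y ^ d *\<^sub>R f y else 0)"
      unfolding c2pi_square by simp
    also have "\<dots> = emb d f y"
    proof (cases "y > 0")
      case True
      then have "y powr ((- real d + 1) / 2) * y ^ d = y powr ((real d + 1) / 2)"
        by (simp add: field_simps flip: powr_add powr_realpow)
      then show ?thesis using True by (simp add: emb_def)
    next
      case False
      then show ?thesis using \<open>y \<noteq> 0\<close> by (simp add: emb_def)
    qed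
    finally show ?thesis .
  qed
qed

text \<open>Since s -> 1/s is an involution and the two factors s^(d+1) cancel, \<open>f\<close> and
  its double transform have the same Laplace transform on the imaginary axis without 0. A single
  point does not affect the inversion integral, which recovers the values at
  \<open>t > 0\<close>.\<close>

lemma hank_hank:
  assumes f: "f \<in> schwartz_half_line" and d: "d > 0" and t: "t > 0"
  shows "hank d (hank d f) t = f t"
proof -
  let ?g = "hank d (hank d f)"
  have g: "?g \<in> schwartz_half_line" by (intro hank_schwartz f)
  have eq: "lap d ?g (- \<i> * complex_of_real x) = lap d f (- \<i> * complex_of_real x)" if "x \<noteq> 0" for x
  proof -
    let ?s = "- \<i> * complex_of_real x"
    have s: "?s \<noteq> 0" "Re ?s \<ge> 0" "1 / ?s \<noteq> 0" "Re (1 / ?s) \<ge> 0" using that by (auto simp: Re_divide)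
    have "lap d ?g ?s = lap d f (1 / (1 / ?s)) / (1 / ?s) ^ Suc d / ?s ^ Suc d"
      using s by (simp only: lap_hank[OF hank_schwartz[OF f] s(2,1)] lap_hank[OF f s(4,3)])
    moreover have "L / (1 / z) ^ n / z ^ n = L" if "z \<noteq> 0" for L z :: complex and n
      using that by (simp add: power_divide)
    from this[OF s(1)] have "lap d f (1 / (1 / ?s)) / (1 / ?s) ^ Suc d / ?s ^ Suc d = lap d f ?s"
      by (simp only: divide_divide_eq_right div_by_1 mult_1)
    ultimately show ?thesis by (simp only:)
  qed
  have "(LINT x|lborel. lap d ?g (- \<i> * complex_of_real x) * exp (- \<i> * complex_of_real (x * t)))
     = (LINT x|lborel. lap d f (- \<i> * complex_of_real x) * exp (- \<i> * complex_of_real (x * t)))"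
    by (rule integral_discrete_difference[of "{0}"]) (simp_all add: eq[unfolded mult_minus_left])
  then show ?thesis using t unfolding lap_inversion[OF g d less_imp_neq[OF t, symmetric]] lap_inversion[OF f d less_imp_neq[OF t, symmetric]]
    by simp
qed

lemma schwartz_cnj:
  assumes "f \<in> schwartz_half_line"
  shows "(\<lambda>x. cnj (f x)) \<in> schwartz_half_line"
proof (rule schwartz_coinduct[where C = "(\<lambda>f x. cnj (f x)) ` schwartz_half_line"])
  fix h k assume "h \<in> (\<lambda>f x. cnj (f x)) ` schwartz_half_line"
  then obtain f where h: "h = (\<lambda>x. cnj (f x))" and f: "f \<in> schwartz_half_line" by blast
  obtain A where A: "\<And>x. x \<ge> 0 \<Longrightarrow> x ^ k * cmod (f x) \<le> A" using schwartz_bound[OF f] by blast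
  then show "\<exists>B. \<forall>x\<ge>0. x ^ k * cmod (h x) \<le> B" unfolding h by auto
next
  fix h assume "h \<in> (\<lambda>f x. cnj (f x)) ` schwartz_half_line"
  then obtain f where h: "h = (\<lambda>x. cnj (f x))" and f: "f \<in> schwartz_half_line" by blast
  obtain f' where f': "f' \<in> schwartz_half_line"
    "\<And>x. x \<ge> 0 \<Longrightarrow> (f has_vector_derivative f' x) (at x within {0..})" using schwartz_deriv[OF f] by blast
  show "\<exists>g'\<in>(\<lambda>f x. cnj (f x)) ` schwartz_half_line.
      \<forall>x\<ge>0. (h has_vector_derivative g' x) (at x within {0..})"
    using f' unfolding h
    by (intro bexI[of _ "\<lambda>x. cnj (f' x)"]) (auto intro!: has_vector_derivative_cnj)
qed (rule rev_image_eqI[OF assms], rule refl)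

lemma hank_cnj: "hank d (\<lambda>x. cnj (f x)) y = cnj (hank d f y)"
  unfolding hank_def by (subst Bochner_Integration.integral_cnj[symmetric]) simp

text \<open>The kernel is real and symmetric and the transform is an involution. In the pairing of
  \<open>hank d f\<close> with its conjugate one transform can therefore be moved to the other
  factor, where it cancels.\<close>

lemma norm_emb_hank:
  assumes f: "f \<in> schwartz_half_line" and d: "d > 0"
  shows "norm (abs_L2pos (emb d (hank d f))) = norm (abs_L2pos (emb d f))"
proof -
  have c: "(\<lambda>x. cnj (f x)) \<in> schwartz_half_line" by (rule schwartz_cnj[OF f])
  have "complex_of_real ((norm (abs_L2pos (emb d (hank d f))))\<^sup>2)
     = (LINT y|HL. hank d f y * (y ^ d *\<^sub>R hank d (\<lambda>x. cnj (f x)) y))"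
    unfolding norm_emb[OF hank_schwartz[OF f]] hank_cnj ..
  also have "\<dots> = (LINT x|HL. (x ^ d *\<^sub>R f x) * hank d (hank d (\<lambda>x. cnj (f x))) x)"
    by (rule hank_symmetric[OF schwartz_integrable[OF f] schwartz_integrable[OF hank_schwartz[OF c]]])
  also have "\<dots> = (LINT x|HL. f x * (x ^ d *\<^sub>R cnj (f x)))"
    by (intro Bochner_Integration.integral_cong refl) (simp add: hank_hank[OF c d])
  also have "\<dots> = complex_of_real ((norm (abs_L2pos (emb d f)))\<^sup>2)" by (rule norm_emb[OF f, symmetric])
  finally have "(norm (abs_L2pos (emb d (hank d f))))\<^sup>2 = (norm (abs_L2pos (emb d f)))\<^sup>2"
    by (simp only: of_real_eq_iff)
  then show ?thesis by (simp add: power2_eq_iff_nonneg)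
qed

lemma emb_cmult: "emb d (\<lambda>x. c * f x) = (\<lambda>x. c * emb d f x)"
  by (auto simp: emb_def)

lemma lap_cmult: "lap d (\<lambda>x. c * f x) s = c * lap d f s"
  unfolding lap_def by (subst integral_mult_right_zero[symmetric]) (simp add: mult_ac)

lemma lap_exp_mult: "lap d (\<lambda>x. exp (- a * complex_of_real x) * f x) s = lap d f (s + a)"
  unfolding lap_def by (intro Bochner_Integration.integral_cong refl) (simp add: exp_add[symmetric] algebra_simps mult_exp_exp)

lemma norm_abs_L2pos_unimodular:
  assumes f: "SQ f" and g: "g \<in> borel_measurable HL" and eq: "\<And>x. x > 0 \<Longrightarrow> cmod (g x) = cmod (f x)"
  shows "norm (abs_L2pos g) = norm (abs_L2pos f)"
proof (rule antisym)
  have le: "AE x in HL. cmod (g x) \<le> 1 * cmod (f x)" using eq by (simp add: AE_HL_iff)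
  show "norm (abs_L2pos g) \<le> norm (abs_L2pos f)"
    using norm_abs_L2pos_le[OF f g _ le] by simp
  have "SQ g" by (rule SQ_bound[OF f g le])
  from norm_abs_L2pos_le[OF this, of f 1] show "norm (abs_L2pos f) \<le> norm (abs_L2pos g)"
    using f eq by (simp add: AE_HL_iff square_integrable_def)
qed

section \<open>The action by fractional linear substitutions and its generators\<close>

definition mat2 :: "real \<Rightarrow> real \<Rightarrow> real \<Rightarrow> real \<Rightarrow> real ^ 2 ^ 2" where
  "mat2 p q r s = vector [vector [p, q], vector [r, s]]"

lemma mat2_nth [simp]: "mat2 p q r s $ 1 $ 1 = p" "mat2 p q r s $ 1 $ 2 = q"
  "mat2 p q r s $ 2 $ 1 = r" "mat2 p q r s $ 2 $ 2 = s"
  by (simp_all add: mat2_def)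

lemma mat2_eq_iff: "A = B \<longleftrightarrow> A $ 1 $ 1 = B $ 1 $ 1 \<and> A $ 1 $ 2 = B $ 1 $ 2 \<and> A $ 2 $ 1 = B $ 2 $ 1 \<and> A $ 2 $ 2 = B $ 2 $ 2"
  for A B :: "real ^ 2 ^ 2"
  by (auto simp: vec_eq_iff forall_2)

lemma mat2_mult_nth: "(A ** B) $ i $ j = A $ i $ 1 * B $ 1 $ j + A $ i $ 2 * B $ 2 $ j"
  for A B :: "real ^ 2 ^ 2"
  by (simp add: matrix_matrix_mult_def sum_2)

lemma SL2_mat2 [simp]: "mat2 p q r s \<in> SL2 \<longleftrightarrow> p * s - q * r = 1"
  by (simp add: SL2_def det_2)

lemma SL2_mult: "A \<in> SL2 \<Longrightarrow> B \<in> SL2 \<Longrightarrow> A ** B \<in> SL2"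
  by (simp add: SL2_def det_mul)

lemma finite_linear: "a \<noteq> 0 \<or> b \<noteq> 0 \<Longrightarrow> finite {x::real. a * x + b = 0}"
proof (cases "a = 0")
  case False
  then have "{x. a * x + b = 0} \<subseteq> {- b / a}" by (auto simp: field_simps)
  then show ?thesis by (rule finite_subset) simp
qed simp

text \<open>The set of points at which an identity can be lost when it holds off \<open>Z\<close>
  and is then transformed by \<open>g\<close>. Each point of \<open>Z\<close> has at most one
  preimage, the zero of a linear equation that cannot degenerate because the determinant is
  1.\<close>

lemma finite_moebius:
  assumes g: "g \<in> SL2" and Z: "finite Z"
  shows "finite ({x. g $ 2 $ 1 * x + g $ 1 $ 1 = 0} \<union>
    {x. g $ 2 $ 1 * x + g $ 1 $ 1 \<noteq> 0 \<and> (g $ 2 $ 2 * x + g $ 1 $ 2) / (g $ 2 $ 1 * x + g $ 1 $ 1) \<in> Z})"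
proof (rule finite_UnI)
  have det: "g $ 1 $ 1 * g $ 2 $ 2 - g $ 1 $ 2 * g $ 2 $ 1 = 1" using g by (simp add: SL2_def det_2)
  show "finite {x. g $ 2 $ 1 * x + g $ 1 $ 1 = 0}" by (rule finite_linear) (use det in auto)
  have "finite (\<Union>z\<in>Z. {x. (g $ 2 $ 2 - z * g $ 2 $ 1) * x + (g $ 1 $ 2 - z * g $ 1 $ 1) = 0})"
  proof (intro finite_UN_I Z finite_linear)
    fix z
    show "g $ 2 $ 2 - z * g $ 2 $ 1 \<noteq> 0 \<or> g $ 1 $ 2 - z * g $ 1 $ 1 \<noteq> 0"
    proof (rule ccontr)
      assume "\<not> ?thesis"
      then have "g $ 2 $ 2 = z * g $ 2 $ 1" "g $ 1 $ 2 = z * g $ 1 $ 1" by auto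
      with det show False by (simp add: algebra_simps)
    qed
  qed
  then show "finite {x. g $ 2 $ 1 * x + g $ 1 $ 1 \<noteq> 0 \<and> (g $ 2 $ 2 * x + g $ 1 $ 2) / (g $ 2 $ 1 * x + g $ 1 $ 1) \<in> Z}"
  proof (rule rev_finite_subset, intro subsetI)
    fix x
    let ?z = "(g $ 2 $ 2 * x + g $ 1 $ 2) / (g $ 2 $ 1 * x + g $ 1 $ 1)"
    assume "x \<in> {x. g $ 2 $ 1 * x + g $ 1 $ 1 \<noteq> 0 \<and> (g $ 2 $ 2 * x + g $ 1 $ 2) / (g $ 2 $ 1 * x + g $ 1 $ 1) \<in> Z}"
    then have nz: "g $ 2 $ 1 * x + g $ 1 $ 1 \<noteq> 0" and z: "?z \<in> Z" by auto
    have "(g $ 2 $ 2 - ?z * g $ 2 $ 1) * x + (g $ 1 $ 2 - ?z * g $ 1 $ 1)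
      = (g $ 2 $ 2 * x + g $ 1 $ 2) - ?z * (g $ 2 $ 1 * x + g $ 1 $ 1)" by (simp only: algebra_simps)
    also have "\<dots> = 0" using nz by simp
    finally show "x \<in> (\<Union>z\<in>Z. {x. (g $ 2 $ 2 - z * g $ 2 $ 1) * x + (g $ 1 $ 2 - z * g $ 1 $ 1) = 0})"
      using z by (intro UN_I[of ?z]) simp_all
  qed
qed

lemma pi_rep_cong_finite:
  assumes g: "g \<in> SL2" and fin: "finite {x. \<phi> x \<noteq> \<psi> x}"
  shows "finite {x. pi_rep d g \<phi> x \<noteq> pi_rep d g \<psi> x}"
  by (rule finite_subset[OF _ finite_moebius[OF g fin]]) (auto simp: pi_rep_def Let_def)

text \<open>The substitution is the right action of \<open>g\<close> on the row (1, x), whence the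
  order of the factors. Away from the poles of both substitutions the denominators multiply
  (\<open>den\<close>); at the finitely many other points some value is a limit, and nothing is
  claimed.\<close>

lemma pi_rep_mult_finite:
  assumes g: "g \<in> SL2" and h: "h \<in> SL2"
  shows "finite {x. pi_rep d (g ** h) \<phi> x \<noteq> pi_rep d g (pi_rep d h \<phi>) x}"
proof (rule finite_subset[OF _ finite_moebius[OF g, of "{y. h $ 2 $ 1 * y + h $ 1 $ 1 = 0}"]])
  show "finite {y. h $ 2 $ 1 * y + h $ 1 $ 1 = 0}"
    using finite_moebius[OF h finite.emptyI] by simp
  define p q r s where "p = g $ 1 $ 1" "q = g $ 1 $ 2" "r = g $ 2 $ 1" "s = g $ 2 $ 2"
  note gd = this
  define p' q' r' s' where "p' = h $ 1 $ 1" "q' = h $ 1 $ 2" "r' = h $ 2 $ 1" "s' = h $ 2 $ 2"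
  note hd = this
  have "pi_rep d (g ** h) \<phi> x = pi_rep d g (pi_rep d h \<phi>) x"
    if x: "r * x + p \<noteq> 0" and y: "r' * ((s * x + q) / (r * x + p)) + p' \<noteq> 0" for x
  proof -
    define y where "y = (s * x + q) / (r * x + p)"
    have sx: "s * x + q = (r * x + p) * y" using x by (simp add: y_def)
    have den: "(r * p' + s * r') * x + (p * p' + q * r') = (r * x + p) * (r' * y + p')"
    proof -
      have "(r * p' + s * r') * x + (p * p' + q * r') = p' * (r * x + p) + r' * (s * x + q)" by (simp add: algebra_simps)
      then show ?thesis unfolding sx by (simp add: algebra_simps)
    qed
    have num: "(r * q' + s * s') * x + (p * q' + q * s') = (r * x + p) * (s' * y + q')"
    proof -
      have "(r * q' + s * s') * x + (p * q' + q * s') = q' * (r * x + p) + s' * (s * x + q)" by (simp add: algebra_simps)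
      then show ?thesis unfolding sx by (simp add: algebra_simps)
    qed
    show ?thesis
      using x y unfolding pi_rep_def Let_def mat2_mult_nth gd[symmetric] hd[symmetric] den num y_def[symmetric]
      by (simp add: power_int_mult_distrib)
  qed
  then show "{x. pi_rep d (g ** h) \<phi> x \<noteq> pi_rep d g (pi_rep d h \<phi>) x} \<subseteq>
    {x. g $ 2 $ 1 * x + g $ 1 $ 1 = 0} \<union>
    {x. g $ 2 $ 1 * x + g $ 1 $ 1 \<noteq> 0 \<and> (g $ 2 $ 2 * x + g $ 1 $ 2) / (g $ 2 $ 1 * x + g $ 1 $ 1) \<in> {y. h $ 2 $ 1 * y + h $ 1 $ 1 = 0}}"
    unfolding gd hd by auto
qed

lemma M_op_cong_finite:
  assumes "finite {x. \<phi> x \<noteq> \<psi> x}"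
  shows "M_op d \<phi> = M_op d \<psi>"
proof
  fix y
  have "(LINT x|lborel. \<phi> x * exp (- \<i> * of_real (x * y))) = (LINT x|lborel. \<psi> x * exp (- \<i> * of_real (x * y)))"
    by (rule integral_discrete_difference[of "{x. \<phi> x \<noteq> \<psi> x}"]) (use assms in \<open>auto simp: countable_finite\<close>)
  then show "M_op d \<phi> y = M_op d \<psi> y" by (simp only: M_op_def)
qed

text \<open>$T_d f'$ and $\pi_d(g)T_d f$ are compared up to finite sets because this makes the property multiplicative in $g$
  without examining limits at the poles; \<^const>\<open>M_op\<close> does not see finite sets.\<close>

definition good :: "nat \<Rightarrow> real ^ 2 ^ 2 \<Rightarrow> bool" where
  "good d g \<longleftrightarrow> g \<in> SL2 \<and> (\<forall>f\<in>S_half_line d. \<exists>f'\<in>S_half_line d. norm (abs_L2pos f') = norm (abs_L2pos f)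
     \<and> finite {x. T_op d f' x \<noteq> pi_rep d g (T_op d f) x})"

lemma goodD:
  "good d g \<Longrightarrow> f \<in> S_half_line d \<Longrightarrow> \<exists>f'\<in>S_half_line d. norm (abs_L2pos f') = norm (abs_L2pos f)
     \<and> finite {x. T_op d f' x \<noteq> pi_rep d g (T_op d f) x}"
  by (simp add: good_def)

lemma good_mult:
  assumes g: "good d g" and h: "good d h"
  shows "good d (g ** h)"
  unfolding good_def
proof (intro conjI ballI)
  have gS: "g \<in> SL2" and hS: "h \<in> SL2" using g h by (auto simp: good_def)
  show "g ** h \<in> SL2" using gS hS by (rule SL2_mult)
  fix f assume f: "f \<in> S_half_line d"
  obtain f' where f'S: "f' \<in> S_half_line d" and f'0: "norm (abs_L2pos f') = norm (abs_L2pos f) \<and>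
    finite {x. T_op d f' x \<noteq> pi_rep d h (T_op d f) x}"
    using goodD[OF h f] by (rule bexE)
  obtain f'' where f''S: "f'' \<in> S_half_line d" and f''0: "norm (abs_L2pos f'') = norm (abs_L2pos f') \<and>
    finite {x. T_op d f'' x \<noteq> pi_rep d g (T_op d f') x}"
    using goodD[OF g f'S] by (rule bexE)
  note f' = f'S conjunct1[OF f'0] conjunct2[OF f'0] and f'' = f''S conjunct1[OF f''0] conjunct2[OF f''0]
  have "finite {x. T_op d f'' x \<noteq> pi_rep d (g ** h) (T_op d f) x}"
    by (rule finite_subset[OF _ finite_UnI[OF finite_UnI[OF f''(3) pi_rep_cong_finite[OF gS f'(3), of d]]
          pi_rep_mult_finite[OF gS hS, of d "T_op d f"]]]) auto
  then show "\<exists>f'\<in>S_half_line d. norm (abs_L2pos f') = norm (abs_L2pos f)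
     \<and> finite {x. T_op d f' x \<noteq> pi_rep d (g ** h) (T_op d f) x}"
    using f'(2) f''(1,2) by (intro bexI[of _ f''] conjI) simp_all
qed

abbreviation nmat :: "real \<Rightarrow> real ^ 2 ^ 2" where "nmat c \<equiv> mat2 1 c 0 1"
abbreviation wmat :: "real ^ 2 ^ 2" where "wmat \<equiv> mat2 0 (-1) 1 0"
abbreviation nbar :: "real \<Rightarrow> real ^ 2 ^ 2" where "nbar c \<equiv> mat2 1 0 c 1"

lemma T_op_nmat:
  "T_op d (emb d (\<lambda>x. exp (- (- \<i> * complex_of_real c) * complex_of_real x) * f x)) = pi_rep d (nmat c) (T_op d (emb d f))"
proof
  fix z
  have e: "- \<i> * complex_of_real z + - \<i> * complex_of_real c = - \<i> * complex_of_real (z + c)"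
    by (simp add: algebra_simps)
  have "pi_rep d (nmat c) \<phi> z = \<phi> (z + c)" for \<phi> by (simp add: pi_rep_def)
  then show "T_op d (emb d (\<lambda>x. exp (- (- \<i> * complex_of_real c) * complex_of_real x) * f x)) z
    = pi_rep d (nmat c) (T_op d (emb d f)) z"
    by (simp only: T_op_emb lap_exp_mult e)
qed

lemma good_nmat: "good d (nmat c)"
  unfolding good_def S_half_line_eq
proof (intro conjI ballI)
  fix f assume "f \<in> emb d ` schwartz_half_line"
  then obtain f1 where f: "f = emb d f1" "f1 \<in> schwartz_half_line" by blast
  let ?g = "\<lambda>x. exp (- (- \<i> * complex_of_real c) * complex_of_real x) * f1 x"
  have g: "?g \<in> schwartz_half_line" by (rule schwartz_exp_mult[OF f(2)]) simp
  have "norm (abs_L2pos (emb d ?g)) = norm (abs_L2pos (emb d f1))"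
    by (rule norm_abs_L2pos_unimodular[OF SQ_emb[OF f(2)] measurable_emb[OF g]]) (simp add: emb_def norm_mult)
  then show "\<exists>f'\<in>emb d ` schwartz_half_line. norm (abs_L2pos f') = norm (abs_L2pos f)
     \<and> finite {x. T_op d f' x \<noteq> pi_rep d (nmat c) (T_op d f) x}"
    using g unfolding f(1) T_op_nmat[symmetric] by (intro bexI[of _ "emb d ?g"] imageI) simp_all
qed simp

text \<open>At s = -i x the map s -> 1/s is x -> -1/x, and s^(d+1) = (-i)^(d+1) x^(d+1). This is the
  origin of the constant in front of the Hankel transform.\<close>

lemma T_op_wmat:
  assumes f: "f \<in> schwartz_half_line" and x: "x \<noteq> 0"
  shows "T_op d (emb d (\<lambda>x. (- \<i>) ^ Suc d * hank d f x)) x = pi_rep d wmat (T_op d (emb d f)) x"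
proof -
  let ?s = "- \<i> * complex_of_real x"
  have s: "?s \<noteq> 0" "Re ?s \<ge> 0" using x by auto
  have i: "1 / ?s = - \<i> * complex_of_real (- 1 / x)" using x by (simp add: field_simps)
  have "(- \<i>) ^ Suc d * lap d (hank d f) ?s = (- \<i>) ^ Suc d * (lap d f (1 / ?s) / ?s ^ Suc d)"
    by (simp only: lap_hank[OF f s(2,1)])
  also have "\<dots> = lap d f (1 / ?s) / complex_of_real x ^ Suc d"
    unfolding power_mult_distrib by simp
  finally have "T_op d (emb d (\<lambda>x. (- \<i>) ^ Suc d * hank d f x)) x = c2pi *\<^sub>R (lap d f (- \<i> * complex_of_real (- 1 / x)) / complex_of_real x ^ Suc d)"
    by (simp only: T_op_emb lap_cmult i)
  also have "\<dots> = (x powi (- int d - 1)) *\<^sub>R (c2pi *\<^sub>R lap d f (- \<i> * complex_of_real (- 1 / x)))"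
  proof -
    have "x powi (- int d - 1) = inverse (x ^ Suc d)"
    proof -
      have "- int d - 1 = - int (Suc d)" by simp
      then show ?thesis by (simp only: power_int_minus power_int_of_nat)
    qed
    then show ?thesis
      by (simp only: scaleR_conv_of_real divide_inverse of_real_inverse of_real_power mult_ac)
  qed
  also have "\<dots> = pi_rep d wmat (T_op d (emb d f)) x"
  proof -
    have "pi_rep d wmat \<phi> x = (x powi (- int d - 1)) *\<^sub>R \<phi> (- 1 / x)" for \<phi>
      using x by (simp add: pi_rep_def Let_def)
    then show ?thesis by (simp only: T_op_emb)
  qed
  finally show ?thesis .
qed

lemma T_op_wmat_finite:
  assumes f: "f \<in> schwartz_half_line"
  shows "finite {x. T_op d (emb d (\<lambda>x. (- \<i>) ^ Suc d * hank d f x)) x \<noteq> pi_rep d wmat (T_op d (emb d f)) x}"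
proof (rule finite_subset)
  show "{x. T_op d (emb d (\<lambda>x. (- \<i>) ^ Suc d * hank d f x)) x \<noteq> pi_rep d wmat (T_op d (emb d f)) x} \<subseteq> {0}"
  proof (intro subsetI, simp only: mem_Collect_eq singleton_iff)
    fix x assume a: "T_op d (emb d (\<lambda>x. (- \<i>) ^ Suc d * hank d f x)) x \<noteq> pi_rep d wmat (T_op d (emb d f)) x"
    show "x = 0" by (rule contrapos_np[OF a T_op_wmat[OF f]])
  qed
qed simp

lemma good_wmat:
  assumes d: "d > 0" shows "good d wmat"
  unfolding good_def S_half_line_eq
proof (intro conjI ballI)
  fix f assume "f \<in> emb d ` schwartz_half_line"
  then obtain f1 where f: "f = emb d f1" "f1 \<in> schwartz_half_line" by blast
  let ?g = "\<lambda>x. (- \<i>) ^ Suc d * hank d f1 x"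
  have g: "?g \<in> schwartz_half_line" by (intro schwartz_cmult hank_schwartz f(2))
  have "norm (abs_L2pos (emb d ?g)) = norm (abs_L2pos (emb d (hank d f1)))"
    by (rule norm_abs_L2pos_unimodular[OF SQ_emb[OF hank_schwartz[OF f(2)]] measurable_emb[OF g]])
      (simp add: emb_def norm_mult norm_power)
  then have n: "norm (abs_L2pos (emb d ?g)) = norm (abs_L2pos f)"
    unfolding norm_emb_hank[OF f(2) d] f(1) .
  have "finite {x. T_op d (emb d ?g) x \<noteq> pi_rep d wmat (T_op d f) x}"
    unfolding f(1) by (rule T_op_wmat_finite[OF f(2)])
  with n show "\<exists>f'\<in>emb d ` schwartz_half_line. norm (abs_L2pos f') = norm (abs_L2pos f)
     \<and> finite {x. T_op d f' x \<noteq> pi_rep d wmat (T_op d f) x}"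
    by (rule_tac bexI[OF _ imageI[OF g]]) (rule conjI)
qed simp

text \<open>The inverse of \<open>wmat\<close> is written as its cube, so that closure of
  \<open>good\<close> under products suffices.\<close>

lemma nbar_eq: "nbar c = wmat ** nmat (- c) ** (wmat ** wmat ** wmat)"
  by (simp add: mat2_eq_iff mat2_mult_nth)

text \<open>All three factors are unipotent, so that \<open>nmat\<close> and \<open>wmat\<close>
  generate without a diagonal factor. The two outer parameters are dictated by the diagonal entries
  of \<open>g\<close>; the upper right entry then agrees because the determinant is 1.\<close>

lemma bruhat:
  assumes "g \<in> SL2" "g $ 2 $ 1 \<noteq> 0"
  shows "g = nmat ((g $ 1 $ 1 - 1) / g $ 2 $ 1) ** nbar (g $ 2 $ 1) ** nmat ((g $ 2 $ 2 - 1) / g $ 2 $ 1)"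
proof -
  have "g $ 1 $ 2 = (g $ 1 $ 1 * g $ 2 $ 2 - 1) / g $ 2 $ 1"
    using assms by (simp add: SL2_def det_2 field_simps)
  then show ?thesis
    using assms(2) by (simp add: mat2_eq_iff mat2_mult_nth diff_divide_distrib algebra_simps)
qed

lemma good_SL2:
  assumes d: "d > 0" and g: "g \<in> SL2" shows "good d g"
proof -
  have main: "good d g" if g: "g \<in> SL2" "g $ 2 $ 1 \<noteq> 0" for g
    by (subst bruhat[OF g], subst nbar_eq) (intro good_mult good_nmat good_wmat d)
  \<comment> \<open>A matrix whose lower left entry is 0 is moved by the inverse of
    \<open>wmat\<close> to one whose lower left entry is minus its upper left entry, which the
    determinant forces to be nonzero.\<close>
  have "g = wmat ** (wmat ** wmat ** wmat ** g)"
    by (simp add: mat2_eq_iff mat2_mult_nth)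
  moreover have "good d (wmat ** wmat ** wmat ** g)" if "g $ 2 $ 1 = 0"
  proof (rule main)
    show "wmat ** wmat ** wmat ** g \<in> SL2" using g by (intro SL2_mult) simp_all
    show "(wmat ** wmat ** wmat ** g) $ 2 $ 1 \<noteq> 0"
      using g that by (auto simp: mat2_mult_nth SL2_def det_2)
  qed
  ultimately show ?thesis using main[OF g] good_mult[OF good_wmat[OF d]] by metis
qed

text \<open>The third statement retains the relation to \<open>pi_rep\<close> on the side of the
  line, before \<open>M_op\<close> is applied. Products and linear combinations of the operators are
  computed through it.\<close>

lemma R_plus_good:
  assumes d: "d > 0" and g: "g \<in> SL2" and f: "f \<in> S_half_line d"
  shows "R_plus d g f \<in> S_half_line d" "norm (abs_L2pos (R_plus d g f)) = norm (abs_L2pos f)"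
    "finite {x. T_op d (R_plus d g f) x \<noteq> pi_rep d g (T_op d f) x}"
proof -
  obtain f' where f'S: "f' \<in> S_half_line d" and f'0: "norm (abs_L2pos f') = norm (abs_L2pos f) \<and>
    finite {x. T_op d f' x \<noteq> pi_rep d g (T_op d f) x}"
    using goodD[OF good_SL2[OF d g] f] by (rule bexE)
  note f' = f'S conjunct1[OF f'0] and fin = conjunct2[OF f'0]
  obtain f1 where f1: "f' = emb d f1" "f1 \<in> schwartz_half_line"
    using f'(1) unfolding S_half_line_eq by (rule imageE)
  have "R_plus d g f = M_op d (T_op d f')"
    unfolding R_plus_def by (rule M_op_cong_finite[OF fin, symmetric])
  also have "\<dots> = f'" unfolding f1(1) by (rule M_T_emb[OF f1(2) d])
  finally have eq: "R_plus d g f = f'" .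
  show "R_plus d g f \<in> S_half_line d" "norm (abs_L2pos (R_plus d g f)) = norm (abs_L2pos f)"
    "finite {x. T_op d (R_plus d g f) x \<noteq> pi_rep d g (T_op d f) x}"
    using f' fin unfolding eq by simp_all
qed

lemma finite_neq_trans:
  assumes "finite {x. a x \<noteq> b x}" "finite {x. c x \<noteq> b x}"
  shows "finite {x. a x \<noteq> c x}"
  by (rule finite_subset[OF _ finite_UnI[OF assms]]) auto

lemma R_plus_mult:
  assumes d: "d > 0" and g: "g \<in> SL2" and h: "h \<in> SL2" and f: "f \<in> S_half_line d"
  shows "R_plus d (g ** h) f = R_plus d g (R_plus d h f)"
  unfolding R_plus_def[of d g] R_plus_def[of d "g ** h"]
  by (rule M_op_cong_finite, rule finite_neq_trans[OF pi_rep_mult_finite[OF g h] pi_rep_cong_finite[OF g R_plus_good(3)[OF d h f]]])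

lemma R_plus_nmat:
  assumes d: "d > 0" and f: "f \<in> schwartz_half_line"
  shows "R_plus d (nmat c) (emb d f) = emb d (\<lambda>x. exp (- (- \<i> * complex_of_real c) * complex_of_real x) * f x)"
  unfolding R_plus_def T_op_nmat[symmetric] by (rule M_T_emb[OF schwartz_exp_mult[OF f] d]) simp

lemma R_plus_wmat:
  assumes d: "d > 0" and f: "f \<in> schwartz_half_line"
  shows "R_plus d wmat (emb d f) = emb d (\<lambda>x. (- \<i>) ^ Suc d * hank d f x)"
proof -
  have "R_plus d wmat (emb d f) = M_op d (T_op d (emb d (\<lambda>x. (- \<i>) ^ Suc d * hank d f x)))"
    unfolding R_plus_def by (rule M_op_cong_finite[OF T_op_wmat_finite[OF f], symmetric])
  also have "\<dots> = emb d (\<lambda>x. (- \<i>) ^ Suc d * hank d f x)"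
    by (intro M_T_emb schwartz_cmult hank_schwartz f d)
  finally show ?thesis .
qed

section \<open>Density of S_d in the Hilbert space\<close>

lemma L2_dominated_convergence:
  assumes f: "\<And>n. f n \<in> borel_measurable HL" and g: "g \<in> borel_measurable HL" and w: "SQ w"
    and lim: "AE x in HL. (\<lambda>n. f n x) \<longlonglongrightarrow> g x"
    and bd: "\<And>n. AE x in HL. cmod (f n x) \<le> cmod (w x)"
  shows "SQ (f n)" "SQ g" "(\<lambda>n. abs_L2pos (f n)) \<longlonglongrightarrow> abs_L2pos g"
proof -
  have [measurable]: "\<And>n. f n \<in> borel_measurable HL" "g \<in> borel_measurable HL" by (rule f, rule g)
  have fS: "SQ (f n)" for n by (rule SQ_bound[OF w f, of _ 1]) (use bd in simp)
  then show "SQ (f n)" .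
  have "AE x in HL. \<forall>n. cmod (f n x) \<le> cmod (w x)" using bd by (simp add: AE_all_countable)
  with lim have gb: "AE x in HL. cmod (g x) \<le> 1 * cmod (w x)"
  proof eventually_elim
    case (elim x)
    have "(\<lambda>n. cmod (f n x)) \<longlonglongrightarrow> cmod (g x)" by (rule tendsto_norm[OF elim(1)])
    then have "cmod (g x) \<le> cmod (w x)" by (rule LIMSEQ_le_const2) (use elim(2) in auto)
    then show ?case by simp
  qed
  show gS: "SQ g" by (rule SQ_bound[OF w g gb])
  have "(\<lambda>n. LINT x|dx_over_x. (cmod (f n x - g x))\<^sup>2) \<longlonglongrightarrow> (LINT x|dx_over_x. 0)"
  proof (rule integral_dominated_convergence)
    show "integrable dx_over_x (\<lambda>x. 4 * (cmod (w x))\<^sup>2)"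
      using w by (simp add: square_integrable_def)
    show "AE x in dx_over_x. (\<lambda>n. (cmod (f n x - g x))\<^sup>2) \<longlonglongrightarrow> 0"
      unfolding AE_dx_over_x_iff using lim
    proof eventually_elim
      case (elim x)
      then have "(\<lambda>n. cmod (f n x - g x)) \<longlonglongrightarrow> 0" by (intro tendsto_norm_zero) (simp add: LIM_zero_iff)
      then have "(\<lambda>n. (cmod (f n x - g x))\<^sup>2) \<longlonglongrightarrow> 0\<^sup>2" by (rule tendsto_power)
      then show ?case by simp
    qed
    show "AE x in dx_over_x. norm ((cmod (f n x - g x))\<^sup>2) \<le> 4 * (cmod (w x))\<^sup>2" for n
      unfolding AE_dx_over_x_iff using bd[of n] gb
    proof eventually_elim
      case (elim x)
      have "cmod (f n x - g x) \<le> 2 * cmod (w x)"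
        using norm_triangle_ineq4[of "f n x" "g x"] elim by simp
      then have "(cmod (f n x - g x))\<^sup>2 \<le> (2 * cmod (w x))\<^sup>2" by (intro power_mono) auto
      then show ?case by (simp add: power_mult_distrib)
    qed
  qed simp_all
  then have "(\<lambda>n. (norm (abs_L2pos (f n) - abs_L2pos g))\<^sup>2) \<longlonglongrightarrow> 0"
    by (simp add: abs_L2pos_diff fS gS norm_abs_L2pos SQ_diff)
  then have "(\<lambda>n. sqrt ((norm (abs_L2pos (f n) - abs_L2pos g))\<^sup>2)) \<longlonglongrightarrow> sqrt 0" by (rule tendsto_real_sqrt)
  then show "(\<lambda>n. abs_L2pos (f n)) \<longlonglongrightarrow> abs_L2pos g"
    by (simp add: tendsto_norm_zero_iff LIM_zero_iff)
qed

abbreviation Sd :: "nat \<Rightarrow> L2pos set" where "Sd d \<equiv> abs_L2pos ` S_half_line d"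

lemma schwartz_real_polynomial_exp:
  assumes "real_polynomial_function P" "f \<in> schwartz_half_line"
  shows "(\<lambda>y. complex_of_real (P (exp (- y))) * f y) \<in> schwartz_half_line"
  using assms
proof (induction arbitrary: f rule: real_polynomial_function.induct)
  case (linear P)
  then have L: "P u = u * P 1" for u using linear_cmul[OF bounded_linear.linear, of P u 1] by simp
  have E: "exp (- 1 * complex_of_real y) = complex_of_real (exp (- y))" for y
    by (simp add: exp_of_real[symmetric])
  have eq: "complex_of_real (P (exp (- y))) * f y = complex_of_real (P 1) * (exp (- 1 * complex_of_real y) * f y)" for y
    by (simp only: L[of "exp (- y)"] E of_real_mult mult_ac)
  show ?case unfolding eq by (intro schwartz_cmult schwartz_exp_mult linear) simp
next
  case (const c)
  then show ?case by (intro schwartz_cmult)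
next
  case (add P Q)
  have eq: "complex_of_real (P u + Q u) * z = complex_of_real (P u) * z + complex_of_real (Q u) * z" for u z
    by (simp add: distrib_right)
  show ?case unfolding eq by (intro schwartz_add add)
next
  case (mult P Q)
  have eq: "complex_of_real (P u * Q u) * z = complex_of_real (P u) * (complex_of_real (Q u) * z)" for u z
    by simp
  show ?case unfolding eq by (intro mult)
qed

lemma schwartz_polynomial_exp:
  fixes P :: "real \<Rightarrow> complex"
  assumes P: "polynomial_function P"
  shows "(\<lambda>y. P (exp (- y)) * exp (- 1 * complex_of_real y)) \<in> schwartz_half_line"
proof -
  have r: "real_polynomial_function (\<lambda>u. Re (P u))" "real_polynomial_function (\<lambda>u. Im (P u))"
    using P bounded_linear_Re bounded_linear_Im unfolding polynomial_function_def o_def by blast+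
  have e: "(\<lambda>y. exp (- 1 * complex_of_real y)) \<in> schwartz_half_line" by (rule schwartz_exp) simp
  have eq: "P u * z = complex_of_real (Re (P u)) * z + \<i> * (complex_of_real (Im (P u)) * z)" for u z
    by (subst complex_eq[of "P u"]) (simp add: algebra_simps)
  show ?thesis unfolding eq by (intro schwartz_add schwartz_cmult schwartz_real_polynomial_exp r e)
qed

text \<open>The substitution $u = e^{-x}$ reduces density to the Weierstrass theorem on $[0,1]$.\<close>

lemma closure_Sd_continuous:
  fixes h :: "real \<Rightarrow> complex"
  assumes h: "continuous_on UNIV h" and a: "0 < a"
    and supp: "\<And>x. x \<le> a \<Longrightarrow> h x = 0" "\<And>x. x \<ge> b \<Longrightarrow> h x = 0"
  shows "abs_L2pos h \<in> closure (Sd d)"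
proof -
  define al where "al = (real d + 1) / 2"
  \<comment> \<open>The quotient of \<open>h\<close> by x^al exp (- x), written in u = exp (- x). As
    \<open>h\<close> vanishes near 0 and near infinity, \<open>k\<close> vanishes near u = 1 and
    near u = 0, and is therefore continuous up to both ends.\<close>
  define k where "k u = (if u \<le> 0 then 0 else h (- ln u) * complex_of_real ((- ln u) powr (- al) / u))" for u
  have k1: "k u = 0" if "u \<ge> exp (- a)" for u
  proof -
    have "u > 0" using that exp_gt_zero[of "- a"] by linarith
    then have "- ln u \<le> a" using that by (metis exp_le_cancel_iff exp_ln minus_le_iff)
    then show ?thesis by (simp add: k_def supp)
  qed
  have k0: "k u = 0" if "u \<le> exp (- b)" for u
  proof (cases "u > 0")
    case True
    then have "- ln u \<ge> b" using that by (metis exp_le_cancel_iff exp_ln le_minus_iff)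
    then show ?thesis by (simp add: k_def supp)
  qed (simp add: k_def)
  have e1: "exp (- a) < 1" using a by simp
  have "continuous_on ({..<exp (- b)} \<union> {0<..<1} \<union> {exp (- a)<..}) k"
  proof (intro continuous_on_open_Un open_Un open_lessThan open_greaterThanLessThan open_greaterThan)
    show "continuous_on {..<exp (- b)} k"
      by (rule continuous_on_cong[THEN iffD1, OF refl _ continuous_on_const[of _ 0]]) (simp add: k0)
    show "continuous_on {exp (- a)<..} k"
      by (rule continuous_on_cong[THEN iffD1, OF refl _ continuous_on_const[of _ 0]]) (simp add: k1)
    have "continuous_on {0<..<1} (\<lambda>u. h (- ln u) * complex_of_real ((- ln u) powr (- al) / u))"
      by (intro continuous_intros continuous_on_compose2[OF h]) auto
    then show "continuous_on {0<..<1} k"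
      by (rule continuous_on_cong[THEN iffD1, OF refl, rotated]) (simp add: k_def)
  qed
  moreover have "{0..1} \<subseteq> {..<exp (- b)} \<union> {0<..<1} \<union> {exp (- a)<..}"
    using e1 exp_gt_zero[of "- b"] by (auto simp: not_less)
  ultimately have k: "continuous_on {0..1} k" by (rule continuous_on_subset)
  \<comment> \<open>One factor exp (- x) is kept apart from the polynomial. It makes the product a
    Schwartz function even when the polynomial has a constant term, and turns a uniform error on
    [0,1] into an L^2 error bounded by a multiple of the norm of \<open>?E\<close>.\<close>
  let ?E = "emb d (\<lambda>y. exp (- 1 * complex_of_real y))"
  have E: "SQ ?E" by (intro SQ_emb schwartz_exp) simp
  have hm: "h \<in> borel_measurable HL" by (rule measurable_HL_continuous[OF continuous_on_subset[OF h]]) simp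
  have hS: "SQ h"
  proof -
    have "bounded (h ` {a..b})"
      by (intro compact_imp_bounded compact_continuous_image continuous_on_subset[OF h]) auto
    then obtain B where B: "\<And>x. x \<in> {a..b} \<Longrightarrow> cmod (h x) \<le> B" unfolding bounded_iff by blast
    show ?thesis
    proof (rule SQ_criterion[OF hm])
      fix x :: real assume x: "x > 0"
      show "(1 + x\<^sup>2) * (cmod (h x))\<^sup>2 \<le> ((1 + b\<^sup>2) * B\<^sup>2 / a) * x"
      proof (cases "x \<in> {a..b}")
        case True
        then have "(1 + x\<^sup>2) * (cmod (h x))\<^sup>2 \<le> (1 + b\<^sup>2) * B\<^sup>2"
          using B[OF True] x by (intro mult_mono add_mono power_mono) auto
        also have "(1 + b\<^sup>2) * B\<^sup>2 = ((1 + b\<^sup>2) * B\<^sup>2) * 1" by simp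
        also have "\<dots> \<le> ((1 + b\<^sup>2) * B\<^sup>2) * (x / a)"
          using True a by (intro mult_left_mono) auto
        finally show ?thesis by simp
      next
        case False
        then have "h x = 0" using supp[of x] by (auto simp: not_le)
        then show ?thesis using a x by simp
      qed
    qed
  qed
  show ?thesis unfolding closure_approachable
  proof (intro allI impI)
    fix e :: real assume e: "e > 0"
    define W where "W = norm (abs_L2pos ?E)"
    have W: "W \<ge> 0" by (simp add: W_def)
    define e' where "e' = e / (W + 1)"
    have e': "e' > 0" using e W by (simp add: e'_def)
    obtain P where P: "polynomial_function P" "\<And>u. u \<in> {0..1} \<Longrightarrow> norm (k u - P u) < e'"
      using Stone_Weierstrass_polynomial_function[OF compact_Icc k e'] by blast
    let ?p = "\<lambda>y. P (exp (- y)) * exp (- 1 * complex_of_real y)"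
    have p: "?p \<in> schwartz_half_line" by (rule schwartz_polynomial_exp[OF P(1)])
    have bd: "cmod (h y - emb d ?p y) \<le> e' * cmod (?E y)" if y: "y > 0" for y
    proof -
      have kE: "k (exp (- y)) * ?E y = h y"
      proof -
        have "y powr (- al) * y powr al = 1" using y by (simp flip: powr_add)
        then have 3: "(y powr (- al) / exp (- y)) * (y powr al * exp (- y)) = 1" by simp
        have 1: "k (exp (- y)) = h y * complex_of_real (y powr (- al) / exp (- y))"
          by (simp add: k_def not_le)
        have 2: "?E y = complex_of_real (y powr al * exp (- y))"
          using y by (simp add: emb_def al_def scaleR_conv_of_real exp_of_real[symmetric])
        show ?thesis unfolding 1 2 mult.assoc of_real_mult[symmetric] 3 by simp
      qed
      have pE: "emb d ?p y = P (exp (- y)) * ?E y" using y by (simp add: emb_def)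
      have "h y - emb d ?p y = (k (exp (- y)) - P (exp (- y))) * ?E y"
        unfolding pE left_diff_distrib kE ..
      then have "cmod (h y - emb d ?p y) = norm (k (exp (- y)) - P (exp (- y))) * cmod (?E y)"
        by (simp only: norm_mult)
      also have "\<dots> \<le> e' * cmod (?E y)"
        using y by (intro mult_right_mono less_imp_le[OF P(2)]) auto
      finally show ?thesis .
    qed
    have "norm (abs_L2pos (\<lambda>y. h y - emb d ?p y)) \<le> e' * W" unfolding W_def
    proof (rule norm_abs_L2pos_le[OF E _ less_imp_le[OF e']])
      show "(\<lambda>y. h y - emb d ?p y) \<in> borel_measurable HL"
        by (rule borel_measurable_diff[OF hm measurable_emb[OF p]])
      show "AE y in HL. cmod (h y - emb d ?p y) \<le> e' * cmod (?E y)"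
        unfolding AE_HL_iff by (intro always_eventually allI impI bd)
    qed
    also have "\<dots> < e" using e W by (simp add: e'_def field_simps)
    finally have "dist (abs_L2pos (emb d ?p)) (abs_L2pos h) < e"
      by (subst dist_commute) (simp only: dist_norm abs_L2pos_diff[OF hS SQ_emb[OF p]])
    then show "\<exists>y\<in>Sd d. dist y (abs_L2pos h) < e"
      using p unfolding S_half_line_eq by (intro bexI[of _ "abs_L2pos (emb d ?p)"] imageI)
  qed
qed

lemma continuous_approximation:
  fixes g :: "real \<Rightarrow> complex"
  assumes "g \<in> borel_measurable HL"
  obtains G where "\<And>n::nat. continuous_on UNIV (G n)" "AE x in HL. (\<lambda>n. G n x) \<longlonglongrightarrow> g x"
proof -
  let ?g = "\<lambda>x. indicator {0<..} x *\<^sub>R g x"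
  have "?g \<in> borel_measurable lebesgue"
    using assms by (simp add: borel_measurable_HL_iff measurable_completion measurable_lborel1)
  then have "?g measurable_on UNIV" by (rule lebesgue_measurable_imp_measurable_on) simp
  then obtain N G where N: "negligible N" and G: "\<And>n. continuous_on UNIV (G n)"
    and lim: "\<And>x. x \<notin> N \<Longrightarrow> (\<lambda>n. G n x) \<longlonglongrightarrow> ?g x"
    unfolding measurable_on_def by auto
  have "AE x in lborel. x \<notin> N"
  proof -
    have "N \<in> null_sets lebesgue" using N by (simp add: negligible_iff_null_sets)
    then have "AE x in lebesgue. x \<notin> N" by (rule AE_not_in)
    then show ?thesis by (simp add: AE_completion_iff)
  qed
  then have "AE x in HL. (\<lambda>n. G n x) \<longlonglongrightarrow> g x"
    unfolding AE_HL_iff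
  proof eventually_elim
    case (elim x)
    show ?case using lim[OF elim] by (auto simp: indicator_def)
  qed
  with G that show ?thesis by blast
qed

lemma density_Sd: "closure (Sd d) = UNIV"
proof -
  have "v \<in> closure (Sd d)" for v
  proof -
    define g where "g = rep_L2pos v"
    have g: "SQ g" and v: "v = abs_L2pos g" using rep_L2pos[of v] by (auto simp: g_def)
    have gm: "g \<in> borel_measurable HL" using g by (simp add: square_integrable_def)
    obtain G where G: "\<And>n::nat. continuous_on UNIV (G n)" and lim: "AE x in HL. (\<lambda>n. G n x) \<longlonglongrightarrow> g x"
      using continuous_approximation[OF gm] by blast
    \<comment> \<open>The continuous approximants converge only almost everywhere and without any
      bound. \<open>T K\<close> limits their values to modulus \<open>K\<close> and
      \<open>c K\<close> cuts them off outside [1/K, 2K]; this supplies a dominating function and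
      preserves continuity. Both truncations are removed at the end by letting \<open>K\<close> tend
      to infinity.\<close>
    define T where "T K z = (1 / max 1 (cmod z / K)) *\<^sub>R z" for K :: real and z
    define c where "c K x = min 1 (max 0 (K * x - 1)) * min 1 (max 0 (2 - x / K))" for K x :: real
    have Tc: "continuous_on UNIV (T K)" if "K > 0" for K
      unfolding T_def using that by (intro continuous_intros) auto
    have cc: "continuous_on UNIV (c K)" if "K > 0" for K
      unfolding c_def using that by (intro continuous_intros) auto
    have TK: "cmod (T K z) \<le> K" "cmod (T K z) \<le> cmod z" if "K > 0" for K z
    proof -
      let ?m = "max 1 (cmod z / K)"
      have m: "?m \<ge> 1" by simp
      have n: "cmod (T K z) = cmod z / ?m" using m by (simp add: T_def)
      have "cmod z \<le> K * ?m" using that by (simp add: max_def field_simps)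
      then show "cmod (T K z) \<le> K" unfolding n using m by (simp add: pos_divide_le_eq mult.commute)
      show "cmod (T K z) \<le> cmod z" unfolding n using m
        by (metis div_by_1 frac_le norm_ge_zero order_refl zero_less_one)
    qed
    have c01: "0 \<le> c K x" "c K x \<le> 1" for K x by (auto simp: c_def intro!: mult_le_one)
    have cK: "cmod (c K x *\<^sub>R z) \<le> cmod z" for K x z
      using c01[of K x] by (simp add: mult_left_le_one_le)
    have c0: "c K x = 0" if "K > 0" "x \<le> 1 / K \<or> x \<ge> 2 * K" for K x
      using that by (auto simp: c_def field_simps max_def)
    have f_mem: "abs_L2pos (\<lambda>x. c K x *\<^sub>R T K (g x)) \<in> closure (Sd d)" if K: "K > 0" for K
    proof -
      let ?F = "\<lambda>n x. c K x *\<^sub>R T K (G n x)"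
      have F: "continuous_on UNIV (?F n)" for n
        by (intro continuous_intros cc K continuous_on_compose2[OF Tc[OF K] G]) auto
      define w where "w x = complex_of_real (if x \<in> {1 / K..2 * K} then K else 0)" for x
      have w: "SQ w"
      proof (rule SQ_criterion)
        show "w \<in> borel_measurable HL" unfolding w_def by (rule measurable_HL_borel) measurable
        fix x :: real assume x: "x > 0"
        show "(1 + x\<^sup>2) * (cmod (w x))\<^sup>2 \<le> ((1 + (2 * K)\<^sup>2) * K\<^sup>2 * K) * x"
        proof (cases "x \<in> {1 / K..2 * K}")
          case True
          then have "(1 + x\<^sup>2) * (cmod (w x))\<^sup>2 = (1 + x\<^sup>2) * K\<^sup>2" by (simp add: w_def)
          also have "\<dots> \<le> (1 + (2 * K)\<^sup>2) * K\<^sup>2"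
            using True x by (intro mult_right_mono add_left_mono power_mono) auto
          also have "\<dots> \<le> ((1 + (2 * K)\<^sup>2) * K\<^sup>2) * (K * x)"
          proof -
            have "1 \<le> K * x" using True K by (simp add: field_simps)
            then show ?thesis using mult_left_mono[of 1 "K * x" "(1 + (2 * K)\<^sup>2) * K\<^sup>2"] by simp
          qed
          finally show ?thesis by (simp add: mult.assoc)
        next
          case False
          then have "w x = 0" by (simp only: w_def if_False of_real_0)
          then show ?thesis using K x by simp
        qed
      qed
      have conv: "(\<lambda>n. abs_L2pos (?F n)) \<longlonglongrightarrow> abs_L2pos (\<lambda>x. c K x *\<^sub>R T K (g x))"
      proof (rule L2_dominated_convergence(3)[OF _ _ w])
        show "?F n \<in> borel_measurable HL" for n by (rule measurable_HL_continuous[OF continuous_on_subset[OF F]]) simp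
        have Tm: "T K \<in> borel_measurable borel" by (rule borel_measurable_continuous_onI[OF Tc[OF K]])
        have cm: "c K \<in> borel_measurable borel" by (rule borel_measurable_continuous_onI[OF cc[OF K]])
        show "(\<lambda>x. c K x *\<^sub>R T K (g x)) \<in> borel_measurable HL"
          by (rule borel_measurable_scaleR[OF measurable_HL_borel[OF cm] measurable_compose[OF gm Tm]])
        show "AE x in HL. (\<lambda>n. ?F n x) \<longlonglongrightarrow> c K x *\<^sub>R T K (g x)"
          using lim
        proof eventually_elim
          case (elim x)
          have "isCont (T K) (g x)" using Tc[OF K] by (simp add: continuous_on_eq_continuous_at)
          then show ?case by (intro tendsto_scaleR tendsto_const isCont_tendsto_compose[OF _ elim])
        qed
        have "cmod (?F n x) \<le> cmod (w x)" for n x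
        proof (cases "x \<in> {1 / K..2 * K}")
          case True
          then show ?thesis using order_trans[OF cK TK(1)[OF K]] K by (simp add: w_def)
        next
          case False
          then have "c K x = 0" using K by (intro c0) (auto simp: not_le)
          then show ?thesis by simp
        qed
        then show "AE x in HL. cmod (?F n x) \<le> cmod (w x)" for n by simp
      qed
      have mem: "abs_L2pos (?F n) \<in> closure (Sd d)" for n
        by (rule closure_Sd_continuous[OF F, where a = "1 / K" and b = "2 * K"]) (use K c0 in auto)
      show ?thesis by (rule closed_sequentially[OF closed_closure mem conv])
    qed
    have conv: "(\<lambda>n. abs_L2pos (\<lambda>x. c (real (Suc n)) x *\<^sub>R T (real (Suc n)) (g x))) \<longlonglongrightarrow> abs_L2pos g"
    proof (rule L2_dominated_convergence(3)[OF _ gm g])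
      have Tm: "T (real (Suc n)) \<in> borel_measurable borel" for n by (rule borel_measurable_continuous_onI[OF Tc]) simp
      have cm: "c (real (Suc n)) \<in> borel_measurable borel" for n by (rule borel_measurable_continuous_onI[OF cc]) simp
      show "(\<lambda>x. c (real (Suc n)) x *\<^sub>R T (real (Suc n)) (g x)) \<in> borel_measurable HL" for n
        by (rule borel_measurable_scaleR[OF measurable_HL_borel[OF cm] measurable_compose[OF gm Tm]])
      have "cmod (c (real (Suc n)) x *\<^sub>R T (real (Suc n)) (g x)) \<le> cmod (g x)" for n x
        by (rule order_trans[OF cK TK(2)]) simp
      then show "AE x in HL. cmod (c (real (Suc n)) x *\<^sub>R T (real (Suc n)) (g x)) \<le> cmod (g x)" for n by simp
      have "(\<lambda>n. c (real (Suc n)) x *\<^sub>R T (real (Suc n)) (g x)) \<longlonglongrightarrow> g x" if x: "x > 0" for x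
      proof (rule tendsto_eventually)
        obtain N where N: "max (2 / x) (max x (cmod (g x))) \<le> real N" using real_arch_simple by blast
        show "\<forall>\<^sub>F n in sequentially. c (real (Suc n)) x *\<^sub>R T (real (Suc n)) (g x) = g x"
          using eventually_ge_at_top[of N]
        proof eventually_elim
          case (elim n)
          define K where "K = real (Suc n)"
          have K: "K > 0" "2 / x \<le> K" "x \<le> K" "cmod (g x) \<le> K" using N elim by (auto simp: K_def)
          have "K * x \<ge> 2" using K x by (simp add: field_simps)
          moreover have "x / K \<le> 1" using K by simp
          ultimately have "c K x = 1" by (simp add: c_def)
          moreover have "T K (g x) = g x" using K by (simp add: T_def max_def)
          ultimately show ?case by (simp add: K_def)
        qed
      qed
      then show "AE x in HL. (\<lambda>n. c (real (Suc n)) x *\<^sub>R T (real (Suc n)) (g x)) \<longlonglongrightarrow> g x"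
        by (simp add: AE_HL_iff)
    qed
    have mem: "abs_L2pos (\<lambda>x. c (real (Suc n)) x *\<^sub>R T (real (Suc n)) (g x)) \<in> closure (Sd d)" for n
      by (rule f_mem) simp
    show ?thesis unfolding v by (rule closed_sequentially[OF closed_closure mem conv])
  qed
  then show ?thesis by blast
qed

section \<open>Linearity of the action on S_d and arguments by density\<close>

lemma emb_add: "emb d (\<lambda>x. f x + g x) = (\<lambda>x. emb d f x + emb d g x)"
  by (auto simp: emb_def scaleR_add_right)

lemma SQ_S_half_line: "f \<in> S_half_line d \<Longrightarrow> SQ f"
  unfolding S_half_line_eq by (erule imageE) (simp add: SQ_emb)

lemma S_half_line_lin:
  assumes "f \<in> S_half_line d" "g \<in> S_half_line d"
  shows "(\<lambda>x. a * f x + b * g x) \<in> S_half_line d"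
proof -
  obtain f1 g1 where f: "f = emb d f1" "f1 \<in> schwartz_half_line" and g: "g = emb d g1" "g1 \<in> schwartz_half_line"
    using assms unfolding S_half_line_eq by (elim imageE) (rule that; assumption)
  have "(\<lambda>x. a * f x + b * g x) = emb d (\<lambda>x. a * f1 x + b * g1 x)"
    unfolding f g emb_add emb_cmult ..
  moreover have "(\<lambda>x. a * f1 x + b * g1 x) \<in> schwartz_half_line" by (intro schwartz_add schwartz_cmult f g)
  ultimately show ?thesis unfolding S_half_line_eq by (rule image_eqI)
qed

lemma T_op_lin:
  assumes "f \<in> S_half_line d" "g \<in> S_half_line d"
  shows "T_op d (\<lambda>x. a * f x + b * g x) z = a * T_op d f z + b * T_op d g z"
proof -
  obtain f1 g1 where f: "f = emb d f1" "f1 \<in> schwartz_half_line" and g: "g = emb d g1" "g1 \<in> schwartz_half_line"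
    using assms unfolding S_half_line_eq by (elim imageE) (rule that; assumption)
  have eq: "(\<lambda>x. a * f x + b * g x) = emb d (\<lambda>x. a * f1 x + b * g1 x)"
    unfolding f g emb_add emb_cmult ..
  have i: "integrable HL (\<lambda>x. exp (- s * complex_of_real x) * (x ^ d *\<^sub>R h x))"
    if h: "h \<in> schwartz_half_line" and s: "Re s \<ge> 0" for h s
  proof -
    have "integrable HL (\<lambda>x. x ^ d *\<^sub>R (exp (- s * complex_of_real x) * h x))"
      by (rule schwartz_integrable[OF schwartz_exp_mult[OF h s]])
    then show ?thesis by simp
  qed
  have s: "Re (- \<i> * complex_of_real z) \<ge> 0" by simp
  have "lap d (\<lambda>x. a * f1 x + b * g1 x) (- \<i> * complex_of_real z)
      = lap d (\<lambda>x. a * f1 x) (- \<i> * complex_of_real z) + lap d (\<lambda>x. b * g1 x) (- \<i> * complex_of_real z)"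
    unfolding lap_def scaleR_add_right distrib_left
    by (rule Bochner_Integration.integral_add[OF i[OF schwartz_cmult[OF f(2)] s] i[OF schwartz_cmult[OF g(2)] s]])
  then show ?thesis unfolding eq T_op_emb unfolding f g T_op_emb lap_cmult
    by (simp add: scaleR_add_right)
qed

lemma pi_rep_lin_finite:
  assumes g: "g \<in> SL2"
  shows "finite {x. pi_rep d g (\<lambda>z. a * \<phi> z + b * \<psi> z) x \<noteq> a * pi_rep d g \<phi> x + b * pi_rep d g \<psi> x}"
proof (rule finite_subset)
  show "finite {x. g $ 2 $ 1 * x + g $ 1 $ 1 = 0}" using finite_moebius[OF g finite.emptyI] by simp
  have "pi_rep d g (\<lambda>z. a * \<phi> z + b * \<psi> z) x = a * pi_rep d g \<phi> x + b * pi_rep d g \<psi> x"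
    if "g $ 2 $ 1 * x + g $ 1 $ 1 \<noteq> 0" for x
    using that by (simp add: pi_rep_def Let_def scaleR_add_right)
  then show "{x. pi_rep d g (\<lambda>z. a * \<phi> z + b * \<psi> z) x \<noteq> a * pi_rep d g \<phi> x + b * pi_rep d g \<psi> x}
    \<subseteq> {x. g $ 2 $ 1 * x + g $ 1 $ 1 = 0}" by blast
qed

lemma M_T: "d > 0 \<Longrightarrow> f \<in> S_half_line d \<Longrightarrow> M_op d (T_op d f) = f"
  unfolding S_half_line_eq by (erule imageE) (simp add: M_T_emb)

text \<open>Linearity is not read off from the integral in \<open>M_op\<close>, which would require
  integrability of each integrand. Instead the right-hand side lies in S_d, its image under
  \<open>T_op\<close> agrees with the transformed left-hand side off a finite set, and
  \<open>M_op\<close> inverts \<open>T_op\<close> there.\<close>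

lemma R_plus_lin:
  assumes d: "d > 0" and g: "g \<in> SL2" and f: "f \<in> S_half_line d" and h: "h \<in> S_half_line d"
  shows "R_plus d g (\<lambda>x. a * f x + b * h x) = (\<lambda>x. a * R_plus d g f x + b * R_plus d g h x)"
proof -
  let ?R = "\<lambda>x. a * R_plus d g f x + b * R_plus d g h x"
  have R: "?R \<in> S_half_line d" by (intro S_half_line_lin R_plus_good(1) d g f h)
  have T1: "T_op d (\<lambda>x. a * f x + b * h x) = (\<lambda>z. a * T_op d f z + b * T_op d h z)"
    by (rule ext) (rule T_op_lin[OF f h])
  have T2: "T_op d ?R = (\<lambda>z. a * T_op d (R_plus d g f) z + b * T_op d (R_plus d g h) z)"
    by (rule ext) (intro T_op_lin R_plus_good(1) d g f h)
  have "finite {x. T_op d ?R x \<noteq> a * pi_rep d g (T_op d f) x + b * pi_rep d g (T_op d h) x}"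
    unfolding T2
    by (rule finite_subset[OF _ finite_UnI[OF R_plus_good(3)[OF d g f] R_plus_good(3)[OF d g h]]]) auto
  then have "finite {x. pi_rep d g (T_op d (\<lambda>x. a * f x + b * h x)) x \<noteq> T_op d ?R x}"
    unfolding T1 by (rule finite_neq_trans[OF pi_rep_lin_finite[OF g]])
  then have "R_plus d g (\<lambda>x. a * f x + b * h x) = M_op d (T_op d ?R)"
    unfolding R_plus_def[of d g "\<lambda>x. a * f x + b * h x"] by (rule M_op_cong_finite)
  also have "\<dots> = ?R" by (rule M_T[OF d R])
  finally show ?thesis .
qed

lemma Sd_add: "v \<in> Sd d \<Longrightarrow> w \<in> Sd d \<Longrightarrow> v + w \<in> Sd d"
proof (elim imageE)
  fix f g assume f: "v = abs_L2pos f" "f \<in> S_half_line d" and g: "w = abs_L2pos g" "g \<in> S_half_line d"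
  have "v + w = abs_L2pos (\<lambda>x. 1 * f x + 1 * g x)" unfolding f(1) g(1)
    by (simp add: abs_L2pos_add SQ_S_half_line[OF f(2)] SQ_S_half_line[OF g(2)])
  then show "v + w \<in> Sd d" by - (rule image_eqI, assumption, rule S_half_line_lin[OF f(2) g(2)])
qed

lemma Sd_scaleR: "v \<in> Sd d \<Longrightarrow> c *\<^sub>R v \<in> Sd d"
proof (elim imageE)
  fix f assume f: "v = abs_L2pos f" "f \<in> S_half_line d"
  have "c *\<^sub>R v = abs_L2pos (\<lambda>x. complex_of_real c * f x + 0 * f x)" unfolding f(1)
    by (simp add: abs_L2pos_scaleR[OF SQ_S_half_line[OF f(2)]] scaleR_conv_of_real)
  then show "c *\<^sub>R v \<in> Sd d" by - (rule image_eqI, assumption, rule S_half_line_lin[OF f(2) f(2)])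
qed

lemma closed_dense_Sd: "closed {v. P v} \<Longrightarrow> (\<And>v. v \<in> Sd d \<Longrightarrow> P v) \<Longrightarrow> P v"
proof -
  assume c: "closed {v. P v}" and P: "\<And>v. v \<in> Sd d \<Longrightarrow> P v"
  have "closure (Sd d) \<subseteq> {v. P v}" by (rule closure_minimal[OF _ c]) (use P in blast)
  then show "P v" unfolding density_Sd by blast
qed

lemma continuous_agree_Sd:
  fixes B C :: "L2pos \<Rightarrow> L2pos"
  assumes "continuous_on UNIV B" "continuous_on UNIV C" "\<And>v. v \<in> Sd d \<Longrightarrow> B v = C v"
  shows "B = C"
  by (rule ext, rule closed_dense_Sd[where d = d]) (intro closed_Collect_eq assms, rule assms)

section \<open>Extension to the Hilbert space\<close>

locale isometry_Sd =
  fixes d :: nat and A :: "(real \<Rightarrow> complex) \<Rightarrow> real \<Rightarrow> complex"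
  assumes mem: "f \<in> S_half_line d \<Longrightarrow> A f \<in> S_half_line d"
    and lin: "f \<in> S_half_line d \<Longrightarrow> g \<in> S_half_line d \<Longrightarrow> A (\<lambda>x. a * f x + b * g x) = (\<lambda>x. a * A f x + b * A g x)"
    and iso: "f \<in> S_half_line d \<Longrightarrow> norm (abs_L2pos (A f)) = norm (abs_L2pos f)"
begin

lemma dist_preserving:
  assumes f: "f \<in> S_half_line d" and g: "g \<in> S_half_line d"
  shows "dist (abs_L2pos (A f)) (abs_L2pos (A g)) = dist (abs_L2pos f) (abs_L2pos g)"
proof -
  have "norm (abs_L2pos (A (\<lambda>x. 1 * f x + (-1) * g x))) = norm (abs_L2pos (\<lambda>x. 1 * f x + (-1) * g x))"
    by (intro iso S_half_line_lin f g)
  then show ?thesis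
    unfolding lin[OF f g] by (simp add: dist_norm abs_L2pos_diff SQ_S_half_line[OF f] SQ_S_half_line[OF g]
        SQ_S_half_line[OF mem[OF f]] SQ_S_half_line[OF mem[OF g]])
qed

text \<open>Preservation of distances does two things: it makes the induced map on classes
  independent of the representative chosen by \<open>inv_into\<close>, and it makes that map
  uniformly continuous, so that it extends to the closure of S_d.\<close>

lemma extension_exists: "\<exists>B. continuous_on UNIV B \<and> (\<forall>f\<in>S_half_line d. B (abs_L2pos f) = abs_L2pos (A f))"
proof -
  define B0 where "B0 v = abs_L2pos (A (inv_into (S_half_line d) abs_L2pos v))" for v
  have B0: "B0 (abs_L2pos f) = abs_L2pos (A f)" if f: "f \<in> S_half_line d" for f
  proof -
    let ?f = "inv_into (S_half_line d) abs_L2pos (abs_L2pos f)"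
    have "?f \<in> S_half_line d" "abs_L2pos ?f = abs_L2pos f"
      by (rule inv_into_into[OF imageI[OF f]], rule f_inv_into_f[OF imageI[OF f]])
    then show ?thesis using dist_preserving[of ?f f] f by (simp add: B0_def)
  qed
  have "uniformly_continuous_on (Sd d) B0"
    unfolding uniformly_continuous_on_def
  proof (intro allI impI)
    fix e :: real assume "e > 0"
    moreover have "dist (B0 x') (B0 x) = dist x' x" if "x \<in> Sd d" "x' \<in> Sd d" for x x'
      using that by (elim imageE) (simp add: B0 dist_preserving)
    ultimately show "\<exists>da>0. \<forall>x\<in>Sd d. \<forall>x'\<in>Sd d. dist x' x < da \<longrightarrow> dist (B0 x') (B0 x) < e"
      by (intro exI[of _ e]) simp
  qed
  then obtain B where "uniformly_continuous_on (closure (Sd d)) B" "\<And>x. x \<in> Sd d \<Longrightarrow> B0 x = B x"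
    using uniformly_continuous_on_extension_on_closure by metis
  then show ?thesis
    unfolding density_Sd by (intro exI[of _ B] conjI ballI uniformly_continuous_imp_continuous) (simp_all add: B0[symmetric])
qed

abbreviation "B \<equiv> extend_to_L2 d A"

lemma extension: "continuous_on UNIV B" "f \<in> S_half_line d \<Longrightarrow> B (abs_L2pos f) = abs_L2pos (A f)"
proof -
  have "\<exists>!B. continuous_on UNIV B \<and> (\<forall>f\<in>S_half_line d. B (abs_L2pos f) = abs_L2pos (A f))"
  proof (rule ex_ex1I[OF extension_exists])
    fix B C :: "L2pos \<Rightarrow> L2pos"
    assume "continuous_on UNIV B \<and> (\<forall>f\<in>S_half_line d. B (abs_L2pos f) = abs_L2pos (A f))"
      "continuous_on UNIV C \<and> (\<forall>f\<in>S_half_line d. C (abs_L2pos f) = abs_L2pos (A f))"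
    then show "B = C" by (intro continuous_agree_Sd[of B C d]) auto
  qed
  from theI'[OF this] show "continuous_on UNIV B" "f \<in> S_half_line d \<Longrightarrow> B (abs_L2pos f) = abs_L2pos (A f)"
    unfolding extend_to_L2_def by blast+
qed

lemma extension_mem: "v \<in> Sd d \<Longrightarrow> B v \<in> Sd d"
  by (elim imageE) (simp add: extension(2) mem)

lemma extension_norm: "norm (B v) = norm v"
proof (rule closed_dense_Sd[where d = d and P = "\<lambda>v. norm (B v) = norm v"])
  show "closed {v. norm (B v) = norm v}"
    by (intro closed_Collect_eq continuous_intros extension(1))
qed (auto simp: extension(2) iso)

lemma extension_add: "B (v + w) = B v + B w"
proof -
  have 1: "B (v + w) = B v + B w" if v: "v \<in> Sd d" for v w
  proof (rule closed_dense_Sd[where d = d and P = "\<lambda>w. B (v + w) = B v + B w"])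
    show "closed {w. B (v + w) = B v + B w}"
      by (intro closed_Collect_eq continuous_intros continuous_on_compose2[OF extension(1)] extension(1)) auto
    fix w assume "w \<in> Sd d"
    with v obtain f g where f: "v = abs_L2pos f" "f \<in> S_half_line d" and g: "w = abs_L2pos g" "g \<in> S_half_line d"
      by (elim imageE) (rule that; assumption)
    have "v + w = abs_L2pos (\<lambda>x. 1 * f x + 1 * g x)" unfolding f(1) g(1)
      by (simp add: abs_L2pos_add SQ_S_half_line[OF f(2)] SQ_S_half_line[OF g(2)])
    then have "B (v + w) = abs_L2pos (\<lambda>x. 1 * A f x + 1 * A g x)"
      by (simp only: extension(2)[OF S_half_line_lin[OF f(2) g(2)]] lin[OF f(2) g(2)])
    also have "\<dots> = B v + B w" unfolding f(1) g(1) extension(2)[OF f(2)] extension(2)[OF g(2)]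
      by (simp add: abs_L2pos_add SQ_S_half_line[OF mem[OF f(2)]] SQ_S_half_line[OF mem[OF g(2)]])
    finally show "B (v + w) = B v + B w" .
  qed
  show ?thesis
  proof (rule closed_dense_Sd[where d = d and P = "\<lambda>v. B (v + w) = B v + B w"])
    show "closed {v. B (v + w) = B v + B w}"
      by (intro closed_Collect_eq continuous_intros continuous_on_compose2[OF extension(1)] extension(1)) auto
  qed (rule 1)
qed

lemma extension_scaleR: "B (c *\<^sub>R v) = c *\<^sub>R B v"
proof (rule closed_dense_Sd[where d = d and P = "\<lambda>v. B (c *\<^sub>R v) = c *\<^sub>R B v"])
  show "closed {v. B (c *\<^sub>R v) = c *\<^sub>R B v}"
    by (intro closed_Collect_eq continuous_intros continuous_on_compose2[OF extension(1)] extension(1)) auto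
  fix v assume "v \<in> Sd d"
  then obtain f where f: "v = abs_L2pos f" "f \<in> S_half_line d" by (elim imageE)
  have "c *\<^sub>R v = abs_L2pos (\<lambda>x. complex_of_real c * f x + 0 * f x)" unfolding f(1)
    by (simp add: abs_L2pos_scaleR[OF SQ_S_half_line[OF f(2)]] scaleR_conv_of_real)
  then have "B (c *\<^sub>R v) = abs_L2pos (\<lambda>x. complex_of_real c * A f x + 0 * A f x)"
    by (simp only: extension(2)[OF S_half_line_lin[OF f(2) f(2)]] lin[OF f(2) f(2)])
  also have "\<dots> = c *\<^sub>R B v" unfolding f(1) extension(2)[OF f(2)]
    by (simp add: abs_L2pos_scaleR[OF SQ_S_half_line[OF mem[OF f(2)]]] scaleR_conv_of_real)
  finally show "B (c *\<^sub>R v) = c *\<^sub>R B v" .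
qed

lemma extension_linear: "linear B"
  by (rule linearI) (rule extension_add extension_scaleR)+

end

lemma isometry_R_plus: "d > 0 \<Longrightarrow> g \<in> SL2 \<Longrightarrow> isometry_Sd d (R_plus d g)"
  by standard (intro R_plus_good R_plus_lin | assumption)+

lemma R_plus_L2_props:
  assumes d: "d > 0" and g: "g \<in> SL2"
  shows "continuous_on UNIV (R_plus_L2 d g)" "linear (R_plus_L2 d g)" "norm (R_plus_L2 d g v) = norm v"
    "v \<in> Sd d \<Longrightarrow> R_plus_L2 d g v \<in> Sd d"
    "f \<in> S_half_line d \<Longrightarrow> R_plus_L2 d g (abs_L2pos f) = abs_L2pos (R_plus d g f)"
proof -
  interpret isometry_Sd d "R_plus d g" by (rule isometry_R_plus[OF d g])
  show "continuous_on UNIV (R_plus_L2 d g)" "linear (R_plus_L2 d g)" "norm (R_plus_L2 d g v) = norm v"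
    "v \<in> Sd d \<Longrightarrow> R_plus_L2 d g v \<in> Sd d"
    "f \<in> S_half_line d \<Longrightarrow> R_plus_L2 d g (abs_L2pos f) = abs_L2pos (R_plus d g f)"
    unfolding R_plus_L2_def by (fact extension extension_linear extension_norm extension_mem)+
qed

lemma R_plus_L2_mult:
  assumes d: "d > 0" and g: "g \<in> SL2" and h: "h \<in> SL2"
  shows "R_plus_L2 d (g ** h) v = R_plus_L2 d g (R_plus_L2 d h v)"
proof -
  have "R_plus_L2 d (g ** h) = (\<lambda>v. R_plus_L2 d g (R_plus_L2 d h v))"
  proof (rule continuous_agree_Sd[where d = d])
    show "continuous_on UNIV (R_plus_L2 d (g ** h))" by (rule R_plus_L2_props[OF d SL2_mult[OF g h]])
    show "continuous_on UNIV (\<lambda>v. R_plus_L2 d g (R_plus_L2 d h v))"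
      by (rule continuous_on_compose2[OF R_plus_L2_props(1)[OF d g] R_plus_L2_props(1)[OF d h]]) simp
    fix v assume "v \<in> Sd d"
    then obtain f where f: "v = abs_L2pos f" "f \<in> S_half_line d" by (elim imageE)
    show "R_plus_L2 d (g ** h) v = R_plus_L2 d g (R_plus_L2 d h v)"
      unfolding f(1) R_plus_L2_props(5)[OF d SL2_mult[OF g h] f(2)] R_plus_L2_props(5)[OF d h f(2)]
        R_plus_L2_props(5)[OF d g R_plus_good(1)[OF d h f(2)]] R_plus_mult[OF d g h f(2)] ..
  qed
  then show ?thesis by simp
qed

text \<open>The character exp (i c x), kept in the form exp (- s x) with s = - i c so that the
  results on exponential multipliers apply to it literally.\<close>

definition phase :: "real \<Rightarrow> real \<Rightarrow> complex" where
  "phase c x = exp (- (- \<i> * complex_of_real c) * complex_of_real x)"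

lemma norm_phase [simp]: "cmod (phase c x) = 1"
  by (simp add: phase_def)

lemma measurable_phase: "f \<in> borel_measurable HL \<Longrightarrow> (\<lambda>x. phase c x * f x) \<in> borel_measurable HL"
  unfolding phase_def by (intro borel_measurable_times measurable_HL_exp)

lemma SQ_phase: "SQ f \<Longrightarrow> SQ (\<lambda>x. phase c x * f x)"
  by (rule SQ_bound[of f _ 1]) (simp_all add: norm_mult measurable_phase square_integrable_def[of _ f])

lemma norm_abs_phase: "SQ f \<Longrightarrow> norm (abs_L2pos (\<lambda>x. phase c x * f x)) = norm (abs_L2pos f)"
  by (rule norm_abs_L2pos_unimodular) (simp_all add: norm_mult measurable_phase square_integrable_def[of _ f])

text \<open>Multiplication by the phase is defined on all of L^2 and preserves distances; agreeing
  with the operator on a dense set, it is its extension. Through this formula smoothness of an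
  arbitrary vector becomes a statement about functions.\<close>

lemma R_plus_L2_nmat:
  assumes d: "d > 0" and f: "SQ f"
  shows "R_plus_L2 d (nmat c) (abs_L2pos f) = abs_L2pos (\<lambda>x. phase c x * f x)"
proof -
  define m where "m v = abs_L2pos (\<lambda>x. phase c x * rep_L2pos v x)" for v
  have m: "m (abs_L2pos h) = abs_L2pos (\<lambda>x. phase c x * h x)" if h: "SQ h" for h
  proof -
    have "AE x in HL. rep_L2pos (abs_L2pos h) x = h x"
      using abs_L2pos_eq_iff[OF rep_L2pos(1)[of "abs_L2pos h"] h] by (simp add: rep_L2pos(2))
    then have "AE x in HL. phase c x * rep_L2pos (abs_L2pos h) x = phase c x * h x"
      by eventually_elim simp
    then show ?thesis
      unfolding m_def by (simp add: abs_L2pos_eq_iff SQ_phase rep_L2pos h)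
  qed
  have dm: "dist (m v) (m w) = dist v w" for v w
  proof -
    have v: "v = abs_L2pos (rep_L2pos v)" "w = abs_L2pos (rep_L2pos w)" by (simp_all only: rep_L2pos)
    have "m v - m w = abs_L2pos (\<lambda>x. phase c x * (rep_L2pos v x - rep_L2pos w x))"
      unfolding m_def right_diff_distrib by (intro abs_L2pos_diff SQ_phase rep_L2pos)
    then have "dist (m v) (m w) = norm (abs_L2pos (\<lambda>x. rep_L2pos v x - rep_L2pos w x))"
      by (simp only: dist_norm norm_abs_phase[OF SQ_diff[OF rep_L2pos(1) rep_L2pos(1)]])
    also have "\<dots> = dist v w"
      using abs_L2pos_diff[OF rep_L2pos(1)[of v] rep_L2pos(1)[of w]] by (simp only: dist_norm rep_L2pos)
    finally show ?thesis .
  qed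
  have "R_plus_L2 d (nmat c) = m"
  proof (rule continuous_agree_Sd[where d = d])
    show "continuous_on UNIV (R_plus_L2 d (nmat c))" by (rule R_plus_L2_props[OF d]) simp
    show "continuous_on UNIV m" unfolding continuous_on_iff by (auto simp: dm)
    fix v assume "v \<in> Sd d"
    then obtain f where f: "v = abs_L2pos f" "f \<in> S_half_line d" by (elim imageE)
    then obtain f1 where f1: "f = emb d f1" "f1 \<in> schwartz_half_line" unfolding S_half_line_eq by (elim imageE)
    have "R_plus d (nmat c) f = (\<lambda>x. phase c x * f x)"
      unfolding f1(1) R_plus_nmat[OF d f1(2)] phase_def by (auto simp: emb_def)
    then show "R_plus_L2 d (nmat c) v = m v"
      using f R_plus_L2_props(5)[OF d _ f(2), of "nmat c"] by (simp add: m[OF SQ_S_half_line[OF f(2)]])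
  qed
  then show ?thesis by (simp add: m f)
qed

section \<open>Smooth orbit maps\<close>

lemma C_k_on_SucI:
  assumes "\<And>x. x \<in> U \<Longrightarrow> (F has_derivative D x) (at x)" "\<And>v. C_k_on k U (\<lambda>x. frechet_derivative F (at x) v)"
  shows "C_k_on (Suc k) U F"
  using assms by (auto simp: differentiable_def)

lemma C_k_on_cong:
  assumes "open U" "\<And>x. x \<in> U \<Longrightarrow> F x = G x" "C_k_on k U F"
  shows "C_k_on k U G"
  using assms(2,3)
proof (induction k arbitrary: F G)
  case 0
  then show ?case by (metis C_k_on.simps(1) continuous_on_cong)
next
  case (Suc k)
  have d: "(F has_derivative frechet_derivative F (at x)) (at x)" if "x \<in> U" for x
    using Suc.prems(2) that by (simp add: frechet_derivative_works)
  have g: "(G has_derivative frechet_derivative F (at x)) (at x)" if "x \<in> U" for x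
    by (rule has_derivative_transform_within_open[OF d[OF that] assms(1) that Suc.prems(1)])
  show ?case
  proof (rule C_k_on_SucI[OF g])
    fix v
    show "C_k_on k U (\<lambda>x. frechet_derivative G (at x) v)"
    proof (rule Suc.IH)
      show "frechet_derivative F (at x) v = frechet_derivative G (at x) v" if "x \<in> U" for x
        using frechet_derivative_at[OF g[OF that]] by simp
      show "C_k_on k U (\<lambda>x. frechet_derivative F (at x) v)" using Suc.prems(2) by simp
    qed
  qed
qed

text \<open>The definition refers to \<open>frechet_derivative\<close>, which is a choice.
  Uniqueness of derivatives lets an explicit derivative \<open>D\<close> replace it on the open set,
  and \<open>C_k_on_cong\<close> transfers the remaining differentiability.\<close>

lemma C_k_on_SucI':
  assumes U: "open U" and der: "\<And>x. x \<in> U \<Longrightarrow> (F has_derivative D x) (at x)" and C: "\<And>v. C_k_on k U (\<lambda>x. D x v)"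
  shows "C_k_on (Suc k) U F"
  by (rule C_k_on_SucI[OF der], assumption, rule C_k_on_cong[OF U _ C], drule frechet_derivative_at[OF der], simp)

lemma C_k_on_Suc_D:
  "C_k_on (Suc k) U F \<Longrightarrow> x \<in> U \<Longrightarrow> (F has_derivative frechet_derivative F (at x)) (at x)"
  by (simp add: frechet_derivative_works)

lemma C_k_on_Suc: "C_k_on (Suc k) U F \<Longrightarrow> C_k_on k U F"
proof (induction k arbitrary: F)
  case 0
  then show ?case by (auto intro!: differentiable_imp_continuous_on differentiable_at_imp_differentiable_on)
next
  case (Suc k)
  have "C_k_on k U (\<lambda>x. frechet_derivative F (at x) v)" for v
    by (rule Suc.IH) (use Suc.prems in simp)
  then show ?case using Suc.prems by simp
qed

lemma C_k_on_const: "open U \<Longrightarrow> C_k_on k U (\<lambda>_. c)"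
proof (induction k arbitrary: c)
  case (Suc k)
  show ?case by (rule C_k_on_SucI'[OF Suc.prems has_derivative_const Suc.IH[OF Suc.prems]])
qed simp

lemma C_k_on_bounded_linear:
  assumes "open U" "bounded_linear L" shows "C_k_on k U L"
proof (cases k)
  case 0
  then show ?thesis using assms by (simp add: linear_continuous_on)
next
  case (Suc n)
  show ?thesis unfolding Suc
    by (rule C_k_on_SucI'[OF assms(1) bounded_linear_imp_has_derivative[OF assms(2)] C_k_on_const[OF assms(1)]])
qed

lemma C_k_on_add:
  assumes U: "open U"
  shows "C_k_on k U F \<Longrightarrow> C_k_on k U G \<Longrightarrow> C_k_on k U (\<lambda>x. F x + G x)"
proof (induction k arbitrary: F G)
  case 0
  then show ?case by (simp add: continuous_on_add)
next
  case (Suc k)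
  show ?case
    by (rule C_k_on_SucI'[OF U has_derivative_add[OF C_k_on_Suc_D[OF Suc.prems(1)] C_k_on_Suc_D[OF Suc.prems(2)]] Suc.IH])
      (use Suc.prems in simp_all)
qed

lemma C_k_on_scaleR:
  fixes F :: "'a::euclidean_space \<Rightarrow> 'b::real_normed_vector"
  assumes U: "open U"
  shows "C_k_on k U f \<Longrightarrow> C_k_on k U F \<Longrightarrow> C_k_on k U (\<lambda>x. f x *\<^sub>R F x)"
proof (induction k arbitrary: f F)
  case 0
  then show ?case by (simp add: continuous_on_scaleR)
next
  case (Suc k)
  have C: "C_k_on k U (\<lambda>x. f x *\<^sub>R frechet_derivative F (at x) v + frechet_derivative f (at x) v *\<^sub>R F x)" for v
  proof -
    have "C_k_on k U (\<lambda>x. frechet_derivative F (at x) v)" "C_k_on k U (\<lambda>x. frechet_derivative f (at x) v)"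
      using Suc.prems by simp_all
    then show ?thesis
      by (rule C_k_on_add[OF U Suc.IH[OF C_k_on_Suc[OF Suc.prems(1)]] Suc.IH[OF _ C_k_on_Suc[OF Suc.prems(2)]]])
  qed
  show ?case
    by (rule C_k_on_SucI'[OF U has_derivative_scaleR[OF C_k_on_Suc_D[OF Suc.prems(1)] C_k_on_Suc_D[OF Suc.prems(2)]] C])
qed

lemma C_k_on_mult:
  fixes f g :: "'a::euclidean_space \<Rightarrow> real"
  shows "open U \<Longrightarrow> C_k_on k U f \<Longrightarrow> C_k_on k U g \<Longrightarrow> C_k_on k U (\<lambda>x. f x * g x)"
  using C_k_on_scaleR[of U k f g] by simp

lemma C_k_on_inverse:
  fixes f :: "'a::euclidean_space \<Rightarrow> real"
  assumes U: "open U" and nz: "\<And>x. x \<in> U \<Longrightarrow> f x \<noteq> 0"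
  shows "C_k_on k U f \<Longrightarrow> C_k_on k U (\<lambda>x. inverse (f x))"
proof (induction k)
  case 0
  then show ?case using nz by (auto intro!: continuous_on_inverse)
next
  case (Suc k)
  have i: "C_k_on k U (\<lambda>x. inverse (f x))" by (rule Suc.IH[OF C_k_on_Suc[OF Suc.prems]])
  have C: "C_k_on k U (\<lambda>x. (- 1) * (inverse (f x) * frechet_derivative f (at x) v * inverse (f x)))" for v
    by (intro C_k_on_mult[OF U] C_k_on_const[OF U] i) (use Suc.prems in simp)
  show ?case
  proof (rule C_k_on_SucI'[OF U _ C])
    fix x assume x: "x \<in> U"
    show "((\<lambda>x. inverse (f x)) has_derivative
      (\<lambda>v. (- 1) * (inverse (f x) * frechet_derivative f (at x) v * inverse (f x)))) (at x)"
      using Deriv.has_derivative_inverse[OF nz[OF x] C_k_on_Suc_D[OF Suc.prems x]] by simp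
  qed
qed

text \<open>The operators \<open>P t\<close> are only strongly continuous, but being isometric they preserve the error
  term of \<open>u\<close>.\<close>

lemma isometry_product_derivative:
  fixes P :: "'p::euclidean_space \<Rightarrow> 'b::real_normed_vector \<Rightarrow> 'b"
  assumes lin: "\<And>t. linear (P t)" and iso: "\<And>t v. norm (P t v) = norm v"
    and u: "(u has_derivative u') (at t0)"
    and Pu: "((\<lambda>t. P t (u t0)) has_derivative D) (at t0)"
    and cont: "\<And>h. isCont (\<lambda>t. P t (u' h)) t0"
  shows "((\<lambda>t. P t (u t)) has_derivative (\<lambda>h. D h + P t0 (u' h))) (at t0)"
proof -
  have lu: "bounded_linear u'" and lD: "bounded_linear D" using u Pu by (auto dest: has_derivative_bounded_linear)
  interpret u': bounded_linear u' by (rule lu)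
  have bP: "bounded_linear (P t0)"
    by (rule bounded_linear_intro[where K = 1]) (simp_all add: linear_add[OF lin] linear_scale[OF lin] iso)
  \<comment> \<open>The parameter space is finite-dimensional, so strong continuity on the finitely
    many vectors \<open>u' b\<close> controls \<open>P t (u' h) - P t0 (u' h)\<close> uniformly
    relative to the norm of \<open>h\<close>.\<close>
  define E where "E t = (\<Sum>b\<in>Basis. norm (P t (u' b) - P t0 (u' b)))" for t
  have E: "(E \<longlongrightarrow> 0) (at t0)"
  proof -
    have "((\<lambda>t. norm (P t (u' b) - P t0 (u' b))) \<longlongrightarrow> 0) (at t0)" for b
      using cont[of b] unfolding isCont_def by (intro tendsto_norm_zero) (simp add: LIM_zero_iff)
    then show ?thesis unfolding E_def by (intro tendsto_null_sum)
  qed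
  have Ebd: "norm (P t (u' h) - P t0 (u' h)) \<le> norm h * E t" for t h
  proof -
    have h: "u' h = (\<Sum>b\<in>Basis. (h \<bullet> b) *\<^sub>R u' b)"
      by (subst euclidean_representation[symmetric, of h]) (simp only: u'.sum u'.scaleR)
    have "P s (u' h) = (\<Sum>b\<in>Basis. (h \<bullet> b) *\<^sub>R P s (u' b))" for s
      unfolding h by (simp add: linear_sum[OF lin] linear_scale[OF lin])
    then have "P t (u' h) - P t0 (u' h) = (\<Sum>b\<in>Basis. (h \<bullet> b) *\<^sub>R (P t (u' b) - P t0 (u' b)))"
      by (simp add: sum_subtractf scaleR_diff_right)
    also have "norm \<dots> \<le> (\<Sum>b\<in>Basis. norm h * norm (P t (u' b) - P t0 (u' b)))"
      by (intro sum_norm_le) (simp add: Basis_le_norm mult_right_mono)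
    finally show ?thesis by (simp add: E_def sum_distrib_left)
  qed
  show ?thesis
    unfolding has_derivative_at_alt
  proof (intro conjI allI impI)
    show "bounded_linear (\<lambda>h. D h + P t0 (u' h))"
      by (intro bounded_linear_add lD bounded_linear_compose[OF bP lu])
    fix e :: real assume e: "e > 0"
    then have e3: "e / 3 > 0" by simp
    obtain d1 where d1: "d1 > 0" "\<And>t. norm (t - t0) < d1 \<Longrightarrow> norm (u t - u t0 - u' (t - t0)) \<le> e / 3 * norm (t - t0)"
      using u e3 unfolding has_derivative_at_alt by blast
    obtain d2 where d2: "d2 > 0" "\<And>t. norm (t - t0) < d2 \<Longrightarrow> norm (P t (u t0) - P t0 (u t0) - D (t - t0)) \<le> e / 3 * norm (t - t0)"
      using Pu e3 unfolding has_derivative_at_alt by blast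
    obtain d3 where d3: "d3 > 0" "\<And>t. t \<noteq> t0 \<Longrightarrow> dist t t0 < d3 \<Longrightarrow> dist (E t) 0 < e / 3"
      using E e3 unfolding Lim_at by (metis zero_less_dist_iff)
    show "\<exists>d>0. \<forall>t. norm (t - t0) < d \<longrightarrow> norm (P t (u t) - P t0 (u t0) - (D (t - t0) + P t0 (u' (t - t0)))) \<le> e * norm (t - t0)"
    proof (intro exI[of _ "min d1 (min d2 d3)"] conjI allI impI)
      show "0 < min d1 (min d2 d3)" using d1 d2 d3 by simp
      fix t assume t: "norm (t - t0) < min d1 (min d2 d3)"
      let ?a = "P t (u t - u t0 - u' (t - t0))"
      let ?b = "P t (u t0) - P t0 (u t0) - D (t - t0)"
      let ?c = "P t (u' (t - t0)) - P t0 (u' (t - t0))"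
      have "P t (u t) - P t0 (u t0) - (D (t - t0) + P t0 (u' (t - t0))) = ?a + ?b + ?c"
        by (simp add: linear_diff[OF lin])
      also have "norm \<dots> \<le> norm ?a + norm ?b + norm ?c"
        by (intro order_trans[OF norm_triangle_ineq] add_right_mono norm_triangle_ineq)
      also have "norm ?a \<le> e / 3 * norm (t - t0)" unfolding iso using d1(2) t by simp
      also have "norm ?b \<le> e / 3 * norm (t - t0)" using d2(2) t by simp
      also have "norm ?c \<le> e / 3 * norm (t - t0)"
      proof (cases "t = t0")
        case False
        have "norm ?c \<le> norm (t - t0) * E t" by (rule Ebd)
        also have "\<dots> \<le> norm (t - t0) * (e / 3)"
          using d3(2)[OF False] t by (intro mult_left_mono) (simp_all add: dist_norm)
        finally show ?thesis by (simp only: mult.commute)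
      qed simp
      finally show "norm (P t (u t) - P t0 (u t0) - (D (t - t0) + P t0 (u' (t - t0)))) \<le> e * norm (t - t0)"
        by simp
    qed
  qed
qed

text \<open>A retraction of the matrices of positive determinant onto $SL(2,\mathbb{R})$; it extends orbit maps to
  an open set of matrices.\<close>

definition unimod :: "real ^ 2 ^ 2 \<Rightarrow> real ^ 2 ^ 2" where
  "unimod g = (1 / sqrt (det g)) *\<^sub>R g"

definition adj2 :: "real ^ 2 ^ 2 \<Rightarrow> real ^ 2 ^ 2" where
  "adj2 g = mat2 (g $ 2 $ 2) (- g $ 1 $ 2) (- g $ 2 $ 1) (g $ 1 $ 1)"

lemma unimod_nth: "unimod g $ i $ j = g $ i $ j / sqrt (det g)"
  by (simp add: unimod_def)

lemma unimod_SL2: "det g > 0 \<Longrightarrow> unimod g \<in> SL2"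
  by (simp add: SL2_def det_2 unimod_nth diff_divide_distrib[symmetric])

lemma unimod_mult: "det g > 0 \<Longrightarrow> det h > 0 \<Longrightarrow> unimod g ** unimod h = unimod (g ** h)"
  by (simp add: mat2_eq_iff mat2_mult_nth unimod_nth det_mul real_sqrt_mult add_divide_distrib)

lemma unimod_id: "g \<in> SL2 \<Longrightarrow> unimod g = g"
  by (simp add: SL2_def unimod_def)

lemma mat_1_mat2: "mat 1 = mat2 1 0 0 1"
  by (simp add: mat2_eq_iff mat_def)

lemma adj2_mult: "adj2 g ** g = det g *\<^sub>R mat 1" "g ** adj2 g = det g *\<^sub>R mat 1"
  by (simp_all add: mat2_eq_iff mat2_mult_nth adj2_def det_2 mat_1_mat2)

lemma det_scaleR_2: "det (c *\<^sub>R g) = c\<^sup>2 * det g" for g :: "real ^ 2 ^ 2"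
  by (simp add: det_2 power2_eq_square algebra_simps)

lemma det_adj2: "det (adj2 g) = det g"
  by (simp add: adj2_def det_2)

lemma continuous_on_det_2: "continuous_on UNIV (det :: real ^ 2 ^ 2 \<Rightarrow> real)"
  unfolding det_2[abs_def] by (intro continuous_intros)

lemma open_det_pos: "open {g :: real ^ 2 ^ 2. det g > 0}"
  by (intro open_Collect_less continuous_on_det_2 continuous_on_const)

section \<open>Orbit maps of an isometric representation with an invariant subspace\<close>

locale sl2_rep =
  fixes R :: "real ^ 2 ^ 2 \<Rightarrow> 'b::real_normed_vector \<Rightarrow> 'b" and X :: "'b set"
  assumes lin: "g \<in> SL2 \<Longrightarrow> linear (R g)" and iso: "g \<in> SL2 \<Longrightarrow> norm (R g v) = norm v"
    and mult: "g \<in> SL2 \<Longrightarrow> h \<in> SL2 \<Longrightarrow> R (g ** h) v = R g (R h v)"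
    and sub: "subspace X" and inv: "g \<in> SL2 \<Longrightarrow> v \<in> X \<Longrightarrow> R g v \<in> X"
    and der: "v \<in> X \<Longrightarrow> \<exists>w\<in>X. ((\<lambda>c. R (nmat c) v) has_vector_derivative w) (at 0)"
begin

lemma bounded_linear_R: "g \<in> SL2 \<Longrightarrow> bounded_linear (R g)"
  by (rule bounded_linear_intro[where K = 1]) (simp_all add: linear_add[OF lin] linear_scale[OF lin] iso)

text \<open>\<open>R (mat 1)\<close> is idempotent by \<open>mult\<close> and injective by
  \<open>iso\<close>, hence the identity.\<close>

lemma one: "R (mat 1) v = v"
proof -
  have I: "mat 1 \<in> SL2" by (simp add: SL2_def)
  have "R (mat 1) (R (mat 1) v - v) = 0"
    using mult[OF I I, of v] by (simp add: linear_diff[OF lin[OF I]])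
  then show ?thesis using iso[OF I, of "R (mat 1) v - v"] by simp
qed

text \<open>The locale assumes a derivative at 0 only. Writing \<open>A ** nmat c ** B\<close> as
  \<open>A ** nmat c0\<close> times \<open>nmat (c - c0) ** B\<close> moves it to any base point and
  to any translate, and invariance keeps the result in \<open>X\<close>.\<close>

lemma curve_derivative:
  assumes v: "v \<in> X" and A: "A \<in> SL2" and B: "B \<in> SL2"
  shows "\<exists>w\<in>X. ((\<lambda>c. R (A ** nmat c ** B) v) has_vector_derivative w) (at c0)"
proof -
  have n: "nmat c \<in> SL2" for c by simp
  obtain w where w: "w \<in> X" "((\<lambda>c. R (nmat c) (R B v)) has_vector_derivative w) (at 0)"
    using der[OF inv[OF B v]] by blast
  have An: "A ** nmat c0 \<in> SL2" by (rule SL2_mult[OF A n])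
  have "((\<lambda>c. R (nmat (c - c0)) (R B v)) has_vector_derivative w) (at c0)"
  proof -
    have d: "((\<lambda>c. c - c0) has_vector_derivative 1 - 0) (at c0)"
      by (intro has_vector_derivative_diff has_vector_derivative_id has_vector_derivative_const)
    have "((\<lambda>c. R (nmat c) (R B v)) has_vector_derivative w) (at (c0 - c0))" using w(2) by simp
    from vector_diff_chain_at[OF d this] show ?thesis by (simp add: o_def)
  qed
  from bounded_linear.has_vector_derivative[OF bounded_linear_R[OF An] this]
  have "((\<lambda>c. R (A ** nmat c0) (R (nmat (c - c0)) (R B v))) has_vector_derivative R (A ** nmat c0) w) (at c0)" .
  moreover have "R (A ** nmat c0) (R (nmat (c - c0)) (R B v)) = R (A ** nmat c ** B) v" for c
  proof -
    have "A ** nmat c ** B = (A ** nmat c0) ** (nmat (c - c0) ** B)"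
      by (simp add: mat2_eq_iff mat2_mult_nth algebra_simps)
    then show ?thesis by (simp only: mult[OF An SL2_mult[OF n B]] mult[OF n B])
  qed
  ultimately show ?thesis using inv[OF An w(1)] by auto
qed

lemma param_derivative:
  fixes a :: "'p::euclidean_space \<Rightarrow> real"
  assumes v: "v \<in> X" and A: "A \<in> SL2" and B: "B \<in> SL2" and a: "(a has_derivative a') (at t0)"
  shows "\<exists>w\<in>X. ((\<lambda>t. R (A ** nmat (a t) ** B) v) has_derivative (\<lambda>h. a' h *\<^sub>R w)) (at t0)"
proof -
  obtain w where w: "w \<in> X" "((\<lambda>c. R (A ** nmat c ** B) v) has_vector_derivative w) (at (a t0))"
    using curve_derivative[OF v A B] by blast
  from has_derivative_compose[OF a this(2)[unfolded has_vector_derivative_def]] w(1)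
  show ?thesis by blast
qed

text \<open>Premise and conclusion have the same shape, a map whose value and derivatives at the
  base point lie in \<open>X\<close>, so the rule can be applied factor by factor to a product of
  unipotents.\<close>

lemma product_param_derivative:
  fixes a :: "'p::euclidean_space \<Rightarrow> real"
  assumes A: "A \<in> SL2" and B: "B \<in> SL2" and a: "(a has_derivative a') (at t0)"
    and ut0: "u t0 \<in> X" and u: "(u has_derivative u') (at t0)" and u': "\<And>h. u' h \<in> X"
  shows "\<exists>w\<in>X. ((\<lambda>t. R (A ** nmat (a t) ** B) (u t)) has_derivative (\<lambda>h. a' h *\<^sub>R w + R (A ** nmat (a t0) ** B) (u' h))) (at t0)"
proof -
  have S: "A ** nmat c ** B \<in> SL2" for c by (intro SL2_mult A B) simp
  obtain w where w: "w \<in> X" "((\<lambda>t. R (A ** nmat (a t) ** B) (u t0)) has_derivative (\<lambda>h. a' h *\<^sub>R w)) (at t0)"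
    using param_derivative[OF ut0 A B a] by blast
  have c: "isCont (\<lambda>t. R (A ** nmat (a t) ** B) (u' h)) t0" for h
    using param_derivative[OF u' A B a, of h] by (blast intro: has_derivative_continuous)
  from isometry_product_derivative[of "\<lambda>t. R (A ** nmat (a t) ** B)", OF lin[OF S] iso[OF S] u w(2) c] w(1)
  show ?thesis by blast
qed

end

lemma has_derivative_entry: "((\<lambda>M :: real ^ 'n ^ 'm. M $ i $ j) has_derivative (\<lambda>h. h $ i $ j)) F"
  by (intro bounded_linear_imp_has_derivative bounded_linear_compose[OF bounded_linear_vec_nth bounded_linear_vec_nth])

lemma has_derivative_exI: "(f has_derivative D) F \<Longrightarrow> \<exists>D. (f has_derivative D) F"
  by blast

lemma has_derivative_sqrt_det:
  "\<exists>q'. ((\<lambda>M :: real ^ 2 ^ 2. sqrt (det M)) has_derivative q') (at (mat 1))"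
proof -
  note e = has_derivative_entry[where 'n = 2 and 'm = 2 and F = "at (mat 1)"]
  have "\<exists>D. ((\<lambda>M :: real ^ 2 ^ 2. det M) has_derivative D) (at (mat 1))"
    unfolding det_2
    using has_derivative_diff[OF has_derivative_mult[OF e[of 1 1] e[of 2 2]] has_derivative_mult[OF e[of 1 2] e[of 2 1]]]
    by (rule has_derivative_exI)
  then obtain D where D: "((\<lambda>M :: real ^ 2 ^ 2. det M) has_derivative D) (at (mat 1))" by blast
  have "(sqrt has_derivative (*) (inverse (sqrt 1) / 2)) (at (det (mat 1 :: real ^ 2 ^ 2)))"
    using DERIV_real_sqrt[of 1] by (simp add: has_field_derivative_def)
  from has_derivative_compose[OF D this] show ?thesis by blast
qed

text \<open>Bruhat coordinates of \<open>unimod M ** wmat\<close>, in which the lower left entry does not vanish near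
  \<open>M = mat 1\<close>.\<close>

definition bru_a :: "real ^ 2 ^ 2 \<Rightarrow> real" where "bru_a M = (M $ 1 $ 2 - sqrt (det M)) / M $ 2 $ 2"
definition bru_b :: "real ^ 2 ^ 2 \<Rightarrow> real" where "bru_b M = - (M $ 2 $ 2 / sqrt (det M))"
definition bru_c :: "real ^ 2 ^ 2 \<Rightarrow> real" where "bru_c M = (- M $ 2 $ 1 - sqrt (det M)) / M $ 2 $ 2"

lemma bru_derivatives:
  obtains a' b' c' where "(bru_a has_derivative a') (at (mat 1))" "(bru_b has_derivative b') (at (mat 1))"
    "(bru_c has_derivative c') (at (mat 1))"
proof -
  obtain q' where q: "((\<lambda>M :: real ^ 2 ^ 2. sqrt (det M)) has_derivative q') (at (mat 1))"
    using has_derivative_sqrt_det by blast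
  note e = has_derivative_entry[where 'n = 2 and 'm = 2 and F = "at (mat 1)"]
  have nz: "(mat 1 :: real ^ 2 ^ 2) $ 2 $ 2 \<noteq> 0" "sqrt (det (mat 1 :: real ^ 2 ^ 2)) \<noteq> 0"
    by (simp add: mat_def, simp)
  have "\<exists>a'. (bru_a has_derivative a') (at (mat 1))"
    unfolding bru_a_def[abs_def] using has_derivative_divide[OF has_derivative_diff[OF e[of 1 2] q] e[of 2 2] nz(1)] by (rule has_derivative_exI)
  moreover have "\<exists>b'. (bru_b has_derivative b') (at (mat 1))"
    unfolding bru_b_def[abs_def] using has_derivative_minus[OF has_derivative_divide[OF e[of 2 2] q nz(2)]] by (rule has_derivative_exI)
  moreover have "\<exists>c'. (bru_c has_derivative c') (at (mat 1))"
    unfolding bru_c_def[abs_def]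
    using has_derivative_divide[OF has_derivative_diff[OF has_derivative_minus[OF e[of 2 1]] q] e[of 2 2] nz(1)] by (rule has_derivative_exI)
  ultimately show ?thesis using that by (elim exE)
qed

abbreviation wmat3 :: "real ^ 2 ^ 2" where "wmat3 \<equiv> wmat ** wmat ** wmat"

lemma wmat3: "wmat3 = mat2 0 1 (-1) 0" "wmat ** wmat3 = mat 1" "wmat3 ** wmat = mat 1"
  by (simp_all add: mat2_eq_iff mat2_mult_nth mat_1_mat2)

lemma unimod_bru:
  assumes "det M > 0" "M $ 2 $ 2 \<noteq> 0"
  shows "unimod M ** wmat = nmat (bru_a M) ** (wmat ** nmat (bru_b M) ** wmat3) ** nmat (bru_c M)"
proof -
  let ?q = "sqrt (det M)"
  have q: "?q > 0" using assms by simp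
  have S: "unimod M ** wmat \<in> SL2" by (rule SL2_mult[OF unimod_SL2[OF assms(1)]]) simp
  have n: "(unimod M ** wmat) $ 2 $ 1 = M $ 2 $ 2 / ?q" "(unimod M ** wmat) $ 1 $ 1 = M $ 1 $ 2 / ?q"
    "(unimod M ** wmat) $ 2 $ 2 = - M $ 2 $ 1 / ?q"
    by (simp_all add: mat2_mult_nth unimod_nth)
  have nz: "(unimod M ** wmat) $ 2 $ 1 \<noteq> 0" using n assms q by simp
  have a: "((unimod M ** wmat) $ 1 $ 1 - 1) / (unimod M ** wmat) $ 2 $ 1 = bru_a M"
    and c: "((unimod M ** wmat) $ 2 $ 2 - 1) / (unimod M ** wmat) $ 2 $ 1 = bru_c M"
    unfolding n bru_a_def bru_c_def using q assms by (simp_all add: field_simps)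
  show ?thesis
    by (subst bruhat[OF S nz]) (simp only: a c, simp only: n(1) nbar_eq bru_b_def)
qed

lemma mat2_scaleR_mult: "(c *\<^sub>R A) ** B = c *\<^sub>R (A ** B)" "A ** (c *\<^sub>R B) = c *\<^sub>R (A ** B)"
  for A B :: "real ^ 2 ^ 2"
  by (simp_all only: mat2_eq_iff mat2_mult_nth vector_scaleR_component real_scaleR_def distrib_left mult_ac)

lemma mat2_mult_add: "A ** (B + C) = A ** B + A ** C" for A B C :: "real ^ 2 ^ 2"
  by (simp only: mat2_eq_iff mat2_mult_nth vector_add_component distrib_left add_ac)

context sl2_rep
begin

lemma X_add: "v \<in> X \<Longrightarrow> w \<in> X \<Longrightarrow> v + w \<in> X" and X_scaleR: "v \<in> X \<Longrightarrow> c *\<^sub>R v \<in> X"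
  using sub by (auto simp: subspace_add subspace_scale)

text \<open>The factor \<open>wmat\<close> in the Bruhat coordinates is undone by starting from
  \<open>R wmat3 v\<close>; the product rule then runs over the three unipotent factors from right
  to left. The direction \<open>h\<close> enters only through the scalars, so three fixed vectors
  describe the whole derivative.\<close>

lemma derivative_at_one:
  assumes a: "(bru_a has_derivative a') (at (mat 1))" and b: "(bru_b has_derivative b') (at (mat 1))"
    and c: "(bru_c has_derivative c') (at (mat 1))" and v: "v \<in> X"
  shows "\<exists>w1\<in>X. \<exists>w2\<in>X. \<exists>w3\<in>X. ((\<lambda>M. R (unimod M) v) has_derivative (\<lambda>h. a' h *\<^sub>R w1 + b' h *\<^sub>R w2 + c' h *\<^sub>R w3)) (at (mat 1))"
proof -
  have I: "mat 1 \<in> SL2" by (simp add: SL2_def)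
  have W: "wmat \<in> SL2" "wmat3 \<in> SL2" by (simp_all add: wmat3(1))
  have n: "nmat t \<in> SL2" for t by simp
  define v' where "v' = R wmat3 v"
  have v': "v' \<in> X" unfolding v'_def by (rule inv[OF W(2) v])
  define N where "N t = mat 1 ** nmat t ** mat 1" for t
  define Nb where "Nb t = wmat ** nmat t ** wmat3" for t
  have N: "N t = nmat t" for t by (simp add: N_def)
  have NS: "N t \<in> SL2" "Nb t \<in> SL2" for t unfolding N Nb_def by (intro SL2_mult W n)+
  obtain w1 where w1: "w1 \<in> X" "((\<lambda>M. R (N (bru_c M)) v') has_derivative (\<lambda>h. c' h *\<^sub>R w1)) (at (mat 1))"
    using param_derivative[OF v' I I c] unfolding N_def by blast
  define u1 where "u1 M = R (N (bru_c M)) v'" for M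
  have u1X: "u1 M \<in> X" for M unfolding u1_def by (rule inv[OF NS(1) v'])
  obtain w2 where w2: "w2 \<in> X" "((\<lambda>M. R (Nb (bru_b M)) (u1 M)) has_derivative (\<lambda>h. b' h *\<^sub>R w2 + R (Nb (bru_b (mat 1))) (c' h *\<^sub>R w1))) (at (mat 1))"
    using product_param_derivative[OF W(1) W(2) b, of u1 "\<lambda>h. c' h *\<^sub>R w1"] u1X w1(2) X_scaleR[OF w1(1)]
    unfolding Nb_def u1_def by blast
  define w1b where "w1b = R (Nb (bru_b (mat 1))) w1"
  have w1b: "w1b \<in> X" unfolding w1b_def by (rule inv[OF NS(2) w1(1)])
  have w2': "((\<lambda>M. R (Nb (bru_b M)) (u1 M)) has_derivative (\<lambda>h. b' h *\<^sub>R w2 + c' h *\<^sub>R w1b)) (at (mat 1))"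
    using w2(2) by (simp add: w1b_def linear_scale[OF lin[OF NS(2)]])
  define u2 where "u2 M = R (Nb (bru_b M)) (u1 M)" for M
  have u2X: "u2 M \<in> X" for M unfolding u2_def by (rule inv[OF NS(2) u1X])
  have u2d: "b' h *\<^sub>R w2 + c' h *\<^sub>R w1b \<in> X" for h by (intro X_add X_scaleR w2(1) w1b)
  obtain w3 where w3: "w3 \<in> X" "((\<lambda>M. R (N (bru_a M)) (u2 M)) has_derivative (\<lambda>h. a' h *\<^sub>R w3 + R (N (bru_a (mat 1))) (b' h *\<^sub>R w2 + c' h *\<^sub>R w1b))) (at (mat 1))"
    using product_param_derivative[OF I I a, of u2 "\<lambda>h. b' h *\<^sub>R w2 + c' h *\<^sub>R w1b"] u2X w2' u2d
    unfolding N_def u2_def by blast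
  let ?A = "R (N (bru_a (mat 1)))"
  have w3': "((\<lambda>M. R (N (bru_a M)) (u2 M)) has_derivative (\<lambda>h. a' h *\<^sub>R w3 + b' h *\<^sub>R ?A w2 + c' h *\<^sub>R ?A w1b)) (at (mat 1))"
    using w3(2) by (simp add: linear_scale[OF lin[OF NS(1)]] linear_add[OF lin[OF NS(1)]] add.assoc)
  have eq: "R (N (bru_a M)) (u2 M) = R (unimod M) v" if M: "M \<in> {M. det M > 0} \<inter> {M. M $ 2 $ 2 \<noteq> 0}" for M
  proof -
    have "R (N (bru_a M)) (u2 M) = R (nmat (bru_a M) ** Nb (bru_b M) ** nmat (bru_c M)) v'"
      unfolding u2_def u1_def N by (simp only: mult[OF SL2_mult[OF n NS(2)] n] mult[OF n NS(2)])
    also have "nmat (bru_a M) ** Nb (bru_b M) ** nmat (bru_c M) = unimod M ** wmat"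
      unfolding Nb_def using unimod_bru[of M] M by simp
    also have "R (unimod M ** wmat) v' = R (unimod M ** wmat ** wmat3) v"
      unfolding v'_def using M by (intro mult[symmetric] SL2_mult unimod_SL2 W) auto
    also have "unimod M ** wmat ** wmat3 = unimod M ** (wmat ** wmat3)"
      by (rule matrix_mul_assoc[symmetric])
    also have "\<dots> = unimod M" by (simp only: wmat3(2) matrix_mul_rid)
    finally show ?thesis .
  qed
  have op: "open ({M :: real ^ 2 ^ 2. det M > 0} \<inter> {M. M $ 2 $ 2 \<noteq> 0})"
    by (intro open_Int open_det_pos open_Collect_neq continuous_intros)
  have mem: "mat 1 \<in> {M :: real ^ 2 ^ 2. det M > 0} \<inter> {M. M $ 2 $ 2 \<noteq> 0}"
    by (simp add: mat_1_mat2 det_2)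
  have "((\<lambda>M. R (unimod M) v) has_derivative (\<lambda>h. a' h *\<^sub>R w3 + b' h *\<^sub>R ?A w2 + c' h *\<^sub>R ?A w1b)) (at (mat 1))"
    by (rule has_derivative_transform_within_open[OF w3' op mem eq])
  then show ?thesis
    by (intro bexI[OF _ inv[OF NS(1) w1b]] bexI[OF _ inv[OF NS(1) w2(1)]] bexI[OF _ w3(1)])
qed

text \<open>Left translation: \<open>R (unimod M)\<close> is \<open>R (unimod g)\<close> composed
  with the operator of the inverse of \<open>g\<close> times \<open>M\<close>, a matrix near the
  identity when \<open>M\<close> is near \<open>g\<close>. The inverse is \<open>adj2 g\<close>
  divided by the determinant. The three vectors are chosen before \<open>g\<close>; only for this
  reason is the derivative again a combination of orbit maps, to which the statement can be applied
  once more.\<close>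

lemma derivative_at:
  assumes a: "(bru_a has_derivative a') (at (mat 1))" and b: "(bru_b has_derivative b') (at (mat 1))"
    and c: "(bru_c has_derivative c') (at (mat 1))" and v: "v \<in> X"
  shows "\<exists>w1\<in>X. \<exists>w2\<in>X. \<exists>w3\<in>X. \<forall>g. det g > 0 \<longrightarrow> ((\<lambda>M. R (unimod M) v) has_derivative
    (\<lambda>h. (inverse (det g) * a' (adj2 g ** h)) *\<^sub>R R (unimod g) w1 + (inverse (det g) * b' (adj2 g ** h)) *\<^sub>R R (unimod g) w2
      + (inverse (det g) * c' (adj2 g ** h)) *\<^sub>R R (unimod g) w3)) (at g)"
proof -
  obtain w1 w2 w3 where w: "w1 \<in> X" "w2 \<in> X" "w3 \<in> X"
    "((\<lambda>M. R (unimod M) v) has_derivative (\<lambda>h. a' h *\<^sub>R w1 + b' h *\<^sub>R w2 + c' h *\<^sub>R w3)) (at (mat 1))"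
    using derivative_at_one[OF a b c v] by blast
  have sc: "a' (t *\<^sub>R h) = t * a' h" "b' (t *\<^sub>R h) = t * b' h" "c' (t *\<^sub>R h) = t * c' h" for t h
    using linear_scale[OF has_derivative_linear[OF a]] linear_scale[OF has_derivative_linear[OF b]]
      linear_scale[OF has_derivative_linear[OF c]] by auto
  have key: "((\<lambda>M. R (unimod M) v) has_derivative
    (\<lambda>h. (inverse (det g) * a' (adj2 g ** h)) *\<^sub>R R (unimod g) w1 + (inverse (det g) * b' (adj2 g ** h)) *\<^sub>R R (unimod g) w2
      + (inverse (det g) * c' (adj2 g ** h)) *\<^sub>R R (unimod g) w3)) (at g)" if g: "det g > 0" for g
  proof -
    let ?G = "inverse (det g) *\<^sub>R adj2 g"
    have Gg: "?G ** g = mat 1" "g ** ?G = mat 1"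
      using g by (simp_all add: mat2_scaleR_mult adj2_mult)
    have dG: "det ?G > 0" using g by (simp add: det_scaleR_2 det_adj2)
    have L: "((\<lambda>M. ?G ** M) has_derivative (\<lambda>h. ?G ** h)) (at g)"
    proof (rule bounded_linear_imp_has_derivative)
      have "linear (\<lambda>M :: real ^ 2 ^ 2. ?G ** M)"
        by (rule linearI) (simp_all add: mat2_mult_add mat2_scaleR_mult)
      then show "bounded_linear (\<lambda>M :: real ^ 2 ^ 2. ?G ** M)" by (simp add: linear_conv_bounded_linear)
    qed
    have gS: "unimod g \<in> SL2" by (rule unimod_SL2[OF g])
    from bounded_linear.has_derivative[OF bounded_linear_R[OF gS] has_derivative_compose[OF L w(4)[folded Gg(1)]]]
    have "((\<lambda>M. R (unimod g) (R (unimod (?G ** M)) v)) has_derivative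
      (\<lambda>h. R (unimod g) (a' (?G ** h) *\<^sub>R w1 + b' (?G ** h) *\<^sub>R w2 + c' (?G ** h) *\<^sub>R w3))) (at g)" .
    moreover have "?G ** h = inverse (det g) *\<^sub>R (adj2 g ** h)" for h :: "real ^ 2 ^ 2"
      by (rule mat2_scaleR_mult)
    ultimately have D: "((\<lambda>M. R (unimod g) (R (unimod (?G ** M)) v)) has_derivative
     (\<lambda>h. (inverse (det g) * a' (adj2 g ** h)) *\<^sub>R R (unimod g) w1 + (inverse (det g) * b' (adj2 g ** h)) *\<^sub>R R (unimod g) w2
      + (inverse (det g) * c' (adj2 g ** h)) *\<^sub>R R (unimod g) w3)) (at g)"
      by (simp only: sc linear_add[OF lin[OF gS]] linear_scale[OF lin[OF gS]])
    show ?thesis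
    proof (rule has_derivative_transform_within_open[OF D open_det_pos])
      show "g \<in> {g. det g > 0}" using g by simp
      fix M :: "real ^ 2 ^ 2" assume "M \<in> {g. det g > 0}"
      then have M: "det M > 0" by simp
      then have GM: "det (?G ** M) > 0" using dG by (simp only: det_mul mult_pos_pos)
      have "R (unimod g) (R (unimod (?G ** M)) v) = R (unimod (g ** (?G ** M))) v"
        by (simp only: mult[OF gS unimod_SL2[OF GM], symmetric] unimod_mult[OF g GM])
      also have "g ** (?G ** M) = M" by (simp only: matrix_mul_assoc Gg matrix_mul_lid)
      finally show "R (unimod g) (R (unimod (?G ** M)) v) = R (unimod M) v" .
    qed
  qed
  show ?thesis
    by (rule bexI[OF _ w(1)], rule bexI[OF _ w(2)], rule bexI[OF _ w(3)], intro allI impI key)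
qed

lemma C_k_orbit: "v \<in> X \<Longrightarrow> C_k_on k {g. det g > 0} (\<lambda>g. R (unimod g) v)"
proof (induction k arbitrary: v)
  case 0
  obtain a' b' c' where abc: "(bru_a has_derivative a') (at (mat 1))" "(bru_b has_derivative b') (at (mat 1))"
    "(bru_c has_derivative c') (at (mat 1))" by (rule bru_derivatives)
  have "isCont (\<lambda>g. R (unimod g) v) g" if "det g > 0" for g
    using derivative_at[OF abc 0] that by (blast intro: has_derivative_continuous)
  then show ?case by (auto intro!: continuous_at_imp_continuous_on)
next
  case (Suc k)
  obtain a' b' c' where abc: "(bru_a has_derivative a') (at (mat 1))" "(bru_b has_derivative b') (at (mat 1))"
    "(bru_c has_derivative c') (at (mat 1))" by (rule bru_derivatives)
  obtain w1 w2 w3 where w: "w1 \<in> X" "w2 \<in> X" "w3 \<in> X"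
    and D: "\<forall>g. det g > 0 \<longrightarrow> ((\<lambda>M. R (unimod M) v) has_derivative
    (\<lambda>h. (inverse (det g) * a' (adj2 g ** h)) *\<^sub>R R (unimod g) w1 + (inverse (det g) * b' (adj2 g ** h)) *\<^sub>R R (unimod g) w2
      + (inverse (det g) * c' (adj2 g ** h)) *\<^sub>R R (unimod g) w3)) (at g)"
    using derivative_at[OF abc Suc.prems] by blast
  note U = open_det_pos
  have det: "C_k_on k {g :: real ^ 2 ^ 2. det g > 0} (\<lambda>g. inverse (det g))"
  proof (rule C_k_on_inverse[OF U])
    have e: "C_k_on k {g :: real ^ 2 ^ 2. det g > 0} (\<lambda>M. M $ i $ j)" for i j
      by (rule C_k_on_bounded_linear[OF U bounded_linear_compose[OF bounded_linear_vec_nth bounded_linear_vec_nth]])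
    have "C_k_on k {g :: real ^ 2 ^ 2. det g > 0} (\<lambda>M. M $ 1 $ 1 * M $ 2 $ 2 + (- 1) * (M $ 1 $ 2 * M $ 2 $ 1))"
      by (rule C_k_on_add[OF U C_k_on_mult[OF U e e] C_k_on_mult[OF U C_k_on_const[OF U] C_k_on_mult[OF U e e]]])
    then show "C_k_on k {g :: real ^ 2 ^ 2. det g > 0} det" by (simp add: det_2[abs_def])
    show "det x \<noteq> 0" if "x \<in> {g :: real ^ 2 ^ 2. det g > 0}" for x :: "real ^ 2 ^ 2"
      using that by simp
  qed
  \<comment> \<open>For matrices of size two \<open>adj2\<close> is linear, so this coefficient is a
    linear function of \<open>g\<close>.\<close>
  have adj: "C_k_on k {g :: real ^ 2 ^ 2. det g > 0} (\<lambda>g. l (adj2 g ** h))" if l: "bounded_linear l" for l :: "real ^ 2 ^ 2 \<Rightarrow> real" and h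
  proof (rule C_k_on_bounded_linear[OF U])
    have "linear (\<lambda>g. adj2 g ** h)"
      by (rule linearI) (simp_all add: mat2_eq_iff mat2_mult_nth adj2_def algebra_simps)
    then have "bounded_linear (\<lambda>g. adj2 g ** h)" by (simp add: linear_conv_bounded_linear)
    from bounded_linear_compose[OF l this] show "bounded_linear (\<lambda>g. l (adj2 g ** h))" .
  qed
  note tm = C_k_on_scaleR[OF U C_k_on_mult[OF U det adj] Suc.IH]
  note bl = abc[THEN has_derivative_bounded_linear]
  have D': "((\<lambda>M. R (unimod M) v) has_derivative
    (\<lambda>h. (inverse (det g) * a' (adj2 g ** h)) *\<^sub>R R (unimod g) w1 + (inverse (det g) * b' (adj2 g ** h)) *\<^sub>R R (unimod g) w2
      + (inverse (det g) * c' (adj2 g ** h)) *\<^sub>R R (unimod g) w3)) (at g)" if "g \<in> {g. det g > 0}" for g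
    using D that by simp
  show ?case
  proof (rule C_k_on_SucI'[OF U D'])
    fix h
    show "C_k_on k {g. det g > 0} (\<lambda>g. (inverse (det g) * a' (adj2 g ** h)) *\<^sub>R R (unimod g) w1 + (inverse (det g) * b' (adj2 g ** h)) *\<^sub>R R (unimod g) w2
      + (inverse (det g) * c' (adj2 g ** h)) *\<^sub>R R (unimod g) w3)"
      by (rule C_k_on_add[OF U C_k_on_add[OF U tm[OF bl(1) w(1)] tm[OF bl(2) w(2)]] tm[OF bl(3) w(3)]])
  qed
qed

lemma smooth_on_SL2_orbit:
  assumes "v \<in> X" shows "smooth_on_SL2 (\<lambda>g. R g v)"
  unfolding smooth_on_SL2_def
proof (intro ballI)
  fix g :: "real ^ 2 ^ 2" assume g: "g \<in> SL2"
  show "\<exists>U F'. g \<in> U \<and> smooth_on_open U F' \<and> (\<forall>h\<in>U \<inter> SL2. F' h = R h v)"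
  proof (intro exI conjI)
    show "g \<in> {g. det g > 0}" using g by (simp add: SL2_def)
    show "smooth_on_open {g. det g > 0} (\<lambda>g. R (unimod g) v)"
      using C_k_orbit[OF assms] by (simp add: smooth_on_open_def open_det_pos)
    show "\<forall>h\<in>{g. det g > 0} \<inter> SL2. R (unimod h) v = R h v" by (simp add: unimod_id)
  qed
qed

end

lemma phase_0 [simp]: "phase 0 x = 1"
  by (simp add: phase_def)

lemma phase_eq_iexp: "phase c x = iexp (c * x)"
  by (simp add: phase_def mult.assoc)

lemma phase_taylor: "cmod (phase c x - 1 - \<i> * complex_of_real (c * x)) \<le> (c * x)\<^sup>2"
proof -
  have "cmod (iexp (c * x) - (\<Sum>k\<le>1. (\<i> * complex_of_real (c * x)) ^ k / fact k)) \<le> \<bar>c * x\<bar> ^ Suc 1 / fact (Suc 1)"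
    by (rule iexp_approx1)
  then have "cmod (phase c x - 1 - \<i> * complex_of_real (c * x)) \<le> (c * x)\<^sup>2 / 2"
    by (simp add: phase_eq_iexp numeral_2_eq_2 diff_diff_add power2_eq_square)
  then show ?thesis using zero_le_power2[of "c * x"] by linarith
qed

text \<open>The derivative is multiplication by i x, and the remainder is at most c^2 x^2 times the
  modulus of the function. Both multipliers preserve S_d, which also makes the remainder bound a
  finite norm.\<close>

lemma nmat_derivative:
  assumes d: "d > 0" and v: "v \<in> Sd d"
  shows "\<exists>w\<in>Sd d. ((\<lambda>c. R_plus_L2 d (nmat c) v) has_vector_derivative w) (at 0)"
proof -
  from v obtain f where f: "f \<in> schwartz_half_line" "v = abs_L2pos (emb d f)"
    unfolding S_half_line_eq by (elim imageE) (simp only:)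
  define f1 where "f1 x = \<i> * (complex_of_real x * f x)" for x
  define f2 where "f2 x = complex_of_real x * (complex_of_real x * f x)" for x
  have f1: "f1 \<in> schwartz_half_line" unfolding f1_def by (intro schwartz_cmult schwartz_xmult f)
  have f2: "f2 \<in> schwartz_half_line" unfolding f2_def by (intro schwartz_xmult f)
  note S = SQ_emb[OF f(1), of d] SQ_emb[OF f1, of d] SQ_emb[OF f2, of d]
  have Rv: "R_plus_L2 d (nmat c) v = abs_L2pos (\<lambda>x. phase c x * emb d f x)" for c
    unfolding f(2) by (rule R_plus_L2_nmat[OF d S(1)])
  have "((\<lambda>c. R_plus_L2 d (nmat c) v) has_vector_derivative abs_L2pos (emb d f1)) (at 0 within UNIV)"
  proof (rule has_vector_derivative_quadratic)
    fix c :: real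
    have s1: "SQ (\<lambda>x. c *\<^sub>R emb d f1 x)" by (rule square_integrable_scaleR[OF S(2)])
    have s2: "SQ (\<lambda>x. phase c x * emb d f x - phase 0 x * emb d f x)" by (intro SQ_diff SQ_phase S)
    have "R_plus_L2 d (nmat c) v - R_plus_L2 d (nmat 0) v - (c - 0) *\<^sub>R abs_L2pos (emb d f1)
      = abs_L2pos (\<lambda>x. phase c x * emb d f x - phase 0 x * emb d f x - c *\<^sub>R emb d f1 x)"
      unfolding Rv diff_zero abs_L2pos_scaleR[OF S(2)] abs_L2pos_diff[OF SQ_phase[OF S(1)] SQ_phase[OF S(1)]]
      by (rule abs_L2pos_diff[OF s2 s1])
    also have "norm \<dots> \<le> c\<^sup>2 * norm (abs_L2pos (emb d f2))"
    proof (rule norm_abs_L2pos_le[OF S(3)])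
      show "(\<lambda>x. phase c x * emb d f x - phase 0 x * emb d f x - c *\<^sub>R emb d f1 x) \<in> borel_measurable HL"
        using SQ_diff[OF s2 s1] by (simp add: square_integrable_def)
      have "cmod (phase c x * emb d f x - phase 0 x * emb d f x - c *\<^sub>R emb d f1 x) \<le> c\<^sup>2 * cmod (emb d f2 x)" if x: "x > 0" for x
      proof -
        let ?p = "x powr ((real d + 1) / 2)"
        have "phase c x * emb d f x - phase 0 x * emb d f x - c *\<^sub>R emb d f1 x
           = (phase c x - 1 - \<i> * complex_of_real (c * x)) * emb d f x"
          using x by (simp add: emb_def f1_def scaleR_conv_of_real algebra_simps)
        then have "cmod (phase c x * emb d f x - phase 0 x * emb d f x - c *\<^sub>R emb d f1 x)
           = cmod (phase c x - 1 - \<i> * complex_of_real (c * x)) * cmod (emb d f x)"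
          by (simp only: norm_mult)
        also have "\<dots> \<le> (c * x)\<^sup>2 * cmod (emb d f x)" by (rule mult_right_mono[OF phase_taylor]) simp
        also have "\<dots> = c\<^sup>2 * cmod (emb d f2 x)"
          using x by (simp add: emb_def f2_def norm_mult power_mult_distrib power2_eq_square mult_ac)
        finally show ?thesis .
      qed
      then show "AE x in HL. cmod (phase c x * emb d f x - phase 0 x * emb d f x - c *\<^sub>R emb d f1 x) \<le> c\<^sup>2 * cmod (emb d f2 x)"
        unfolding AE_HL_iff by (intro always_eventually allI impI)
    qed simp
    finally show "norm (R_plus_L2 d (nmat c) v - R_plus_L2 d (nmat 0) v - (c - 0) *\<^sub>R abs_L2pos (emb d f1))
      \<le> norm (abs_L2pos (emb d f2)) * (c - 0)\<^sup>2" by (simp add: mult.commute)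
  qed
  moreover have "abs_L2pos (emb d f1) \<in> Sd d" unfolding S_half_line_eq by (intro imageI f1)
  ultimately show ?thesis by auto
qed

lemma subspace_Sd: "subspace (Sd d)"
proof (rule subspaceI)
  have "(\<lambda>x. exp (- 1 * complex_of_real x)) \<in> schwartz_half_line" by (rule schwartz_exp) simp
  then have "abs_L2pos (emb d (\<lambda>x. exp (- 1 * complex_of_real x))) \<in> Sd d" unfolding S_half_line_eq by (intro imageI)
  from Sd_scaleR[OF this, of 0] show "0 \<in> Sd d" by simp
qed (rule Sd_add Sd_scaleR, assumption+)+

lemma sl2_rep_R_plus: "d > 0 \<Longrightarrow> sl2_rep (R_plus_L2 d) (Sd d)"
  by (rule sl2_rep.intro)
    (rule R_plus_L2_props(2) R_plus_L2_props(3) R_plus_L2_mult subspace_Sd R_plus_L2_props(4) nmat_derivative; assumption)+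

lemma Sd_subset_smooth: "d > 0 \<Longrightarrow> Sd d \<subseteq> smooth_vectors (R_plus_L2 d)"
  unfolding smooth_vectors_def using sl2_rep.smooth_on_SL2_orbit[OF sl2_rep_R_plus] by blast

section \<open>Smooth vectors are Schwartz functions\<close>

lemma quotient_LIMSEQ:
  fixes f :: "real \<Rightarrow> 'a::real_normed_vector"
  assumes f: "(f has_vector_derivative D) (at c)" and h: "h \<longlonglongrightarrow> 0" "\<And>n. h n \<noteq> 0"
  shows "(\<lambda>n. inverse (h n) *\<^sub>R (f (c + h n) - f c)) \<longlonglongrightarrow> D"
proof -
  have "((\<lambda>y. norm (f (c + y) - f c - y *\<^sub>R D) / norm y) \<longlongrightarrow> 0) (at 0)"
    using f unfolding has_vector_derivative_def has_derivative_at by simp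
  moreover have "filterlim h (at 0) sequentially" using h by (simp add: filterlim_at)
  ultimately have "(\<lambda>n. norm (f (c + h n) - f c - h n *\<^sub>R D) / norm (h n)) \<longlonglongrightarrow> 0"
    by (rule filterlim_compose)
  moreover have "norm (f (c + h n) - f c - h n *\<^sub>R D) / norm (h n) = norm (inverse (h n) *\<^sub>R (f (c + h n) - f c) - D)" for n
  proof -
    have "inverse (h n) *\<^sub>R (f (c + h n) - f c) - D = inverse (h n) *\<^sub>R (f (c + h n) - f c - h n *\<^sub>R D)"
      using h(2)[of n] by (simp add: scaleR_diff_right)
    then show ?thesis by (simp add: divide_inverse)
  qed
  ultimately show ?thesis by (simp add: tendsto_norm_zero_iff LIM_zero_iff)
qed

text \<open>One fixed direction is enough, because the curve \<open>nmat c ** g0\<close> is affine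
  in \<open>c\<close>.\<close>

primrec iterated_derivative :: "'a::real_normed_vector \<Rightarrow> ('a \<Rightarrow> 'b::real_normed_vector) \<Rightarrow> nat \<Rightarrow> 'a \<Rightarrow> 'b" where
  "iterated_derivative N F 0 = F"
| "iterated_derivative N F (Suc k) = (\<lambda>g. frechet_derivative (iterated_derivative N F k) (at g) N)"

lemma C_k_on_iterated: "(\<And>j. C_k_on j U F) \<Longrightarrow> C_k_on j U (iterated_derivative N F k)"
proof (induction k arbitrary: j)
  case (Suc k)
  from Suc.IH[OF Suc.prems, of "Suc j"] show ?case by simp
qed simp

lemma iterated_has_vector_derivative:
  assumes "\<And>j. C_k_on j U F" "g0 + c *\<^sub>R N \<in> U"
  shows "((\<lambda>c. iterated_derivative N F k (g0 + c *\<^sub>R N)) has_vector_derivative iterated_derivative N F (Suc k) (g0 + c *\<^sub>R N)) (at c)"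
proof -
  let ?F = "iterated_derivative N F k"
  have "C_k_on (Suc 0) U ?F" by (rule C_k_on_iterated[OF assms(1)])
  from C_k_on_Suc_D[OF this assms(2)]
  have D: "(?F has_derivative frechet_derivative ?F (at (g0 + c *\<^sub>R N))) (at (g0 + c *\<^sub>R N))" .
  have "((\<lambda>c. g0 + c *\<^sub>R N) has_derivative (\<lambda>h. h *\<^sub>R N)) (at c)"
    by (auto intro!: derivative_eq_intros)
  from has_derivative_compose[OF this D]
  show ?thesis unfolding has_vector_derivative_def
    by (simp add: linear_scale[OF has_derivative_linear[OF D]])
qed

text \<open>Along \<open>nmat c ** g0\<close> the orbit is the class of \<open>phase c\<close> times
  \<open>f\<close>. Its k-th derivative exists in the Hilbert space, and the difference quotients
  converge pointwise to (i x)^k times the phase times \<open>f\<close>; \<open>L2_limit_AE\<close>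
  identifies the two limits, so this function is square-integrable. The induction covers an open set
  \<open>I\<close> of parameters, because the next derivative at a point uses the previous one
  nearby.\<close>

lemma smooth_vector_powers:
  assumes d: "d > 0" and sm: "smooth_on_SL2 (\<lambda>g. R_plus_L2 d g v)" and g0: "g0 \<in> SL2"
    and f: "SQ f" and fv: "abs_L2pos f = R_plus_L2 d g0 v"
  shows "SQ (\<lambda>x. complex_of_real x ^ k * f x)"
proof -
  obtain U F where gU: "g0 \<in> U" and smF: "smooth_on_open U F" and eq: "\<forall>h\<in>U \<inter> SL2. F h = R_plus_L2 d h v"
    using bspec[OF sm[unfolded smooth_on_SL2_def] g0] by (elim exE conjE) (rule that; assumption)
  have U: "open U" and C: "\<And>j. C_k_on j U F" using smF by (simp_all add: smooth_on_open_def)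
  \<comment> \<open>chosen such that \<open>nmat c ** g0 = g0 + c *\<^sub>R N\<close>\<close>
  define N where "N = mat2 (g0 $ 2 $ 1) (g0 $ 2 $ 2) 0 0"
  define I where "I = {c. g0 + c *\<^sub>R N \<in> U}"
  have "open ((\<lambda>c. g0 + c *\<^sub>R N) -` U)"
    by (intro open_vimage U continuous_intros)
  then have I: "open I" by (simp add: I_def vimage_def)
  have I0: "0 \<in> I" using gU by (simp add: I_def)
  have n: "nmat c ** g0 = g0 + c *\<^sub>R N" for c
    by (simp add: mat2_eq_iff mat2_mult_nth N_def)
  define G where "G k x = (\<i> * complex_of_real x) ^ k * f x" for k x
  have "SQ (G k) \<and> (\<forall>c\<in>I. iterated_derivative N F k (g0 + c *\<^sub>R N) = abs_L2pos (\<lambda>x. phase c x * G k x))" for k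
  proof (induction k)
    case 0
    have G0: "G 0 = f" by (rule ext) (simp add: G_def)
    have "F (g0 + c *\<^sub>R N) = abs_L2pos (\<lambda>x. phase c x * f x)" if "c \<in> I" for c
    proof -
      have "F (nmat c ** g0) = R_plus_L2 d (nmat c ** g0) v"
        using that eq by (intro bspec[OF eq] IntI SL2_mult g0) (simp_all add: I_def n)
      also have "\<dots> = R_plus_L2 d (nmat c) (abs_L2pos f)"
        unfolding fv by (rule R_plus_L2_mult[OF d _ g0]) simp
      also have "\<dots> = abs_L2pos (\<lambda>x. phase c x * f x)" by (rule R_plus_L2_nmat[OF d f])
      finally show ?thesis by (simp only: n)
    qed
    then show ?case unfolding G0 using f by simp
  next
    case (Suc k)
    then have Gk: "SQ (G k)" and Dk: "\<And>c. c \<in> I \<Longrightarrow> iterated_derivative N F k (g0 + c *\<^sub>R N) = abs_L2pos (\<lambda>x. phase c x * G k x)"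
      by auto
    have key: "SQ (\<lambda>x. phase c x * G (Suc k) x) \<and> iterated_derivative N F (Suc k) (g0 + c *\<^sub>R N) = abs_L2pos (\<lambda>x. phase c x * G (Suc k) x)"
      if c: "c \<in> I" for c
    proof -
      obtain e where e: "e > 0" "\<And>y. dist y c < e \<Longrightarrow> y \<in> I" using I c unfolding open_dist by blast
      obtain n0 where n0: "1 / real (Suc n0) < e" using nat_approx_posE[OF e(1)] by blast
      define h where "h n = 1 / real (Suc (n + n0))" for n
      have h0: "h \<longlonglongrightarrow> 0" unfolding h_def by (rule LIMSEQ_ignore_initial_segment[OF LIMSEQ_Suc[OF lim_1_over_n]])
      have hnz: "h n \<noteq> 0" for n by (simp add: h_def)
      have hI: "c + h n \<in> I" for n
      proof (rule e(2))
        have "h n \<le> 1 / real (Suc n0)" unfolding h_def by (intro divide_left_mono) auto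
        then show "dist (c + h n) c < e" using n0 by (simp add: dist_norm h_def)
      qed
      let ?q = "\<lambda>n x. inverse (h n) *\<^sub>R (phase (c + h n) x * G k x - phase c x * G k x)"
      have q: "SQ (?q n)" for n by (intro square_integrable_scaleR SQ_diff SQ_phase Gk)
      have "(\<lambda>n. inverse (h n) *\<^sub>R (iterated_derivative N F k (g0 + (c + h n) *\<^sub>R N) - iterated_derivative N F k (g0 + c *\<^sub>R N)))
        \<longlonglongrightarrow> iterated_derivative N F (Suc k) (g0 + c *\<^sub>R N)"
        by (rule quotient_LIMSEQ[OF iterated_has_vector_derivative[OF C] h0 hnz]) (use c in \<open>simp add: I_def\<close>)
      moreover have "inverse (h n) *\<^sub>R (iterated_derivative N F k (g0 + (c + h n) *\<^sub>R N) - iterated_derivative N F k (g0 + c *\<^sub>R N)) = abs_L2pos (?q n)" for n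
        unfolding Dk[OF hI] Dk[OF c] abs_L2pos_diff[OF SQ_phase[OF Gk] SQ_phase[OF Gk]]
        by (rule abs_L2pos_scaleR[OF SQ_diff[OF SQ_phase[OF Gk] SQ_phase[OF Gk]]])
      ultimately have lim: "(\<lambda>n. abs_L2pos (?q n)) \<longlonglongrightarrow> iterated_derivative N F (Suc k) (g0 + c *\<^sub>R N)" by (simp only:)
      have ae: "AE x in HL. (\<lambda>n. ?q n x) \<longlonglongrightarrow> phase c x * G (Suc k) x"
      proof (rule always_eventually, rule allI)
        fix x
        have "((\<lambda>c. phase c x * G k x) has_vector_derivative \<i> * complex_of_real x * phase c x * G k x) (at c)"
        proof -
          have "((\<lambda>c. exp (- (- \<i> * complex_of_real c) * complex_of_real x) * G k x) has_vector_derivative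
            \<i> * complex_of_real x * exp (- (- \<i> * complex_of_real c) * complex_of_real x) * G k x) (at c)"
            by (rule has_vector_derivative_real_field) (auto intro!: derivative_eq_intros)
          then show ?thesis by (simp only: phase_def)
        qed
        from quotient_LIMSEQ[OF this h0 hnz]
        show "(\<lambda>n. ?q n x) \<longlonglongrightarrow> phase c x * G (Suc k) x" by (simp add: G_def mult_ac)
      qed
      have "(\<lambda>x. phase c x * G (Suc k) x) \<in> borel_measurable HL"
      proof -
        have [measurable]: "f \<in> borel_measurable HL" using f by (simp add: square_integrable_def)
        have "(\<lambda>x. (\<i> * complex_of_real x) ^ Suc k) \<in> borel_measurable HL" by (rule measurable_HL_borel) measurable
        then show ?thesis unfolding G_def by (intro measurable_phase borel_measurable_times) measurable
      qed
      from L2_limit_AE[OF q lim ae this] show ?thesis by simp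
    qed
    show ?case
    proof
      show "SQ (G (Suc k))" using key[OF I0] by simp
    qed (use key in blast)
  qed
  then have G: "SQ (G k)" by blast
  have [measurable]: "f \<in> borel_measurable HL" using f by (simp add: square_integrable_def)
  have m: "(\<lambda>x. complex_of_real x ^ k) \<in> borel_measurable HL" by (rule measurable_HL_borel) measurable
  show ?thesis
  proof (rule SQ_bound[OF G, of _ 1])
    show "(\<lambda>x. complex_of_real x ^ k * f x) \<in> borel_measurable HL" by (rule borel_measurable_times[OF m]) measurable
  qed (simp add: G_def norm_mult norm_power)
qed

section \<open>The Hankel representation of a smooth vector\<close>

lemma SQ_of_powers:
  assumes u: "\<And>k. SQ (\<lambda>x. complex_of_real x ^ k * u x)"
  shows "SQ (\<lambda>x. complex_of_real ((1 + x\<^sup>2) * (1 + x ^ n)) * u x)"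
proof -
  have "SQ (\<lambda>x. (complex_of_real x ^ 0 * u x + complex_of_real x ^ 2 * u x) + (complex_of_real x ^ n * u x + complex_of_real x ^ (n + 2) * u x))"
    by (intro square_integrable_add u)
  then show ?thesis by (simp add: algebra_simps power_add power2_eq_square)
qed

text \<open>Pairing with the weight x / (1 + x^2) converts square-integrability for dx/x into
  integrability for dx, at the price of the factor 1 + x^2, which higher moments pay for. The total
  exponent \<open>a\<close> is nonnegative because \<open>n >= d >= 1\<close>, so there is no
  singularity at 0.\<close>

lemma integrable_HL_powers:
  assumes d: "d > 0" and u: "\<And>k. SQ (\<lambda>x. complex_of_real x ^ k * u x)" and n: "n \<ge> d"
  shows "integrable HL (\<lambda>x. x ^ n *\<^sub>R (x powr (- ((real d + 1) / 2)) *\<^sub>R u x))"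
proof -
  define a where "a = real n - (real d + 1) / 2"
  have a0: "a \<ge> 0" using d n by (simp add: a_def)
  have an: "a \<le> real n" by (simp add: a_def)
  define q where "q x = complex_of_real (x powr a * (1 + x\<^sup>2)) * u x" for x
  have um: "u \<in> borel_measurable HL" using u[of 0] by (simp add: square_integrable_def)
  have q: "SQ q"
  proof (rule SQ_bound[OF SQ_of_powers[OF u, of n], of _ 1])
    have "(\<lambda>x. complex_of_real (x powr a * (1 + x\<^sup>2))) \<in> borel_measurable HL"
      by (rule measurable_HL_borel) measurable
    then show "q \<in> borel_measurable HL" unfolding q_def by (rule borel_measurable_times[OF _ um])
    have "cmod (q x) \<le> 1 * cmod (complex_of_real ((1 + x\<^sup>2) * (1 + x ^ n)) * u x)" if x: "x > 0" for x
    proof -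
      have "x powr a \<le> 1 + x ^ n"
      proof (cases "x \<le> 1")
        case True
        then have "x powr a \<le> 1" using x a0 by (simp add: powr_le1)
        then show ?thesis using zero_le_power[of x n] x by linarith
      next
        case False
        then have "x powr a \<le> x powr real n" using an by (intro powr_mono) auto
        then show ?thesis using x by (simp add: powr_realpow)
      qed
      then have "x powr a * (1 + x\<^sup>2) \<le> (1 + x\<^sup>2) * (1 + x ^ n)"
        by (subst mult.commute) (intro mult_left_mono, auto)
      moreover have "0 \<le> x powr a * (1 + x\<^sup>2)" by simp
      ultimately have "\<bar>x powr a * (1 + x\<^sup>2)\<bar> \<le> \<bar>(1 + x\<^sup>2) * (1 + x ^ n)\<bar>" by linarith
      then have "\<bar>x powr a * (1 + x\<^sup>2)\<bar> * cmod (u x) \<le> \<bar>(1 + x\<^sup>2) * (1 + x ^ n)\<bar> * cmod (u x)"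
        by (rule mult_right_mono) simp
      then show ?thesis unfolding q_def norm_mult norm_of_real by simp
    qed
    then show "AE x in HL. cmod (q x) \<le> 1 * cmod (complex_of_real ((1 + x\<^sup>2) * (1 + x ^ n)) * u x)"
      unfolding AE_HL_iff by (intro always_eventually allI impI)
  qed
  have qw: "integrable dx_over_x (\<lambda>x. q x * cnj (complex_of_real (x / (1 + x\<^sup>2))))"
    by (rule square_integrable_mult[OF q SQ_weight])
  then have "(\<lambda>x. q x * cnj (complex_of_real (x / (1 + x\<^sup>2)))) \<in> borel_measurable HL"
    by (auto dest: borel_measurable_integrable)
  from qw[unfolded integrable_dx_over_x[OF this]]
  have "integrable HL (\<lambda>x. q x * cnj (complex_of_real (x / (1 + x\<^sup>2))) /\<^sub>R x)" .
  then show ?thesis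
  proof (rule Bochner_Integration.integrable_cong[OF refl, THEN iffD1, rotated])
    fix x assume "x \<in> space HL"
    then have x: "x > 0" by simp
    have p: "1 + x\<^sup>2 > 0" by (simp add: add_pos_nonneg)
    have "x powr a * (1 + x\<^sup>2) * (x / (1 + x\<^sup>2)) * inverse x = x powr a"
      using x p by simp
    also have "\<dots> = x ^ n * x powr (- ((real d + 1) / 2))"
      using x by (simp add: a_def powr_diff powr_minus_divide powr_realpow)
    finally have e: "complex_of_real (x powr a * (1 + x\<^sup>2) * (x / (1 + x\<^sup>2)) * inverse x) = complex_of_real (x ^ n * x powr (- ((real d + 1) / 2)))"
      by (rule arg_cong)
    have "q x * cnj (complex_of_real (x / (1 + x\<^sup>2))) /\<^sub>R x = complex_of_real (x powr a * (1 + x\<^sup>2) * (x / (1 + x\<^sup>2)) * inverse x) * u x"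
      unfolding q_def complex_cnj_complex_of_real scaleR_conv_of_real of_real_mult by (simp only: mult_ac)
    also have "\<dots> = x ^ n *\<^sub>R (x powr (- ((real d + 1) / 2)) *\<^sub>R u x)"
      unfolding e by (simp only: scaleR_conv_of_real of_real_mult mult_ac)
    finally show "q x * cnj (complex_of_real (x / (1 + x\<^sup>2))) /\<^sub>R x = x ^ n *\<^sub>R (x powr (- ((real d + 1) / 2)) *\<^sub>R u x)" .
  qed
qed

lemma hank_cmult: "hank d (\<lambda>x. c * f x) y = c * hank d f y"
  unfolding hank_def by (subst integral_mult_right_zero[symmetric]) (simp add: mult_ac)

lemma R_plus_L2_inner:
  assumes d: "d > 0" and g: "g \<in> SL2"
  shows "R_plus_L2 d g v \<bullet> R_plus_L2 d g w = v \<bullet> w"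
  unfolding dot_norm R_plus_L2_props(3)[OF d g] linear_add[OF R_plus_L2_props(2)[OF d g], symmetric] ..

text \<open>The constant s = (-i)^(d+1) satisfies s^3 = \<open>cnj s\<close>, and three Hankel
  transforms amount to one.\<close>

lemma R_plus_L2_wmat3:
  assumes d: "d > 0" and f: "f \<in> schwartz_half_line"
  shows "R_plus_L2 d wmat3 (abs_L2pos (emb d f)) = abs_L2pos (emb d (\<lambda>x. cnj ((- \<i>) ^ Suc d) * hank d f x))"
proof -
  define s where "s = (- \<i>) ^ Suc d"
  have w: "wmat \<in> SL2" "wmat ** wmat \<in> SL2" by (intro SL2_mult | simp)+
  note S = schwartz_cmult hank_schwartz
  have R: "R_plus_L2 d wmat (abs_L2pos (emb d h)) = abs_L2pos (emb d (\<lambda>x. s * hank d h x))" if h: "h \<in> schwartz_half_line" for h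
    unfolding s_def using R_plus_L2_props(5)[OF d w(1), of "emb d h"] h
    by (simp only: S_half_line_eq imageI R_plus_wmat[OF d h])
  have "R_plus_L2 d wmat3 (abs_L2pos (emb d f)) = R_plus_L2 d wmat (R_plus_L2 d wmat (R_plus_L2 d wmat (abs_L2pos (emb d f))))"
    by (simp only: R_plus_L2_mult[OF d w(2,1)] R_plus_L2_mult[OF d w(1,1)])
  also have "\<dots> = abs_L2pos (emb d (\<lambda>x. s * hank d (\<lambda>x. s * hank d (\<lambda>x. s * hank d f x) x) x))"
    by (simp only: R f S)
  also have "\<dots> = abs_L2pos (emb d (\<lambda>x. cnj s * hank d f x))"
  proof (rule abs_L2pos_cong(1))
    show "SQ (emb d (\<lambda>x. s * hank d (\<lambda>x. s * hank d (\<lambda>x. s * hank d f x) x) x))" by (intro SQ_emb S f)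
    fix x :: real assume x: "x > 0"
    have "s * (s * s) = (- \<i> * (- \<i> * - \<i>)) ^ Suc d" unfolding s_def by (simp only: power_mult_distrib)
    also have "\<dots> = cnj s" by (simp add: s_def)
    finally have s3: "s * (s * s) = cnj s" .
    have "s * hank d (\<lambda>x. s * hank d (\<lambda>x. s * hank d f x) x) x = s * (s * s) * hank d (hank d (hank d f)) x"
      by (simp only: hank_cmult mult.assoc)
    also have "hank d (hank d (hank d f)) x = hank d f x" by (rule hank_hank[OF hank_schwartz[OF f] d x])
    finally show "emb d (\<lambda>x. s * hank d (\<lambda>x. s * hank d (\<lambda>x. s * hank d f x) x) x) x = emb d (\<lambda>x. cnj s * hank d f x) x"
      by (simp only: emb_def s3)
  qed
  finally show ?thesis by (simp only: s_def)
qed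

lemma emb_mult_cnj:
  assumes "x > 0"
  shows "emb d f x * cnj (emb d g x) /\<^sub>R x = f x * (x ^ d *\<^sub>R cnj (g x))"
proof -
  have "x powr ((real d + 1) / 2) * x powr ((real d + 1) / 2) * inverse x = x ^ d"
    using emb_power[OF assms, of d] assms by (simp add: power2_eq_square)
  then have e: "complex_of_real (x powr ((real d + 1) / 2) * x powr ((real d + 1) / 2) * inverse x) = complex_of_real (x ^ d)"
    by (rule arg_cong)
  have "emb d f x * cnj (emb d g x) /\<^sub>R x = f x * (complex_of_real (x powr ((real d + 1) / 2) * x powr ((real d + 1) / 2) * inverse x) * cnj (g x))"
    using assms by (simp add: emb_def scaleR_conv_of_real)
  then show ?thesis unfolding e scaleR_conv_of_real .
qed

lemma inner_emb:
  assumes "SQ (emb d f)" "SQ (emb d g)"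
  shows "abs_L2pos (emb d f) \<bullet> abs_L2pos (emb d g) = Re (LINT x|HL. f x * (x ^ d *\<^sub>R cnj (g x)))"
proof -
  have "integrable dx_over_x (\<lambda>x. emb d f x * cnj (emb d g x))" by (rule square_integrable_mult[OF assms])
  then have m: "(\<lambda>x. emb d f x * cnj (emb d g x)) \<in> borel_measurable HL"
    by (auto dest: borel_measurable_integrable)
  show ?thesis
    unfolding inner_abs_L2pos[OF assms] integral_dx_over_x[OF m]
    by (intro arg_cong[of _ _ Re] Bochner_Integration.integral_cong refl) (simp only: space_HL greaterThan_iff emb_mult_cnj)
qed

lemma emb_inverse:
  assumes "x > 0" shows "emb d (\<lambda>x. x powr (- ((real d + 1) / 2)) *\<^sub>R u x) x = u x"
  using assms by (simp add: emb_def flip: powr_add)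

lemma measurable_emb': "f \<in> borel_measurable HL \<Longrightarrow> emb d f \<in> borel_measurable HL"
proof -
  assume f: "f \<in> borel_measurable HL"
  have "(\<lambda>x. (x powr ((real d + 1) / 2)) *\<^sub>R f x) \<in> borel_measurable HL"
    by (intro borel_measurable_scaleR f measurable_HL_borel) measurable
  then show ?thesis
    by (rule measurable_cong[THEN iffD1, rotated]) (simp add: emb_def)
qed

text \<open>On L^2 the operator of \<open>wmat\<close> is only a continuous extension; this
  identifies it with the integral, which converges by the moments of \<open>u\<close>. Paired with
  an element of S_d, the operator is moved to the other side, where by isometry it becomes that of
  the inverse \<open>wmat3\<close> and is known explicitly. Symmetry of the kernel then brings the
  Hankel transform back to \<open>w\<close>, and density of S_d concludes.\<close>

lemma hankel_representation:
  assumes d: "d > 0" and u: "\<And>k. SQ (\<lambda>x. complex_of_real x ^ k * u x)"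
    and f: "SQ f" and fu: "abs_L2pos f = R_plus_L2 d wmat (abs_L2pos u)"
  defines "w \<equiv> \<lambda>x. x powr (- ((real d + 1) / 2)) *\<^sub>R u x"
  shows "AE x in HL. f x = emb d (\<lambda>y. (- \<i>) ^ Suc d * hank d w y) x"
proof -
  define s where "s = (- \<i>) ^ Suc d"
  define V where "V y = s * hank d w y" for y
  \<comment> \<open>the Hankel transform is only known to be bounded; \<open>E\<close> makes it square-integrable\<close>
  define E where "E y = exp (- 1 * complex_of_real y)" for y
  have cE: "cnj (E y) = E y" for y by (simp add: E_def exp_cnj)
  have E1: "cmod (E y) \<le> 1" if "y > 0" for y using that by (simp add: E_def)
  have w: "integrable HL (\<lambda>x. x ^ n *\<^sub>R w x)" if "n \<ge> d" for n
    unfolding w_def by (rule integrable_HL_powers[OF d u that])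
  have Em: "E \<in> borel_measurable HL" unfolding E_def by (rule measurable_HL_exp)
  have uS: "SQ u" using u[of 0] by simp
  have fm: "f \<in> borel_measurable HL" using f by (simp add: square_integrable_def)
  have "continuous_on {0..} (hank d w)"
    by (rule continuous_on_vector_derivative, rule hank_deriv[OF w]) simp_all
  then have hm: "hank d w \<in> borel_measurable HL"
    by (intro measurable_HL_continuous) (erule continuous_on_subset, auto)
  have Vm: "V \<in> borel_measurable HL" unfolding V_def by (intro borel_measurable_times hm) simp
  define B where "B = (LINT x|HL. x ^ d * cmod (w x))"
  have B: "cmod (hank d w y) \<le> B" if "y \<ge> 0" for y
    unfolding B_def by (rule hank_bound[OF w[OF order_refl] that])
  have Ef: "SQ (\<lambda>x. E x * f x)"
    by (rule SQ_bound[OF f, of _ 1]) (use E1 in \<open>auto simp: AE_HL_iff norm_mult mult_left_le_one_le intro!: borel_measurable_times Em fm\<close>)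
  have EV: "SQ (emb d (\<lambda>x. E x * V x))"
  proof (rule SQ_bound[OF SQ_emb[OF schwartz_exp[of 1]]])
    show "emb d (\<lambda>x. E x * V x) \<in> borel_measurable HL" by (intro measurable_emb' borel_measurable_times Em Vm)
    have "cmod (emb d (\<lambda>x. E x * V x) x) \<le> B * cmod (emb d (\<lambda>x. exp (- 1 * complex_of_real x)) x)" if x: "x > 0" for x
    proof -
      have "cmod (V x) \<le> B" using B[of x] x by (simp add: V_def s_def norm_mult norm_power)
      then have "cmod (V x) * (x powr ((real d + 1) / 2) * cmod (E x)) \<le> B * (x powr ((real d + 1) / 2) * cmod (E x))"
        by (intro mult_right_mono) auto
      then show ?thesis using x by (simp add: emb_def norm_mult E_def mult_ac)
    qed
    then show "AE x in HL. cmod (emb d (\<lambda>x. E x * V x) x) \<le> B * cmod (emb d (\<lambda>x. exp (- 1 * complex_of_real x)) x)"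
      unfolding AE_HL_iff by (intro always_eventually allI impI)
  qed simp
  have test: "abs_L2pos (\<lambda>x. E x * f x) \<bullet> abs_L2pos (emb d g) = abs_L2pos (emb d (\<lambda>x. E x * V x)) \<bullet> abs_L2pos (emb d g)"
    if g: "g \<in> schwartz_half_line" for g
  proof -
    define G where "G x = E x * g x" for x
    have G: "G \<in> schwartz_half_line" unfolding G_def E_def by (rule schwartz_exp_mult[OF g]) simp
    have cG: "(\<lambda>x. cnj (G x)) \<in> schwartz_half_line" by (rule schwartz_cnj[OF G])
    have "abs_L2pos (\<lambda>x. E x * f x) \<bullet> abs_L2pos (emb d g) = abs_L2pos f \<bullet> abs_L2pos (emb d G)"
      unfolding inner_abs_L2pos[OF Ef SQ_emb[OF g]] inner_abs_L2pos[OF f SQ_emb[OF G]]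
      by (intro arg_cong[of _ _ Re] Bochner_Integration.integral_cong refl) (simp add: emb_def G_def cE mult_ac)
    also have "\<dots> = R_plus_L2 d wmat (abs_L2pos u) \<bullet> R_plus_L2 d wmat (R_plus_L2 d wmat3 (abs_L2pos (emb d G)))"
    proof -
      have W: "wmat \<in> SL2" "wmat3 \<in> SL2" by (simp_all add: wmat3(1))
      have "R_plus_L2 d wmat (R_plus_L2 d wmat3 (abs_L2pos (emb d G))) = abs_L2pos (emb d G)"
        by (simp only: R_plus_L2_mult[OF d W, symmetric] wmat3(2) sl2_rep.one[OF sl2_rep_R_plus[OF d]])
      then show ?thesis by (simp only: fu)
    qed
    also have "\<dots> = abs_L2pos u \<bullet> abs_L2pos (emb d (\<lambda>x. cnj s * hank d G x))"
      unfolding s_def R_plus_L2_wmat3[OF d G, symmetric] by (rule R_plus_L2_inner[OF d]) simp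
    also have "abs_L2pos u = abs_L2pos (emb d w)"
      by (rule abs_L2pos_cong(1)[OF uS]) (simp add: w_def emb_inverse)
    also have "abs_L2pos (emb d w) \<bullet> abs_L2pos (emb d (\<lambda>x. cnj s * hank d G x)) = Re (LINT x|HL. w x * (x ^ d *\<^sub>R cnj (cnj s * hank d G x)))"
    proof (rule inner_emb)
      show "SQ (emb d w)" by (rule abs_L2pos_cong(2)[OF uS]) (simp add: w_def emb_inverse)
      show "SQ (emb d (\<lambda>x. cnj s * hank d G x))" by (intro SQ_emb schwartz_cmult hank_schwartz G)
    qed
    also have "(LINT x|HL. w x * (x ^ d *\<^sub>R cnj (cnj s * hank d G x))) = (LINT x|HL. s * ((x ^ d *\<^sub>R w x) * hank d (\<lambda>x. cnj (G x)) x))"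
      unfolding hank_cnj by (intro Bochner_Integration.integral_cong refl) (simp add: mult_ac)
    also have "\<dots> = s * (LINT x|HL. (x ^ d *\<^sub>R w x) * hank d (\<lambda>x. cnj (G x)) x)"
      by (rule integral_mult_right_zero)
    also have "(LINT x|HL. (x ^ d *\<^sub>R w x) * hank d (\<lambda>x. cnj (G x)) x) = (LINT y|HL. hank d w y * (y ^ d *\<^sub>R cnj (G y)))"
      by (rule hank_symmetric[OF w[OF order_refl] schwartz_integrable[OF cG], symmetric])
    also have "s * \<dots> = (LINT y|HL. s * (hank d w y * (y ^ d *\<^sub>R cnj (G y))))"
      by (rule integral_mult_right_zero[symmetric])
    also have "\<dots> = (LINT y|HL. (E y * V y) * (y ^ d *\<^sub>R cnj (g y)))"
      by (intro Bochner_Integration.integral_cong refl) (simp add: V_def G_def cE mult_ac)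
    also have "Re \<dots> = abs_L2pos (emb d (\<lambda>x. E x * V x)) \<bullet> abs_L2pos (emb d g)"
      by (rule inner_emb[OF EV SQ_emb[OF g], symmetric])
    finally show ?thesis .
  qed
  define z where "z = abs_L2pos (\<lambda>x. E x * f x) - abs_L2pos (emb d (\<lambda>x. E x * V x))"
  have "z \<bullet> z = 0"
  proof (rule closed_dense_Sd[where d = d and P = "\<lambda>v. z \<bullet> v = 0"])
    show "closed {v. z \<bullet> v = 0}" by (intro closed_Collect_eq continuous_intros)
    fix v assume "v \<in> Sd d"
    then obtain g where "g \<in> schwartz_half_line" "v = abs_L2pos (emb d g)"
      unfolding S_half_line_eq by (elim imageE) (rule that; simp only:)
    then show "z \<bullet> v = 0" by (simp add: z_def inner_diff_left test)
  qed
  then have "abs_L2pos (\<lambda>x. E x * f x) = abs_L2pos (emb d (\<lambda>x. E x * V x))" by (simp add: z_def)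
  then have "AE x in HL. E x * f x = emb d (\<lambda>x. E x * V x) x" by (simp only: abs_L2pos_eq_iff[OF Ef EV])
  then have "AE x in HL. f x = emb d V x"
  proof eventually_elim
    case (elim x)
    have "E x \<noteq> 0" by (simp add: E_def)
    moreover have "emb d (\<lambda>x. E x * V x) x = E x * emb d V x" by (simp add: emb_def)
    ultimately show ?case using elim by simp
  qed
  then show ?thesis by (simp only: V_def[abs_def] s_def)
qed

text \<open>By the Lipschitz bound, \<open>g\<close> is at least half as large as at \<open>y\<close> on an interval of length
  proportional to \<open>cmod (g y)\<close> to the right of \<open>y\<close>; whence the cube.\<close>

lemma cube_decay:
  fixes g :: "real \<Rightarrow> complex"
  assumes L: "L \<ge> 0" "\<And>y z. 0 \<le> y \<Longrightarrow> y \<le> z \<Longrightarrow> z \<le> y + 1 \<Longrightarrow> cmod (g z - g y) \<le> L * (z - y)"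
    and A: "\<And>y. y \<ge> 0 \<Longrightarrow> cmod (g y) \<le> A" and int: "integrable HL (\<lambda>t. t ^ K * (cmod (g t))\<^sup>2)" and y: "y \<ge> 0"
  shows "y ^ K * cmod (g y) ^ 3 \<le> 8 * (L + A + 1) * (LINT t|HL. t ^ K * (cmod (g t))\<^sup>2)"
proof -
  define a where "a = cmod (g y)"
  \<comment> \<open>\<open>B\<close> dominates both \<open>A\<close> and \<open>L\<close>: the first
    keeps \<open>h\<close> at most 1, within the range of the Lipschitz bound, and the second keeps
    the variation of \<open>g\<close> on the interval at most a / 2. The summand 1 makes
    \<open>B\<close> positive.\<close>
  define B where "B = L + A + 1"
  define h where "h = a / (2 * B)"
  have a: "0 \<le> a" "a \<le> A" using A[OF y] by (simp_all add: a_def)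
  have B: "B > 0" "a \<le> B" "L \<le> B" using L a by (simp_all add: B_def)
  have h: "0 \<le> h" "h \<le> 1" "B * h = a / 2" using a B by (simp_all add: h_def field_simps)
  have low: "y ^ K * (a / 2)\<^sup>2 \<le> t ^ K * (cmod (g t))\<^sup>2" if t: "t \<in> {y<..y + h}" for t
  proof -
    have "cmod (g t - g y) \<le> L * (t - y)" using t y h by (intro L) auto
    also have "\<dots> \<le> B * h" using t B L y by (intro mult_mono) auto
    finally have "cmod (g t - g y) \<le> a / 2" by (simp only: h)
    then have "a / 2 \<le> cmod (g t)"
      using norm_triangle_ineq2[of "g y" "g y - g t"] by (simp add: a_def norm_minus_commute)
    then show ?thesis using t y a by (intro mult_mono power_mono) auto
  qed
  have "h * (y ^ K * (a / 2)\<^sup>2) = (LINT t|HL. indicator {y<..y + h} t * (y ^ K * (a / 2)\<^sup>2))"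
  proof -
    have "measure HL {y<..y + h} = measure lborel {y<..y + h}"
      using y by (intro measure_restrict_space) auto
    also have "\<dots> = h" using h by simp
    finally have "(LINT t|HL. indicator {y<..y + h} t) = h" by (simp add: Int_absorb2 subset_eq order.strict_trans1[OF y])
    then show ?thesis by simp
  qed
  also have "\<dots> \<le> (LINT t|HL. t ^ K * (cmod (g t))\<^sup>2)"
    by (rule integral_mono'[OF int]) (use low in \<open>auto simp: indicator_def\<close>)
  finally have "8 * B * (h * (y ^ K * (a / 2)\<^sup>2)) \<le> 8 * B * (LINT t|HL. t ^ K * (cmod (g t))\<^sup>2)"
    using B by (intro mult_left_mono) auto
  moreover have "8 * B * (h * (y ^ K * (a / 2)\<^sup>2)) = y ^ K * a ^ 3"
  proof -
    have "8 * B * (h * (y ^ K * (a / 2)\<^sup>2)) = 8 * (B * h) * (y ^ K * (a / 2)\<^sup>2)" by simp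
    then show ?thesis unfolding h(3) by (simp add: power2_eq_square power3_eq_cube)
  qed
  ultimately show ?thesis by (simp only: a_def B_def)
qed

section \<open>Rapid decay of all derivatives\<close>

lemma one_plus_power_le: "(1 + y) ^ k \<le> 2 ^ k * (1 + y ^ k)" if "y \<ge> 0" for y :: real
proof (cases "y \<le> 1")
  case True
  then have "(1 + y) ^ k \<le> 2 ^ k" using that by (intro power_mono) auto
  also have "\<dots> \<le> 2 ^ k * (1 + y ^ k)" using that by simp
  finally show ?thesis .
next
  case False
  then have "(1 + y) ^ k \<le> (2 * y) ^ k" by (intro power_mono) auto
  also have "\<dots> \<le> 2 ^ k * (1 + y ^ k)" by (simp add: power_mult_distrib)
  finally show ?thesis .
qed

text \<open>An interpolation in the manner of Landau: decay of order 2k of the function and a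
  quadratic Taylor remainder give decay of order k of the derivative. Losing half of the exponent is
  harmless, since every exponent is available.\<close>

lemma derivative_decay:
  fixes g g1 :: "real \<Rightarrow> complex"
  assumes M: "\<And>y z. y \<ge> 0 \<Longrightarrow> z \<ge> 0 \<Longrightarrow> cmod (g z - g y - (z - y) *\<^sub>R g1 y) \<le> M * (z - y)\<^sup>2"
    and dec: "\<And>k. \<exists>C. \<forall>y\<ge>0. y ^ k * cmod (g y) \<le> C"
  shows "\<exists>C. \<forall>y\<ge>0. y ^ k * cmod (g1 y) \<le> C"
proof -
  obtain C0 where C0: "\<forall>y\<ge>0. y ^ 0 * cmod (g y) \<le> C0" using dec by blast
  obtain C1 where C1: "\<forall>y\<ge>0. y ^ (2 * k) * cmod (g y) \<le> C1" using dec by blast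
  define C where "C = 2 ^ (2 * k) * (C0 + C1)"
  have C: "(1 + y) ^ (2 * k) * cmod (g y) \<le> C" if y: "y \<ge> 0" for y
  proof -
    have "(1 + y) ^ (2 * k) * cmod (g y) \<le> (2 ^ (2 * k) * (1 + y ^ (2 * k))) * cmod (g y)"
      by (intro mult_right_mono one_plus_power_le y) simp
    also have "\<dots> = 2 ^ (2 * k) * (y ^ 0 * cmod (g y) + y ^ (2 * k) * cmod (g y))" by (simp add: algebra_simps)
    also have "\<dots> \<le> C" unfolding C_def using C0 C1 y by (intro mult_left_mono add_mono) auto
    finally show ?thesis .
  qed
  have "y ^ k * cmod (g1 y) \<le> 2 * C + \<bar>M\<bar>" if y: "y \<ge> 0" for y
  proof -
    define p where "p = (1 + y) ^ k"
    \<comment> \<open>the step that balances the two error terms of the difference quotient\<close>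
    define h where "h = 1 / p"
    have p: "p \<ge> 1" using y by (simp add: p_def)
    have h: "h > 0" "p * h = 1" using p by (simp_all add: h_def)
    have pp: "p * p = (1 + y) ^ (2 * k)" by (simp add: p_def power_add[symmetric] mult_2)
    have "cmod (g (y + h) - g y - h *\<^sub>R g1 y) \<le> M * h\<^sup>2" using M[of y "y + h"] y h by simp
    moreover have "cmod (h *\<^sub>R g1 y) \<le> cmod (g (y + h)) + cmod (g y) + cmod (g (y + h) - g y - h *\<^sub>R g1 y)"
    proof -
      have "h *\<^sub>R g1 y = g (y + h) - g y - (g (y + h) - g y - h *\<^sub>R g1 y)" by simp
      then have "cmod (h *\<^sub>R g1 y) = cmod (g (y + h) - g y - (g (y + h) - g y - h *\<^sub>R g1 y))" by (rule arg_cong)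
      then show ?thesis
        using norm_triangle_ineq4[of "g (y + h) - g y" "g (y + h) - g y - h *\<^sub>R g1 y"] norm_triangle_ineq4[of "g (y + h)" "g y"]
        by linarith
    qed
    moreover have "M * h\<^sup>2 \<le> \<bar>M\<bar> * h\<^sup>2" by (intro mult_right_mono) auto
    moreover have "cmod (h *\<^sub>R g1 y) = h * cmod (g1 y)" using h by simp
    ultimately have "h * cmod (g1 y) \<le> cmod (g (y + h)) + cmod (g y) + \<bar>M\<bar> * h\<^sup>2"
      by linarith
    then have "(p * p) * (h * cmod (g1 y)) \<le> (p * p) * (cmod (g (y + h)) + cmod (g y) + \<bar>M\<bar> * h\<^sup>2)"
      using p by (intro mult_left_mono) auto
    also have "(p * p) * (h * cmod (g1 y)) = p * cmod (g1 y) * (p * h)" by (simp add: mult_ac)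
    also have "\<dots> = p * cmod (g1 y)" by (simp add: h)
    also have "(p * p) * (cmod (g (y + h)) + cmod (g y) + \<bar>M\<bar> * h\<^sup>2) = (p * p) * cmod (g (y + h)) + (p * p) * cmod (g y) + \<bar>M\<bar> * ((p * h) * (p * h))"
      by (simp add: algebra_simps power2_eq_square)
    also have "(p * p) * cmod (g (y + h)) \<le> (1 + (y + h)) ^ (2 * k) * cmod (g (y + h))"
      unfolding pp using y h by (intro mult_right_mono power_mono) auto
    also have "\<dots> \<le> C" by (rule C) (use y h in simp)
    also have "(p * p) * cmod (g y) \<le> C" unfolding pp by (rule C[OF y])
    finally have "p * cmod (g1 y) \<le> 2 * C + \<bar>M\<bar>" by (simp add: h)
    moreover have "y ^ k * cmod (g1 y) \<le> p * cmod (g1 y)"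
      unfolding p_def using y by (intro mult_right_mono power_mono) auto
    ultimately show ?thesis by simp
  qed
  then show ?thesis by blast
qed

text \<open>For the order \<open>d\<close> a Lipschitz bound and the integrals in the hypothesis
  give decay through \<open>cube_decay\<close>. Every further order is, up to sign, the derivative
  of the preceding one, so \<open>derivative_decay\<close> propagates the decay with the remainder
  from \<open>hank_taylor\<close>.\<close>

lemma hank_power_decay:
  assumes w: "\<And>n. n \<ge> d \<Longrightarrow> integrable HL (\<lambda>x. x ^ n *\<^sub>R w x)"
    and int: "\<And>k. integrable HL (\<lambda>t. t ^ (2 * k + d) * (cmod (hank d w t))\<^sup>2)" and n: "d \<le> n"
  shows "\<exists>C. \<forall>y\<ge>0. y ^ k * cmod (hank n w y) \<le> C"
  using n
proof (induction n arbitrary: k rule: dec_induct)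
  case base
  define A where "A = (LINT x|HL. x ^ d * cmod (w x))"
  define B where "B = (LINT x|HL. x ^ Suc d * cmod (w x))"
  define M where "M = (LINT x|HL. norm (x ^ (d + 2) *\<^sub>R w x))"
  have A: "cmod (hank d w y) \<le> A" if "y \<ge> 0" for y
    unfolding A_def by (rule hank_bound[OF w that]) simp
  have B: "cmod (hank (Suc d) w y) \<le> B" if "y \<ge> 0" for y
    unfolding B_def by (rule hank_bound[OF w that]) simp
  have M0: "M \<ge> 0" by (simp add: M_def)
  have A0: "A \<ge> 0" using A[of 0] norm_ge_zero[of "hank d w 0"] by linarith
  have B0: "B \<ge> 0" using B[of 0] norm_ge_zero[of "hank (Suc d) w 0"] by linarith
  have L: "cmod (hank d w z - hank d w y) \<le> (M + B) * (z - y)" if yz: "0 \<le> y" "y \<le> z" "z \<le> y + 1" for y z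
  proof -
    have "cmod (hank d w z - hank d w y - (z - y) *\<^sub>R - hank (Suc d) w y) \<le> M * (z - y)\<^sup>2"
      unfolding M_def using yz by (intro hank_taylor[OF w]) auto
    also have "\<dots> \<le> M * (z - y)"
      unfolding power2_eq_square using yz by (intro mult_left_mono M0 mult_left_le) auto
    finally have 1: "cmod (hank d w z - hank d w y - (z - y) *\<^sub>R - hank (Suc d) w y) \<le> M * (z - y)" .
    have "cmod ((z - y) *\<^sub>R - hank (Suc d) w y) = (z - y) * cmod (hank (Suc d) w y)" using yz by simp
    also have "\<dots> \<le> (z - y) * B" using yz by (intro mult_left_mono B) auto
    finally have 2: "cmod ((z - y) *\<^sub>R - hank (Suc d) w y) \<le> (z - y) * B" .
    have "(M + B) * (z - y) = M * (z - y) + (z - y) * B" by (simp add: algebra_simps)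
    then show ?thesis
      using norm_triangle_ineq2[of "hank d w z - hank d w y" "(z - y) *\<^sub>R - hank (Suc d) w y"] 1 2 by linarith
  qed
  \<comment> \<open>The hypothesis at 3k: what has to be bounded is the cube of
    \<open>y ^ k * cmod (hank d w y)\<close>, and \<open>K >= 3 * k\<close>.\<close>
  define K where "K = 2 * (3 * k) + d"
  define D where "D = 8 * (M + B + A + 1) * (LINT t|HL. t ^ K * (cmod (hank d w t))\<^sup>2)"
  have D: "y ^ K * cmod (hank d w y) ^ 3 \<le> D" if "y \<ge> 0" for y
    unfolding D_def using M0 B0 by (intro cube_decay[OF _ L A int[of "3 * k", folded K_def] that]) simp
  have "y ^ k * cmod (hank d w y) \<le> 1 + (A ^ 3 + D)" if y: "y \<ge> 0" for y
  proof -
    define t where "t = y ^ k * cmod (hank d w y)"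
    have t: "t \<ge> 0" using y by (simp add: t_def)
    have "y ^ (3 * k) \<le> 1 + y ^ K"
    proof (cases "y \<le> 1")
      case True
      then have "y ^ (3 * k) \<le> 1" using y by (intro power_le_one)
      then show ?thesis using zero_le_power[OF y, of K] by linarith
    next
      case False
      then have "y ^ (3 * k) \<le> y ^ K" by (intro power_increasing) (auto simp: K_def)
      then show ?thesis by simp
    qed
    then have "y ^ (3 * k) * cmod (hank d w y) ^ 3 \<le> (1 + y ^ K) * cmod (hank d w y) ^ 3"
      by (rule mult_right_mono) simp
    moreover have "t ^ 3 = y ^ (3 * k) * cmod (hank d w y) ^ 3"
      by (simp add: t_def power_mult_distrib power_mult[symmetric] mult.commute)
    moreover have "(1 + y ^ K) * cmod (hank d w y) ^ 3 = cmod (hank d w y) ^ 3 + y ^ K * cmod (hank d w y) ^ 3"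
      by (simp add: algebra_simps)
    moreover have "cmod (hank d w y) ^ 3 \<le> A ^ 3" by (intro power_mono A y) simp
    ultimately have t3: "t ^ 3 \<le> A ^ 3 + D" using D[OF y] by linarith
    have "t \<le> 1 + t ^ 3"
    proof (cases "t \<le> 1")
      case True then show ?thesis using t zero_le_power[OF t, of 3] by linarith
    next
      case False
      then have "t ^ 1 \<le> t ^ 3" by (intro power_increasing) auto
      then show ?thesis by simp
    qed
    with t3 show ?thesis unfolding t_def by linarith
  qed
  then show ?case by blast
next
  case (step n)
  have dn: "d \<le> n" by fact
  have "\<exists>C. \<forall>y\<ge>0. y ^ k * cmod (- hank (Suc n) w y) \<le> C"
    by (rule derivative_decay[OF hank_taylor[OF w] step.IH]) (use dn in auto)
  then show ?case by (simp only: norm_minus_cancel)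
qed

lemma hank_schwartz_of_decay:
  assumes w: "\<And>n. n \<ge> d \<Longrightarrow> integrable HL (\<lambda>x. x ^ n *\<^sub>R w x)"
    and int: "\<And>k. integrable HL (\<lambda>t. t ^ (2 * k + d) * (cmod (hank d w t))\<^sup>2)"
  shows "hank d w \<in> schwartz_half_line"
proof (rule schwartz_coinduct)
  \<comment> \<open>The orders start at \<open>d\<close>, because moments of \<open>w\<close> are
    known to be integrable from order \<open>d\<close> on.\<close>
  define C where "C = {h. \<exists>c n. d \<le> n \<and> h = (\<lambda>y. c * hank n w y)}"
  have "hank d w = (\<lambda>y. 1 * hank d w y)" by simp
  then show "hank d w \<in> C" unfolding C_def mem_Collect_eq by (intro exI conjI) (rule order_refl)
  fix g assume "g \<in> C"
  then obtain c n where n: "d \<le> n" and g: "g = (\<lambda>y. c * hank n w y)"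
    unfolding C_def mem_Collect_eq by (elim exE conjE) (rule that; assumption)
  show "\<exists>B. \<forall>x\<ge>0. x ^ k * cmod (g x) \<le> B" for k
  proof -
    obtain B where B: "\<forall>y\<ge>0. y ^ k * cmod (hank n w y) \<le> B" using hank_power_decay[OF w int n] by blast
    have "x ^ k * cmod (g x) \<le> cmod c * B" if "x \<ge> 0" for x
    proof -
      have "cmod c * (x ^ k * cmod (hank n w x)) \<le> cmod c * B" using B that by (intro mult_left_mono) auto
      then show ?thesis by (simp add: g norm_mult mult_ac)
    qed
    then show ?thesis by blast
  qed
  show "\<exists>g'\<in>C. \<forall>x\<ge>0. (g has_vector_derivative g' x) (at x within {0..})"
  proof (rule bexI[of _ "\<lambda>y. (- c) * hank (Suc n) w y"])
    show "(\<lambda>y. (- c) * hank (Suc n) w y) \<in> C"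
      unfolding C_def mem_Collect_eq using n by (intro exI[of _ "- c"] exI[of _ "Suc n"] conjI refl) simp
    show "\<forall>x\<ge>0. (g has_vector_derivative (- c) * hank (Suc n) w x) (at x within {0..})"
    proof (intro allI impI)
      fix x :: real assume x: "x \<ge> 0"
      have "(hank n w has_vector_derivative - hank (Suc n) w x) (at x within {0..})"
        by (rule hank_deriv[OF w x]) (use n in simp)
      from has_vector_derivative_mult_right[OF this, of c]
      show "(g has_vector_derivative (- c) * hank (Suc n) w x) (at x within {0..})" by (simp add: g)
    qed
  qed
qed

lemma smooth_subset_Sd:
  assumes d: "d > 0" shows "smooth_vectors (R_plus_L2 d) \<subseteq> Sd d"
proof
  fix v assume "v \<in> smooth_vectors (R_plus_L2 d)"
  then have sm: "smooth_on_SL2 (\<lambda>g. R_plus_L2 d g v)" by (simp add: smooth_vectors_def)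
  interpret sl2_rep "R_plus_L2 d" "Sd d" by (rule sl2_rep_R_plus[OF d])
  have W: "wmat \<in> SL2" "wmat3 \<in> SL2" by (simp_all add: wmat3(1))
  have one_SL2: "mat 1 \<in> (SL2 :: (real ^ 2 ^ 2) set)" by (simp add: mat_1_mat2)
  define u where "u = rep_L2pos (R_plus_L2 d wmat3 v)"
  define f where "f = rep_L2pos v"
  have uS: "SQ u" "abs_L2pos u = R_plus_L2 d wmat3 v" and fS: "SQ f" "abs_L2pos f = v"
    by (simp_all only: u_def f_def rep_L2pos)
  have u: "SQ (\<lambda>x. complex_of_real x ^ k * u x)" for k
    by (rule smooth_vector_powers[OF d sm W(2) uS])
  have f: "SQ (\<lambda>x. complex_of_real x ^ k * f x)" for k
    by (rule smooth_vector_powers[OF d sm one_SL2 fS(1)]) (simp only: fS one)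
  have fu: "abs_L2pos f = R_plus_L2 d wmat (abs_L2pos u)"
    by (simp only: fS uS mult[OF W(1,2), symmetric] wmat3(2) one)
  define w where "w = (\<lambda>x. x powr (- ((real d + 1) / 2)) *\<^sub>R u x)"
  define V where "V y = (- \<i>) ^ Suc d * hank d w y" for y
  have fV: "AE x in HL. f x = emb d V x"
    unfolding V_def[abs_def] w_def by (rule hankel_representation[OF d u fS(1) fu])
  have w: "integrable HL (\<lambda>x. x ^ n *\<^sub>R w x)" if "n \<ge> d" for n
    unfolding w_def by (rule integrable_HL_powers[OF d u that])
  have "continuous_on {0..} (hank d w)"
    by (rule continuous_on_vector_derivative, rule hank_deriv[OF w]) simp_all
  then have hm: "hank d w \<in> borel_measurable HL"
    by (intro measurable_HL_continuous) (erule continuous_on_subset, auto)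
  \<comment> \<open>Almost everywhere the squared modulus of \<open>f\<close> is x^(d+1) times that
    of the Hankel transform; the density 1/x removes one power.\<close>
  have int: "integrable HL (\<lambda>t. t ^ (2 * k + d) * (cmod (hank d w t))\<^sup>2)" for k
  proof -
    have "integrable dx_over_x (\<lambda>x. (cmod (complex_of_real x ^ k * f x))\<^sup>2)"
      using f[of k] by (simp add: square_integrable_def)
    moreover have "(\<lambda>x. complex_of_real x ^ k * f x) \<in> borel_measurable HL"
      using f[of k] by (simp add: square_integrable_def)
    then have "(\<lambda>x. (cmod (complex_of_real x ^ k * f x))\<^sup>2) \<in> borel_measurable HL"
      by measurable
    ultimately have i: "integrable HL (\<lambda>x. (cmod (complex_of_real x ^ k * f x))\<^sup>2 /\<^sub>R x)"
      by (simp only: integrable_dx_over_x)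
    show ?thesis
    proof (rule integrable_cong_AE_imp[OF i])
      show "(\<lambda>t. t ^ (2 * k + d) * (cmod (hank d w t))\<^sup>2) \<in> borel_measurable HL"
        by (intro borel_measurable_times borel_measurable_power measurable_compose[OF hm borel_measurable_norm] measurable_HL_borel) simp_all
      have pos: "AE x in HL. x > 0" by (simp add: AE_HL_iff)
      show "AE x in HL. (cmod (complex_of_real x ^ k * f x))\<^sup>2 /\<^sub>R x = x ^ (2 * k + d) * (cmod (hank d w x))\<^sup>2"
        using fV pos
      proof eventually_elim
        case (elim x)
        have "(cmod (f x))\<^sup>2 = x ^ Suc d * (cmod (hank d w x))\<^sup>2"
          using elim by (simp add: emb_def V_def norm_mult norm_power power_mult_distrib emb_power)
        then have "(cmod (complex_of_real x ^ k * f x))\<^sup>2 = (x ^ k)\<^sup>2 * (x ^ Suc d * (cmod (hank d w x))\<^sup>2)"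
          using elim by (simp add: norm_mult norm_power power_mult_distrib)
        then show ?case
          using elim by (simp add: power_add power_mult[symmetric] mult.commute[of k])
      qed
    qed
  qed
  have V: "V \<in> schwartz_half_line"
    unfolding V_def[abs_def] by (intro schwartz_cmult hank_schwartz_of_decay w int)
  have "v = abs_L2pos (emb d V)"
    using fV abs_L2pos_eq_iff[OF fS(1) SQ_emb[OF V], of d] fS(2) by simp
  then show "v \<in> Sd d" using V by (simp add: S_half_line_eq)
qed

section \<open>The minus sign\<close>

lemma C_k_on_compose_linear:
  assumes L: "bounded_linear L" and U: "open U" and C: "C_k_on k U F"
  shows "C_k_on k (L -` U) (\<lambda>x. F (L x))"
proof -
  have V: "open (L -` U)" by (rule open_vimage[OF U linear_continuous_on[OF L]])
  show ?thesis
    using C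
  proof (induction k arbitrary: F)
    case 0
    then show ?case
      using continuous_on_compose2[OF _ linear_continuous_on[OF L, of "L -` U"], of U F] by simp
  next
    case (Suc k)
    show ?case
    proof (rule C_k_on_SucI'[OF V])
      fix x assume "x \<in> L -` U"
      then have "(F has_derivative frechet_derivative F (at (L x))) (at (L x))"
        by (intro C_k_on_Suc_D[OF Suc.prems]) simp
      then show "((\<lambda>x. F (L x)) has_derivative (\<lambda>v. frechet_derivative F (at (L x)) (L v))) (at x)"
        by (rule has_derivative_compose[OF bounded_linear_imp_has_derivative[OF L]])
    next
      fix v
      show "C_k_on k (L -` U) (\<lambda>x. frechet_derivative F (at (L x)) (L v))"
        by (rule Suc.IH) (use Suc.prems in simp)
    qed
  qed
qed

text \<open>On the line this conjugation corresponds to x -> -x, hence to \<open>reflect\<close> on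
  functions.\<close>

definition flip :: "real ^ 2 ^ 2 \<Rightarrow> real ^ 2 ^ 2" where
  "flip g = mat2 1 0 0 (- 1) ** g ** mat2 1 0 0 (- 1)"

lemma flip_nth [simp]: "flip g $ 1 $ 1 = g $ 1 $ 1" "flip g $ 1 $ 2 = - g $ 1 $ 2"
  "flip g $ 2 $ 1 = - g $ 2 $ 1" "flip g $ 2 $ 2 = g $ 2 $ 2"
  by (simp_all add: flip_def mat2_mult_nth)

lemma flip_SL2 [simp]: "flip g \<in> SL2 \<longleftrightarrow> g \<in> SL2"
  by (simp add: SL2_def det_2)

lemma flip_flip [simp]: "flip (flip g) = g"
  by (simp add: mat2_eq_iff)

lemma bounded_linear_flip: "bounded_linear flip"
  unfolding linear_conv_bounded_linear[symmetric] by (rule linearI) (simp_all add: mat2_eq_iff)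

text \<open>Since \<open>flip\<close> is linear on the space of all matrices, local smooth
  extensions pull back along it to local smooth extensions.\<close>

lemma smooth_on_SL2_flip:
  assumes F: "smooth_on_SL2 F" and G: "\<And>g. g \<in> SL2 \<Longrightarrow> G g = F (flip g)"
  shows "smooth_on_SL2 G"
  unfolding smooth_on_SL2_def
proof
  fix g :: "real ^ 2 ^ 2" assume g: "g \<in> SL2"
  then have fg: "flip g \<in> SL2" by simp
  obtain U F' where U: "flip g \<in> U" "smooth_on_open U F'" "\<forall>h\<in>U \<inter> SL2. F' h = F h"
    using bspec[OF F[unfolded smooth_on_SL2_def] fg] by (elim exE conjE) (rule that; assumption)
  have oU: "open U" and C: "C_k_on k U F'" for k using U(2) by (simp_all add: smooth_on_open_def)
  show "\<exists>U F'. g \<in> U \<and> smooth_on_open U F' \<and> (\<forall>h\<in>U \<inter> SL2. F' h = G h)"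
  proof (intro exI conjI)
    show "g \<in> flip -` U" using U(1) by simp
    show "smooth_on_open (flip -` U) (\<lambda>h. F' (flip h))"
      unfolding smooth_on_open_def
      by (intro conjI allI C_k_on_compose_linear[OF bounded_linear_flip oU C]
        open_vimage[OF oU linear_continuous_on[OF bounded_linear_flip]])
    show "\<forall>h\<in>flip -` U \<inter> SL2. F' (flip h) = G h" using U(3) G by simp
  qed
qed

lemma integral_lborel_reflect: "(LINT x|lborel. f (- x)) = (LINT x|lborel. f x)"
  for f :: "real \<Rightarrow> 'a::{banach, second_countable_topology}"
  using lborel_integral_real_affine[of "- 1" f 0] by simp

lemma T_op_reflect: "T_op d (reflect f) = reflect (T_op d f)"
proof
  fix z
  show "T_op d (reflect f) z = reflect (T_op d f) z"
    unfolding T_op_def reflect_def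
    by (subst integral_lborel_reflect[symmetric]) simp
qed

lemma M_op_reflect: "reflect (M_op d \<phi>) = M_op d (reflect \<phi>)"
proof
  fix y
  show "reflect (M_op d \<phi>) y = M_op d (reflect \<phi>) y"
    unfolding M_op_def reflect_def
    by (subst integral_lborel_reflect[symmetric]) simp
qed

text \<open>Replacing x by -x and changing the sign of the value reverses the signs of both
  off-diagonal entries. The pole is set aside because both values there are limits.\<close>

lemma pi_rep_reflect_finite:
  assumes g: "g \<in> SL2"
  shows "finite {x. reflect (pi_rep d g (reflect \<phi>)) x \<noteq> pi_rep d (flip g) \<phi> x}"
proof (rule finite_subset)
  have "flip g \<in> SL2" using g by simp
  then have "g $ 2 $ 1 \<noteq> 0 \<or> g $ 1 $ 1 \<noteq> 0" by (auto simp: SL2_def det_2)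
  then show "finite {x. - g $ 2 $ 1 * x + g $ 1 $ 1 = 0}" by (intro finite_linear) simp
  have "reflect (pi_rep d g (reflect \<phi>)) x = pi_rep d (flip g) \<phi> x" if "- g $ 2 $ 1 * x + g $ 1 $ 1 \<noteq> 0" for x
  proof -
    have "- ((g $ 2 $ 2 * - x + g $ 1 $ 2) / (g $ 2 $ 1 * - x + g $ 1 $ 1)) = (g $ 2 $ 2 * x - g $ 1 $ 2) / (- g $ 2 $ 1 * x + g $ 1 $ 1)"
      by (simp add: minus_divide_left)
    then show ?thesis using that by (simp add: pi_rep_def Let_def reflect_def)
  qed
  then show "{x. reflect (pi_rep d g (reflect \<phi>)) x \<noteq> pi_rep d (flip g) \<phi> x} \<subseteq> {x. - g $ 2 $ 1 * x + g $ 1 $ 1 = 0}"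
    by auto
qed

lemma R_minus_eq: "g \<in> SL2 \<Longrightarrow> R_minus d g = R_plus d (flip g)"
  unfolding R_minus_def R_plus_def T_op_reflect M_op_reflect
  by (rule ext, rule M_op_cong_finite[OF pi_rep_reflect_finite])

lemma smooth_vectors_minus: "smooth_vectors (R_minus_L2 d) = smooth_vectors (R_plus_L2 d)"
proof -
  have eq: "R_minus_L2 d g v = R_plus_L2 d (flip g) v" if "g \<in> SL2" for g v
    using that by (simp only: R_minus_L2_def R_plus_L2_def R_minus_eq)
  have "smooth_on_SL2 (\<lambda>g. R_minus_L2 d g v) \<longleftrightarrow> smooth_on_SL2 (\<lambda>g. R_plus_L2 d g v)" for v
  proof
    assume "smooth_on_SL2 (\<lambda>g. R_minus_L2 d g v)"
    then show "smooth_on_SL2 (\<lambda>g. R_plus_L2 d g v)"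
      by (rule smooth_on_SL2_flip) (simp add: eq)
  next
    assume "smooth_on_SL2 (\<lambda>g. R_plus_L2 d g v)"
    then show "smooth_on_SL2 (\<lambda>g. R_minus_L2 d g v)"
      by (rule smooth_on_SL2_flip) (rule eq)
  qed
  then show ?thesis by (simp add: smooth_vectors_def)
qed

theorem theorem5p3:
  fixes d :: nat
  assumes "d > 0"
  shows "smooth_vectors (R_plus_L2 d) = abs_L2pos ` S_half_line d \<and>
         smooth_vectors (R_minus_L2 d) = abs_L2pos ` S_half_line d"
  unfolding smooth_vectors_minus
  using subset_antisym[OF smooth_subset_Sd[OF assms] Sd_subset_smooth[OF assms]] by simp

end
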